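(* Let $\overline{N}(s,m,n)$ denote the number of overpartitions of $n$ whose rank is congruent to $s$ modulo $m$ (with the convention that $\overline{N}(s,m,0)=0$ for all $s,m$), and for $\ell=3$ set $$R_{st}(d)=\sum_{n\ge 0}\left(\overline{N}(s,3,3n+d)-\overline{N}(t,3,3n+d)\right)q^n.$$ Then, as formal power series in $q$ (equivalently, as analytic functions for $|q|<1$), $$R_{01}(0)=-1+\frac{(q^3;q^3)_\infty^2(-q;q)_\infty}{(q;q)_\infty(-q^3;q^3)_\infty^2},$$ $$R_{01}(1)=\frac{2(q^3;q^3)_\infty(q^6;q^6)_\infty}{(q;q)_\infty},$$ $$R_{01}(2)=\frac{4(-q^3;q^3)_\infty^2(q^6;q^6)_\infty^2}{(q^2;q^2)_\infty}-\frac{6(-q^3;q^3)_\infty}{(q^3;q^3)_\infty}\sum_{n\in\mathbb{Z}}\frac{(-1)^nq^{3n^2+3n}}{1-q^{3n+1}}.$$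
   Context: An overpartition of $n$ is a partition of $n$ in which the first occurrence of each distinct part may be overlined. The rank of an overpartition is its largest part minus its number of parts. $\overline{N}(s,m,n)$ is the number of overpartitions of $n$ with rank congruent to $s$ modulo $m$; the empty overpartition of $0$ is not counted, i.e. $\overline{N}(s,m,0)=0$. Notation: $(a_1,\dots,a_j;q)_\infty=\prod_{k\ge0}(1-a_1q^k)\cdots(1-a_jq^k)$. *)

theory Defs
  imports
    "HOL-Library.Multiset"
    "HOL-Number_Theory.Cong"
    "HOL-Computational_Algebra.Formal_Laurent_Series"
    "HOL-Analysis.Analysis"
begin

text \<open>
  An overpartition is encoded as a pair of the multiset of its parts and the set of those part
  sizes whose first occurrence is overlined.
\<close>

definition overpartitions :: "nat \<Rightarrow> (nat multiset \<times> nat set) set" where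
  "overpartitions n = {(M, S). (\<forall>x\<in>#M. x > 0) \<and> sum_mset M = n \<and> S \<subseteq> set_mset M}"

text \<open>Only meaningful for a nonempty overpartition, as \<open>Max {}\<close> is unspecified.\<close>

definition overpartition_rank :: "nat multiset \<times> nat set \<Rightarrow> int" where
  "overpartition_rank p = int (Max (set_mset (fst p))) - int (size (fst p))"

definition Nbar :: "int \<Rightarrow> int \<Rightarrow> nat \<Rightarrow> nat" where
  "Nbar s m n =
     (if n = 0 then 0
      else card {p \<in> overpartitions n. [overpartition_rank p = s] (mod m)})"

text \<open>
  Power series in \<open>q\<close> are taken in the field of formal Laurent series, with \<open>q = fls_X\<close>, because
  the terms of negative index in the bilateral sum of the main theorem are written with negative
  powers of \<open>q\<close>. Infinite sums and products refer to the metric topology on this field (the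
  \<open>q\<close>-adic one). The integer coefficients are embedded into the complex numbers.
\<close>

definition rank_diff :: "nat \<Rightarrow> int \<Rightarrow> int \<Rightarrow> nat \<Rightarrow> complex fls" where
  "rank_diff l s t d =
     fps_to_fls (Abs_fps (\<lambda>n.
       of_nat (Nbar s (int l) (l * n + d)) - of_nat (Nbar t (int l) (l * n + d))))"

definition qpoch_inf :: "complex fls \<Rightarrow> complex fls \<Rightarrow> complex fls" where
  "qpoch_inf a q = prodinf (\<lambda>k. 1 - a * q ^ k)"

end

theory Submission
  imports Defs "HOL-Library.Groups_Big_Fun"
begin

text \<open>
  Counted by number of parts and largest part, overpartitions have generating functions
  \<open>2 q\<^sup>a\<^sup>+\<^sup>c\<^sup>+\<^sup>1 X(a,c)\<close> with symmetric
      \<open>q\<close>-Delannoy polynomials \<open>X\<close>. The symmetry yields a Dyson type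
  recurrence for the number of overpartitions whose rank is at least \<open>m\<close>, which is
      solved by
  partial theta series. Hence the series \<open>D\<close> of the rank differences (with constant
      term \<open>1\<close>)
  satisfies \<open>\<theta>(q) D = 1 + 6 \<Sum> (-1)\<^sup>n q^(n\<^sup>2+n) / (1 -
      q^(3n))\<close>, the sum being over all
  \<open>n \<noteq> 0\<close>, where \<open>\<theta>(q) = \<Sum> (-1)\<^sup>n q^(n\<^sup>2)\<close>.

  Both sides are split according to the exponent modulo \<open>3\<close>. With \<open>x =
      q\<^sup>3\<close>,
  \<open>\<theta>(q) = P - 2 q W\<close> for theta series \<open>P\<close>, \<open>W\<close> in
      \<open>x\<close>, and the three classes of \<open>D\<close> solve a
  linear system whose determinant \<open>P\<^sup>3 - 8 x W\<^sup>3\<close> is the product of the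
      \<open>\<theta>(\<omega>\<^sup>j q)\<close>, hence an
  infinite product. The right-hand side of the equation for the first class contains two
  Lambert series; they combine to the derivative \<open>\<Sum> (1 - 6k) x^(k(3k-1)/2)\<close>,
      because
  \<open>T(k) = \<Sum> (-1)\<^sup>n x^(n(n+1)/2 - kn) / (1 - x\<^sup>n)\<close>, the sum over
      \<open>n \<noteq> 0\<close>, telescopes to \<open>- k\<close>. The
  derivative is evaluated by the quintuple product identity.
\<close>

section \<open>Summable families of Laurent series\<close>

text \<open>For a fixed number of parts, the count with a single bound on the parts is not a
  monomial times a symmetric polynomial, but the sum over two consecutive bounds is. Ranks therefore
  enter through pairs of consecutive thresholds, and the empty overpartition is counted twice until
  a factor \<open>2\<close> is cancelled. The added constant \<open>1\<close> restores the empty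
  overpartition dropped by the convention at \<open>n = 0\<close>; it becomes the \<open>- 1\<close>
  of the first formula. The obstacle is that the two Lambert series and the bilateral sum are not
  evaluated separately. In the eliminated equation for the first class they have coefficients
  proportional to \<open>P\<close> and \<open>x * W\<close>. Since
  \<open>2 * theta_W * theta_J = theta 3 * theta_K\<close>, multiplication by \<open>theta_J\<close>
  makes these proportional to \<open>theta_J\<close> and \<open>x * theta_K\<close>, the
  coefficients that the interchange of a double series produces. So the whole right-hand side
  collapses to theta series. The second equation of the system is homogeneous and gives the second
  class from the first; the third equation keeps the bilateral sum, which is why it survives in the
  last formula.\<close>

definition vanishes_below :: "int \<Rightarrow> 'a::field fls \<Rightarrow> bool"
  where "vanishes_below N f \<longleftrightarrow> (\<forall>n<N. fls_nth f n = 0)"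

text \<open>Zero is a separate case because \<open>fls_subdegree 0\<close> is \<open>0\<close>,
  whereas \<open>vanishes_below\<close> gives zero arbitrarily high order.\<close>

lemma low_iff: "vanishes_below N f \<longleftrightarrow> f = 0 \<or> N \<le> fls_subdegree f"
proof
  assume "vanishes_below N f"
  then show "f = 0 \<or> N \<le> fls_subdegree f"
    unfolding vanishes_below_def using nth_fls_subdegree_nonzero by (meson not_le)
qed (auto simp: vanishes_below_def)

lemma low_0 [simp]: "vanishes_below N 0"
  by (simp add: vanishes_below_def)

lemma low_add: "vanishes_below N f \<Longrightarrow> vanishes_below N g \<Longrightarrow>
    vanishes_below N (f + g)"
  by (simp add: vanishes_below_def)

lemma low_diff: "vanishes_below N f \<Longrightarrow> vanishes_below N g \<Longrightarrow>
    vanishes_below N (f - g)"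
  by (simp add: vanishes_below_def)

lemma low_uminus [simp]: "vanishes_below N (- f) \<longleftrightarrow> vanishes_below N f"
  by (simp add: vanishes_below_def)

lemma low_mono: "vanishes_below N f \<Longrightarrow> M \<le> N \<Longrightarrow> vanishes_below
    M f"
  by (auto simp: vanishes_below_def)

lemma low_mult: "vanishes_below N f \<Longrightarrow> vanishes_below M g \<Longrightarrow>
    vanishes_below (N + M) (f * g)"
  by (cases "f * g = 0") (auto simp: low_iff)

lemma low_mult0: "vanishes_below N f \<Longrightarrow> vanishes_below 0 g \<Longrightarrow>
    vanishes_below N (f * g)"
  using low_mult[of N f 0 g] by simp

lemma low_0_mult: "vanishes_below 0 f \<Longrightarrow> vanishes_below N g \<Longrightarrow>
    vanishes_below N (f * g)"
  using low_mult[of 0 f N g] by simp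

lemma low_sum: "(\<And>i. i \<in> A \<Longrightarrow> vanishes_below N (f i)) \<Longrightarrow>
    vanishes_below N (sum f A)"
  by (induction A rule: infinite_finite_induct) (auto intro: low_add)

lemma low_prod0: "(\<And>i. i \<in> A \<Longrightarrow> vanishes_below 0 (f i)) \<Longrightarrow>
    vanishes_below 0 (prod f A)"
proof (induction A rule: infinite_finite_induct)
  case (insert x F)
  then show ?case by (auto intro: low_mult0)
qed (auto simp: low_iff)

lemma low_ex: "\<exists>N. vanishes_below N f"
  using low_iff by blast

lemma low_all_imp_0: "(\<And>N. vanishes_below N f) \<Longrightarrow> f = 0"
  by (metis low_iff add_le_same_cancel1 not_one_le_zero)

lemma eq_lowI: "(\<And>N. vanishes_below N (f - g)) \<Longrightarrow> f = g"
  using low_all_imp_0[of "f - g"] by simp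

lemma low_1 [simp]: "vanishes_below N 1 \<longleftrightarrow> N \<le> 0"
  by (simp add: low_iff)

lemma low_of_int [simp]: "vanishes_below 0 (of_int n :: 'a::field fls)"
  by (simp add: vanishes_below_def fls_of_int_nth)

lemma low_of_nat [simp]: "vanishes_below 0 (of_nat n :: 'a::field fls)"
  by (simp add: vanishes_below_def fls_of_nat_nth)

lemma low_numeral: "vanishes_below 0 (numeral n :: 'a::field fls)"
  by (metis low_of_nat of_nat_numeral)

lemma low_inverse_1: "vanishes_below 1 f \<Longrightarrow> vanishes_below 0 (1 / (1 - f ::
    'a::field fls))"
proof -
  assume "vanishes_below 1 f"
  then have "fls_nth (1 - f) 0 = 1" "vanishes_below 0 (1 - f)"
    by (auto simp: vanishes_below_def)
  then have "fls_subdegree (1 - f) = 0"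
    by (metis fls_subdegree_leI low_iff order_antisym one_neq_zero fls_zero_nth)
  then show ?thesis
    by (simp add: low_iff divide_inverse fls_inverse_subdegree)
qed

text \<open>In a nonarchimedean complete field, terms tending to zero off finite sets are already
  unconditionally summable.\<close>

definition null_family :: "('i \<Rightarrow> 'a::field fls) \<Rightarrow> bool"
  where "null_family f \<longleftrightarrow> (\<forall>N. finite {i. \<not> vanishes_below N (f
      i)})"

text \<open>Meaningful only for null families: \<open>Sum_any\<close> is \<open>0\<close> on an
    infinite support.\<close>

definition fsum :: "('i \<Rightarrow> 'a::field fls) \<Rightarrow> 'a fls"
  where "fsum f = Abs_fls (\<lambda>n. Sum_any (\<lambda>i. fls_nth (f i) n))"

lemma null_familyD: "null_family f \<Longrightarrow> finite {i. \<not> vanishes_below N (f i)}"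
  by (simp add: null_family_def)

lemma null_familyI:
  assumes "\<And>i. vanishes_below (e i) (f i)" "\<And>N. finite {i. e i < N}"
  shows "null_family f"
  unfolding null_family_def
proof
  fix N
  have "{i. \<not> vanishes_below N (f i)} \<subseteq> {i. e i < N}"
    using assms(1) low_mono by (metis Collect_mono not_le)
  then show "finite {i. \<not> vanishes_below N (f i)}"
    using assms(2) finite_subset by blast
qed

lemma null_family_nth: "null_family f \<Longrightarrow> finite {i. fls_nth (f i) n \<noteq> 0}"
  by (rule finite_subset[OF _ null_familyD[of f "n + 1"]]) (auto simp: vanishes_below_def)

text \<open>All but finitely many members have no negative exponents, so only finitely many bounds
  are compared. The common bound is what lets \<open>Abs_fls\<close> represent the coefficientwise
  sum.\<close>

lemma null_family_lower:
  assumes "null_family f"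
  obtains N where "\<And>i. vanishes_below N (f i)"
proof -
  let ?A = "{i. \<not> vanishes_below 0 (f i)}"
  have fin: "finite ?A" using assms by (rule null_familyD)
  have "\<forall>i. \<exists>N. vanishes_below N (f i)" using low_ex by blast
  then obtain b where b: "vanishes_below (b i) (f i)" for i
    using choice by metis
  define N where "N = Min (insert 0 (b ` ?A))"
  have "vanishes_below N (f i)" for i
  proof (cases "vanishes_below 0 (f i)")
    case True
    then show ?thesis by (rule low_mono) (simp add: N_def fin)
  next
    case False
    then have "N \<le> b i" unfolding N_def using fin by (intro Min_le) auto
    then show ?thesis using b low_mono by blast
  qed
  then show ?thesis using that by blast
qed

lemma fsum_nth:
  assumes "null_family f"
  shows "fls_nth (fsum f) n = Sum_any (\<lambda>i. fls_nth (f i) n)"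
proof -
  obtain N where "vanishes_below N (f i)" for i using null_family_lower[OF assms] by blast
  then have "\<forall>n<N. Sum_any (\<lambda>i. fls_nth (f i) n) = 0"
    by (simp add: vanishes_below_def)
  then show ?thesis
    unfolding fsum_def by (rule nth_Abs_fls_lower_bound)
qed

lemma fsum_approx:
  assumes "null_family f" "finite A" "{i. \<not> vanishes_below N (f i)} \<subseteq> A"
  shows "vanishes_below N (fsum f - sum f A)"
  unfolding vanishes_below_def
proof (intro allI impI)
  fix n assume "n < N"
  then have "{i. fls_nth (f i) n \<noteq> 0} \<subseteq> A"
    using assms(3) by (auto simp: vanishes_below_def)
  then show "fls_nth (fsum f - sum f A) n = 0"
    using assms(1,2) by (simp add: fsum_nth Sum_any.expand_superset fls_nth_sum)
qed

lemma fsum_eqI: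
  assumes "null_family f"
    and "\<And>N. \<exists>A0. finite A0 \<and> (\<forall>A. finite A \<longrightarrow> A0
        \<subseteq> A \<longrightarrow> vanishes_below N (S - sum f A))"
  shows "fsum f = S"
proof (rule eq_lowI)
  fix N
  obtain A0 where A0: "finite A0" "\<And>A. finite A \<Longrightarrow> A0 \<subseteq> A
      \<Longrightarrow> vanishes_below N (S - sum f A)"
    using assms(2) by blast
  let ?A = "A0 \<union> {i. \<not> vanishes_below N (f i)}"
  have fin: "finite ?A" using A0(1) null_familyD[OF assms(1)] by simp
  have "vanishes_below N (fsum f - sum f ?A)" by (rule fsum_approx[OF assms(1) fin]) auto
  moreover have "vanishes_below N (S - sum f ?A)" using A0(2) fin by blast
  ultimately have "vanishes_below N ((fsum f - sum f ?A) - (S - sum f ?A))" by (rule low_diff)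
  then show "vanishes_below N (fsum f - S)" by simp
qed

lemma low_fsum:
  assumes "null_family f" "\<And>i. vanishes_below N (f i)"
  shows "vanishes_below N (fsum f)"
  using assms by (auto simp: vanishes_below_def fsum_nth)

lemma null_family_0 [simp]: "null_family (\<lambda>_. 0)"
  by (simp add: null_family_def)

lemma fsum_0 [simp]: "fsum (\<lambda>_. 0) = 0"
  by (rule fls_eqI) (simp add: fsum_nth)

lemma null_family_finite: "finite {i. f i \<noteq> 0} \<Longrightarrow> null_family f"
  unfolding null_family_def by (intro allI, erule rev_finite_subset) auto

lemma fsum_finite:
  assumes "finite A" "\<And>i. i \<notin> A \<Longrightarrow> f i = 0"
  shows "fsum f = sum f A"
proof -
  have "finite {i. f i \<noteq> 0}" by (rule finite_subset[OF _ assms(1)]) (use assms(2) in auto)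
  then have n: "null_family f" by (rule null_family_finite)
  show ?thesis
  proof (rule fls_eqI)
    fix n
    have "{i. fls_nth (f i) n \<noteq> 0} \<subseteq> A" using assms(2) by force
    then show "fls_nth (fsum f) n = fls_nth (sum f A) n"
      using assms(1) n by (simp add: fsum_nth Sum_any.expand_superset fls_nth_sum)
  qed
qed

lemma null_family_subset:
  assumes "null_family f" "\<And>i. g i = f i \<or> g i = 0"
  shows "null_family g"
  unfolding null_family_def
proof
  fix N show "finite {i. \<not> vanishes_below N (g i)}"
    by (rule finite_subset[OF _ null_familyD[OF assms(1), of N]])
       (use assms(2) low_0 in \<open>auto, metis\<close>)
qed

lemma null_family_add:
  assumes "null_family f" "null_family g"
  shows "null_family (\<lambda>i. f i + g i)"
  unfolding null_family_def
proof
  fix N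
  have "{i. \<not> vanishes_below N (f i + g i)} \<subseteq> {i. \<not> vanishes_below N (f i)}
      \<union> {i. \<not> vanishes_below N (g i)}"
    by (auto intro: low_add)
  then show "finite {i. \<not> vanishes_below N (f i + g i)}"
    using null_familyD[OF assms(1)] null_familyD[OF assms(2)] by (meson finite_Un finite_subset)
qed

lemma fsum_add:
  assumes "null_family f" "null_family g"
  shows "fsum (\<lambda>i. f i + g i) = fsum f + fsum g"
  by (rule fls_eqI)
     (simp add: fsum_nth assms null_family_add Sum_any.distrib null_family_nth)

lemma null_family_mult_left:
  assumes "null_family f"
  shows "null_family (\<lambda>i. c * f i)"
  unfolding null_family_def
proof
  fix N
  obtain M where M: "vanishes_below M c" using low_ex by blast
  have "{i. \<not> vanishes_below N (c * f i)} \<subseteq> {i. \<not> vanishes_below (N - M) (f i)}"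
    using low_mult[OF M, of "N - M"] by auto
  then show "finite {i. \<not> vanishes_below N (c * f i)}"
    using null_familyD[OF assms] finite_subset by blast
qed

lemma fsum_mult_left:
  assumes "null_family f"
  shows "fsum (\<lambda>i. c * f i) = c * fsum f"
proof (rule fsum_eqI)
  show "null_family (\<lambda>i. c * f i)" by (rule null_family_mult_left[OF assms])
  fix N
  obtain M where M: "vanishes_below M c" using low_ex by blast
  let ?A0 = "{i. \<not> vanishes_below (N - M) (f i)}"
  have "vanishes_below N (c * fsum f - (\<Sum>i\<in>A. c * f i))" if "finite A" "?A0 \<subseteq>
      A" for A
  proof -
    have "vanishes_below (M + (N - M)) (c * (fsum f - sum f A))"
      by (rule low_mult[OF M fsum_approx[OF assms that]])
    then show ?thesis by (simp add: right_diff_distrib sum_distrib_left)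
  qed
  then show "\<exists>A0. finite A0 \<and> (\<forall>A. finite A \<longrightarrow> A0 \<subseteq>
      A \<longrightarrow> vanishes_below N (c * fsum f - (\<Sum>i\<in>A. c * f i)))"
    using null_familyD[OF assms] by blast
qed

lemma null_family_uminus: "null_family f \<Longrightarrow> null_family (\<lambda>i. - f i)"
  by (simp add: null_family_def)

lemma fsum_uminus: "null_family f \<Longrightarrow> fsum (\<lambda>i. - f i) = - fsum f"
  using fsum_mult_left[of f "-1"] by simp

lemma null_family_diff:
  "null_family f \<Longrightarrow> null_family g \<Longrightarrow> null_family (\<lambda>i. f i -
      g i)"
  using null_family_add[of f "\<lambda>i. - g i"] null_family_uminus[of g] by simp

lemma fsum_diff:
  "null_family f \<Longrightarrow> null_family g \<Longrightarrow> fsum (\<lambda>i. f i - g i) =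
      fsum f - fsum g"
  using fsum_add[of f "\<lambda>i. - g i"] fsum_uminus[of g] null_family_uminus[of g] by simp

lemma null_family_comp_inj:
  assumes "null_family f" "inj h"
  shows "null_family (\<lambda>i. f (h i))"
  unfolding null_family_def
proof
  fix N
  have "finite (h -` {i. \<not> vanishes_below N (f i)})"
    using null_familyD[OF assms(1)] assms(2) by (rule finite_vimageI)
  then show "finite {i. \<not> vanishes_below N (f (h i))}" by (simp add: vimage_def)
qed

lemma fsum_reindex_inj:
  assumes "null_family f" "inj h" "\<And>i. i \<notin> range h \<Longrightarrow> f i = 0"
  shows "fsum (\<lambda>i. f (h i)) = fsum f"
proof (rule fsum_eqI)
  show "null_family (\<lambda>i. f (h i))" by (rule null_family_comp_inj[OF assms(1,2)])
  fix N
  let ?A0 = "h -` {i. \<not> vanishes_below N (f i)}"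
  have fin: "finite ?A0"
    using null_familyD[OF assms(1)] assms(2) by (rule finite_vimageI)
  have "vanishes_below N (fsum f - (\<Sum>i\<in>A. f (h i)))" if "finite A" "?A0 \<subseteq> A"
      for A
  proof -
    have "(\<Sum>i\<in>A. f (h i)) = sum f (h ` A)"
      using assms(2) by (simp add: sum.reindex inj_on_subset)
    moreover have "{i. \<not> vanishes_below N (f i)} \<subseteq> h ` A"
    proof
      fix j assume j: "j \<in> {i. \<not> vanishes_below N (f i)}"
      then have "f j \<noteq> 0" by auto
      then obtain i where "j = h i" using assms(3) by auto
      then show "j \<in> h ` A" using j that(2) by auto
    qed
    ultimately show ?thesis using fsum_approx[OF assms(1), of "h ` A" N] that(1) by simp
  qed
  then show "\<exists>A0. finite A0 \<and> (\<forall>A. finite A \<longrightarrow> A0 \<subseteq>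
      A \<longrightarrow> vanishes_below N (fsum f - (\<Sum>i\<in>A. f (h i))))"
    using fin by blast
qed

lemma fsum_reindex:
  assumes "null_family f" "bij h"
  shows "fsum (\<lambda>i. f (h i)) = fsum f"
  by (rule fsum_reindex_inj) (use assms in \<open>auto simp: bij_def\<close>)

lemma null_family_section:
  assumes "null_family f"
  shows "null_family (\<lambda>b. f (a, b))"
  by (rule null_family_comp_inj[OF assms]) (auto intro: injI)

lemma null_family_section_fsum:
  assumes "null_family f"
  shows "null_family (\<lambda>a. fsum (\<lambda>b. f (a, b)))"
  unfolding null_family_def
proof
  fix N
  have "{a. \<not> vanishes_below N (fsum (\<lambda>b. f (a, b)))} \<subseteq> fst ` {p. \<not>
      vanishes_below N (f p)}"
  proof
    fix a assume "a \<in> {a. \<not> vanishes_below N (fsum (\<lambda>b. f (a, b)))}"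
    then have "\<exists>b. \<not> vanishes_below N (f (a, b))"
      using low_fsum[OF null_family_section[OF assms]] by blast
    then show "a \<in> fst ` {p. \<not> vanishes_below N (f p)}" by force
  qed
  then show "finite {a. \<not> vanishes_below N (fsum (\<lambda>b. f (a, b)))}"
    using null_familyD[OF assms] finite_subset by blast
qed

text \<open>A rectangle containing the finitely many terms of low order approximates the double sum
  and, row by row, also the iterated sum.\<close>

lemma fsum_Fubini:
  assumes "null_family f"
  shows "fsum (\<lambda>a. fsum (\<lambda>b. f (a, b))) = fsum f"
proof (rule fsum_eqI)
  show "null_family (\<lambda>a. fsum (\<lambda>b. f (a, b)))" by (rule
      null_family_section_fsum[OF assms])
  fix N
  let ?L = "{p. \<not> vanishes_below N (f p)}"
  have fin: "finite ?L" by (rule null_familyD[OF assms])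
  have "vanishes_below N (fsum f - (\<Sum>a\<in>A. fsum (\<lambda>b. f (a, b))))" if A: "finite
      A" "fst ` ?L \<subseteq> A" for A
  proof -
    let ?B = "snd ` ?L"
    have "vanishes_below N (fsum f - sum f (A \<times> ?B))"
      by (rule fsum_approx[OF assms]) (use A fin in force)+
    moreover have "vanishes_below N (\<Sum>a\<in>A. fsum (\<lambda>b. f (a, b)) -
        (\<Sum>b\<in>?B. f (a, b)))"
      by (intro low_sum fsum_approx null_family_section[OF assms]) (use fin in force)+
    ultimately have "vanishes_below N ((fsum f - sum f (A \<times> ?B)) - (\<Sum>a\<in>A. fsum
        (\<lambda>b. f (a, b)) - (\<Sum>b\<in>?B. f (a, b))))"
      by (rule low_diff)
    then show ?thesis
      by (simp add: sum_subtractf sum.cartesian_product)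
  qed
  then show "\<exists>A0. finite A0 \<and> (\<forall>A. finite A \<longrightarrow> A0 \<subseteq>
      A \<longrightarrow> vanishes_below N (fsum f - (\<Sum>a\<in>A. fsum (\<lambda>b. f (a, b)))))"
    using fin by blast
qed

lemma fsum_swap:
  assumes "null_family (\<lambda>(a, b). f a b)"
  shows "fsum (\<lambda>a. fsum (\<lambda>b. f a b)) = fsum (\<lambda>b. fsum (\<lambda>a. f a b))"
proof -
  have n: "null_family (\<lambda>p. (\<lambda>(a, b). f a b) (prod.swap p))"
    by (rule null_family_comp_inj[OF assms]) simp
  have "fsum (\<lambda>(a, b). f a b) = fsum (\<lambda>p. (\<lambda>(a, b). f a b) (prod.swap p))"
    by (rule fsum_reindex[OF assms, symmetric]) (simp add: bij_swap)
  then show ?thesis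
    using fsum_Fubini[OF assms] fsum_Fubini[OF n] by simp
qed

lemma null_family_prod:
  assumes "null_family f" "null_family g"
  shows "null_family (\<lambda>(a, b). f a * g b)"
  unfolding null_family_def
proof
  fix N
  obtain M where M: "vanishes_below M (f a)" for a using null_family_lower[OF assms(1)] by blast
  obtain K where K: "vanishes_below K (g b)" for b using null_family_lower[OF assms(2)] by blast
  have "{p. \<not> vanishes_below N (case p of (a, b) \<Rightarrow> f a * g b)} \<subseteq> {a.
      \<not> vanishes_below (N - K) (f a)} \<times> {b. \<not> vanishes_below (N - M) (g b)}"
    using low_mult[OF M, of "N - M"] low_mult[OF _ K, of "N - K"] by auto
  then show "finite {p. \<not> vanishes_below N (case p of (a, b) \<Rightarrow> f a * g b)}"
    using null_familyD[OF assms(1)] null_familyD[OF assms(2)] by (meson finite_SigmaI finite_subset)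
qed

lemma fsum_prod:
  assumes "null_family f" "null_family g"
  shows "fsum (\<lambda>(a, b). f a * g b) = fsum f * fsum g"
proof -
  have "fsum (\<lambda>(a, b). f a * g b) = fsum (\<lambda>a. fsum (\<lambda>b. f a * g b))"
    using fsum_Fubini[OF null_family_prod[OF assms]] by simp
  also have "\<dots> = fsum (\<lambda>a. fsum g * f a)"
    by (simp add: fsum_mult_left[OF assms(2)] mult.commute)
  finally show ?thesis
    by (simp add: fsum_mult_left[OF assms(1)] mult.commute)
qed

section \<open>Summability criteria and changes of index for integer and natural indices\<close>

lemma null_family_int:
  fixes f :: "int \<Rightarrow> 'a::field fls"
  assumes "\<And>i. vanishes_below (\<bar>i\<bar> - C) (f i)"
  shows "null_family f"
proof (rule null_familyI[OF assms])
  fix N :: int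
  have "{i. \<bar>i\<bar> - C < N} \<subseteq> {-(N + C)..N + C}" by auto
  then show "finite {i. \<bar>i\<bar> - C < N}" using finite_subset by blast
qed

lemma null_family_int_pair:
  fixes f :: "int \<times> int \<Rightarrow> 'a::field fls"
  assumes "\<And>i j. vanishes_below (\<bar>i\<bar> + \<bar>j\<bar> - C) (f (i, j))"
  shows "null_family f"
proof (rule null_familyI[where e = "\<lambda>(i, j). \<bar>i\<bar> + \<bar>j\<bar> - C"])
  fix N :: int
  have "{p. (case p of (i, j) \<Rightarrow> \<bar>i\<bar> + \<bar>j\<bar> - C) < N} \<subseteq>
      {-(N + C)..N + C} \<times> {-(N + C)..N + C}" by auto
  then show "finite {p. (case p of (i, j) \<Rightarrow> \<bar>i\<bar> + \<bar>j\<bar> - C) < N}"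
    using finite_subset by blast
qed (use assms in auto)

lemma null_family_nat:
  fixes f :: "nat \<Rightarrow> 'a::field fls"
  assumes "\<And>i. vanishes_below (int i - C) (f i)"
  shows "null_family f"
proof (rule null_familyI[OF assms])
  fix N :: int
  have "{i. int i - C < N} \<subseteq> {..nat (N + C)}" by auto
  then show "finite {i. int i - C < N}" using finite_subset by blast
qed

lemma fsum_nat_Suc:
  assumes "null_family f"
  shows "fsum f = f 0 + fsum (\<lambda>n. f (Suc n))"
proof -
  let ?g = "\<lambda>n. if n = 0 then 0 else f n" and ?h = "\<lambda>n. if n = 0 then f 0 else 0"
  have g: "null_family ?g" by (rule null_family_subset[OF assms]) auto
  have h: "null_family ?h" by (rule null_family_finite) auto
  have "fsum (\<lambda>n. ?g (Suc n)) = fsum ?g"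
  proof (rule fsum_reindex_inj[OF g])
    fix n assume "n \<notin> range Suc"
    then have "n = 0" by (cases n) auto
    then show "?g n = 0" by simp
  qed simp
  moreover have "fsum ?h = f 0" by (subst fsum_finite[of "{0}"]) auto
  moreover have "fsum f = fsum (\<lambda>n. ?h n + ?g n)" by (rule arg_cong[of _ _ fsum]) auto
  ultimately show ?thesis by (simp add: fsum_add g h)
qed

lemma fsum_split3:
  fixes f :: "int \<Rightarrow> 'a::field fls"
  assumes "null_family f"
  shows "fsum f = fsum (\<lambda>m. f (3 * m)) + fsum (\<lambda>m. f (3 * m + 1)) + fsum
      (\<lambda>m. f (3 * m + 2))"
proof -
  define g where "g r n = (if n mod 3 = r then f n else 0)" for r n :: int
  have g: "null_family (g r)" for r
    unfolding g_def by (rule null_family_subset[OF assms]) auto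
  have r: "fsum (\<lambda>m. g r (3 * m + r)) = fsum (g r)" if "r \<in> {0, 1, 2}" for r
  proof (rule fsum_reindex_inj[OF g])
    fix n assume n: "n \<notin> range (\<lambda>m. 3 * m + r)"
    have "n mod 3 \<noteq> r"
    proof
      assume "n mod 3 = r"
      then have "n = 3 * (n div 3) + r" by presburger
      then show False using n by blast
    qed
    then show "g r n = 0" by (simp add: g_def)
  qed (auto intro: injI)
  have "f n = (g 0 n + g 1 n) + g 2 n" for n
  proof -
    have "n mod 3 = 0 \<or> n mod 3 = 1 \<or> n mod 3 = 2" by presburger
    then show ?thesis by (auto simp: g_def)
  qed
  then have "fsum f = fsum (g 0) + fsum (g 1) + fsum (g 2)"
    using fsum_add[OF null_family_add[OF g g] g, of 0 1 2] fsum_add[OF g g, of 0 1]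
    by (simp add: ext[of f "\<lambda>n. (g 0 n + g 1 n) + g 2 n"])
  moreover have "g 0 (3 * m + 0) = f (3 * m)" "g 1 (3 * m + 1) = f (3 * m + 1)"
    "g 2 (3 * m + 2) = f (3 * m + 2)" for m
    by (simp_all add: g_def)
  ultimately show ?thesis using r[of 0] r[of 1] r[of 2] by simp
qed

lemma fsum_int_uminus:
  fixes f :: "int \<Rightarrow> 'a::field fls"
  assumes "null_family f"
  shows "fsum (\<lambda>n. f (- n)) = fsum f"
  by (rule fsum_reindex[OF assms]) (rule bij_uminus)

lemma fsum_int_shift:
  fixes f :: "int \<Rightarrow> 'a::field fls"
  assumes "null_family f"
  shows "fsum (\<lambda>n. f (n + c)) = fsum f"
  using fsum_reindex[OF assms, of "\<lambda>n. n + c"] bij_plus_right[of c] by simp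

section \<open>Overpartitions by largest part and number of parts\<close>

text \<open>At \<open>q = 1\<close> this is the Delannoy recurrence for lattice paths with diagonal
  steps. The weights are those obeyed by the pair sums in \<open>delannoy_recurrence\<close>; they
  treat the two arguments differently, so symmetry needs a proof.\<close>

fun delannoy :: "'a::comm_ring_1 \<Rightarrow> nat \<Rightarrow> nat \<Rightarrow> 'a" where
  "delannoy q 0 p = 1"
| "delannoy q (Suc l) 0 = 1"
| "delannoy q (Suc l) (Suc p) =
     q ^ Suc p * delannoy q l (Suc p) + delannoy q (Suc l) p + q ^ p * delannoy q l p"

lemma delannoy_0_right [simp]: "delannoy q l 0 = 1"
  by (cases l) auto

text \<open>This is the difference between the defining recurrence and its transpose, hence amounts
  to \<open>delannoy_Suc_Suc'\<close>. Facts \<open>1\<close> and \<open>2\<close> expand the two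
  products to the same multiple of \<open>delannoy q a c\<close> plus lower terms, and the lower
  terms are matched by the identity at smaller indices.\<close>

lemma delannoy_exchange:
  "(1 - q ^ Suc c) * delannoy q a (Suc c) - (1 - q ^ Suc a) * delannoy q (Suc a) c
     = (q ^ c - q ^ a) * delannoy q a c"
proof (induction "a + c" arbitrary: a c rule: less_induct)
  case less
  \<comment> \<open>For \<open>a = 0\<close> the truncated \<open>a - 1\<close> is harmless because
    the factor \<open>1 - q ^ a\<close> vanishes; likewise for \<open>c = 0\<close> in fact
    \<open>2\<close>.\<close>
  have 1: "(1 - q ^ Suc c) * delannoy q a (Suc c) =
      (1 - q ^ Suc (a + c)) * delannoy q a c + q ^ c * (1 - q ^ a) * delannoy q (a - 1) c"
  proof (cases a)
    case (Suc b)
    have "(1 - q ^ Suc c) * delannoy q b (Suc c) - (1 - q ^ Suc b) * delannoy q (Suc b) c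
        = (q ^ c - q ^ b) * delannoy q b c"
      by (rule less) (simp add: Suc)
    then have e: "(1 - q ^ Suc c) * delannoy q b (Suc c) = (1 - q ^ Suc b) * delannoy q (Suc b) c
        + (q ^ c - q ^ b) * delannoy q b c" by (simp add: algebra_simps)
    have "(1 - q ^ Suc c) * delannoy q a (Suc c) = q ^ Suc c * ((1 - q ^ Suc c) * delannoy q b
        (Suc c))
        + (1 - q ^ Suc c) * (delannoy q (Suc b) c + q ^ c * delannoy q b c)"
      unfolding Suc delannoy.simps by (simp add: algebra_simps)
    also have "\<dots> = (1 - q ^ Suc (a + c)) * delannoy q a c + q ^ c * (1 - q ^ a) * delannoy
        q (a - 1) c"
      unfolding e Suc by (simp add: algebra_simps power_add)
    finally show ?thesis .
  qed simp
  have 2: "(1 - q ^ Suc a) * delannoy q (Suc a) c =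
      (1 - q ^ Suc (a + c)) * delannoy q a c + q ^ a * (1 - q ^ c) * delannoy q a (c - 1)"
  proof (cases c)
    case (Suc d)
    have "(1 - q ^ Suc d) * delannoy q a (Suc d) - (1 - q ^ Suc a) * delannoy q (Suc a) d
        = (q ^ d - q ^ a) * delannoy q a d"
      by (rule less) (simp add: Suc)
    then have e: "(1 - q ^ Suc a) * delannoy q (Suc a) d = (1 - q ^ Suc d) * delannoy q a (Suc d)
        - (q ^ d - q ^ a) * delannoy q a d" by (simp add: algebra_simps)
    have "(1 - q ^ Suc a) * delannoy q (Suc a) c =
        (1 - q ^ Suc a) * (q ^ Suc d * delannoy q a (Suc d) + q ^ d * delannoy q a d) +
        (1 - q ^ Suc a) * delannoy q (Suc a) d"
      unfolding Suc delannoy.simps by (simp add: algebra_simps)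
    also have "\<dots> = (1 - q ^ Suc (a + c)) * delannoy q a c + q ^ a * (1 - q ^ c) * delannoy
        q a (c - 1)"
      unfolding e Suc by (simp add: algebra_simps power_add)
    finally show ?thesis .
  qed simp
  have "q ^ c * (1 - q ^ a) * delannoy q (a - 1) c - q ^ a * (1 - q ^ c) * delannoy q a (c - 1)
      = (q ^ c - q ^ a) * delannoy q a c"
  proof (cases a; cases c)
    fix b d assume a: "a = Suc b" and c: "c = Suc d"
    have "(1 - q ^ Suc d) * delannoy q b (Suc d) - (1 - q ^ Suc b) * delannoy q (Suc b) d
        = (q ^ d - q ^ b) * delannoy q b d"
      by (rule less) (simp add: a c)
    then have "delannoy q b (Suc d) = q ^ Suc d * delannoy q b (Suc d) +
        (1 - q ^ Suc b) * delannoy q (Suc b) d + (q ^ d - q ^ b) * delannoy q b d"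
      by (simp add: algebra_simps)
    then have "q ^ c * delannoy q b (Suc d) = q ^ c * (q ^ Suc d * delannoy q b (Suc d) +
        (1 - q ^ Suc b) * delannoy q (Suc b) d + (q ^ d - q ^ b) * delannoy q b d)"
      by simp
    then show ?thesis
      unfolding a c delannoy.simps by (simp add: algebra_simps)
  qed (auto simp: algebra_simps)
  then show ?case unfolding 1 2 by simp
qed

lemma delannoy_Suc_Suc':
  "delannoy q (Suc l) (Suc p) =
     q ^ Suc l * delannoy q (Suc l) p + delannoy q l (Suc p) + q ^ l * delannoy q l p"
  using delannoy_exchange[of q p l] unfolding delannoy.simps by (simp add: algebra_simps)

lemma delannoy_commute: "delannoy q l p = delannoy q p l"
proof (induction "l + p" arbitrary: l p rule: less_induct)
  case less
  show ?case
  proof (cases l; cases p)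
    fix m r assume l: "l = Suc m" and p: "p = Suc r"
    show ?thesis
      unfolding l p delannoy_Suc_Suc'[of q r m] delannoy.simps(3)[of q m r]
      using less[of m "Suc r"] less[of "Suc m" r] less[of m r] by (simp add: l p)
  qed simp_all
qed

section \<open>Counting overpartitions with bounded parts\<close>

definition bounded_overpartitions :: "nat \<Rightarrow> nat \<Rightarrow> nat \<Rightarrow> (nat
    multiset \<times> nat set) set" where
  "bounded_overpartitions l N n =
     {(M, S). (\<forall>x\<in>#M. 0 < x \<and> x \<le> N) \<and> size M = l \<and> sum_mset M = n
         \<and> S \<subseteq> set_mset M}"

lemma finite_bounded_overpartitions [simp]: "finite (bounded_overpartitions l N n)"
proof (rule finite_subset)
  show "bounded_overpartitions l N n \<subseteq>
      (mset ` {xs. set xs \<subseteq> {..N} \<and> length xs = l}) \<times> Pow {..N}"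
  proof
    fix p assume p: "p \<in> bounded_overpartitions l N n"
    obtain M S where MS: "p = (M, S)" by force
    obtain xs where xs: "M = mset xs" using ex_mset by metis
    have "xs \<in> {xs. set xs \<subseteq> {..N} \<and> length xs = l}" "S \<in> Pow {..N}"
      using p unfolding MS xs bounded_overpartitions_def by auto
    then show "p \<in> (mset ` {xs. set xs \<subseteq> {..N} \<and> length xs = l}) \<times> Pow
        {..N}"
      unfolding MS xs by blast
  qed
qed (simp add: finite_lists_length_eq)

lemma bounded_overpartitions_0_left:
  "bounded_overpartitions 0 N n = (if n = 0 then {({#}, {})} else {})"
  by (auto simp: bounded_overpartitions_def)

lemma bounded_overpartitions_Suc_0: "bounded_overpartitions (Suc l) 0 n = {}"
proof -
  have "size M \<noteq> Suc l" if "\<forall>x\<in>#M. 0 < x \<and> x \<le> 0" for M :: "nat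
      multiset"
    using that by (cases M) auto
  then show ?thesis by (auto simp: bounded_overpartitions_def)
qed

text \<open>If a part \<open>Suc N\<close> occurs, one copy is removed. When it is the only copy and
  overlined, its overline goes as well and all remaining parts are at most \<open>N\<close>;
  otherwise the set of overlined sizes is still admissible for the remaining parts.\<close>

lemma bounded_overpartitions_Suc_Suc:
  "bounded_overpartitions (Suc l) (Suc N) n = bounded_overpartitions (Suc l) N n \<union>
     (if Suc N \<le> n then
        (\<lambda>(M, S). (add_mset (Suc N) M, S)) ` bounded_overpartitions l (Suc N) (n - Suc N)
            \<union>
        (\<lambda>(M, S). (add_mset (Suc N) M, insert (Suc N) S)) ` bounded_overpartitions l N (n
            - Suc N)
      else {})" (is "?L = ?A \<union> (if _ then ?f ` ?B \<union> ?g ` ?C else {})")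
proof (intro equalityI subsetI)
  fix p assume p: "p \<in> ?L"
  obtain M S where MS: "p = (M, S)" by force
  show "p \<in> ?A \<union> (if Suc N \<le> n then ?f ` ?B \<union> ?g ` ?C else {})"
  proof (cases "Suc N \<in># M")
    case False
    then have "p \<in> ?A" using p unfolding MS bounded_overpartitions_def
      by (auto simp: le_Suc_eq)
    then show ?thesis by simp
  next
    case True
    then obtain M' where M': "M = add_mset (Suc N) M'" by (metis mset_add)
    have n: "Suc N \<le> n" "sum_mset M' = n - Suc N" "size M' = l"
      using p unfolding MS M' bounded_overpartitions_def by auto
    show ?thesis
    proof (cases "Suc N \<in> S \<and> Suc N \<notin># M'")
      case True
      have "(M', S - {Suc N}) \<in> ?C"
        using p n True unfolding MS M' bounded_overpartitions_def by (auto simp: le_Suc_eq)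
      moreover have "p = ?g (M', S - {Suc N})" using True by (auto simp: MS M')
      ultimately have "p \<in> ?g ` ?C" by (rule rev_image_eqI)
      then show ?thesis using n(1) by simp
    next
      case False
      have "(M', S) \<in> ?B"
        using p n False unfolding MS M' bounded_overpartitions_def by auto
      moreover have "p = ?f (M', S)" by (auto simp: MS M')
      ultimately have "p \<in> ?f ` ?B" by (rule rev_image_eqI)
      then show ?thesis using n(1) by simp
    qed
  qed
next
  fix p assume "p \<in> ?A \<union> (if Suc N \<le> n then ?f ` ?B \<union> ?g ` ?C else {})"
  then show "p \<in> ?L"
    by (auto simp: bounded_overpartitions_def intro: le_SucI split: if_splits)
qed

lemma card_bounded_overpartitions_Suc_Suc:
  "card (bounded_overpartitions (Suc l) (Suc N) n) = card (bounded_overpartitions (Suc l) N n) +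
     (if Suc N \<le> n then card (bounded_overpartitions l (Suc N) (n - Suc N)) +
        card (bounded_overpartitions l N (n - Suc N)) else 0)"
proof -
  let ?A = "bounded_overpartitions (Suc l) N n"
  let ?B = "bounded_overpartitions l (Suc N) (n - Suc N)"
  let ?C = "bounded_overpartitions l N (n - Suc N)"
  let ?f = "\<lambda>(M, S). (add_mset (Suc N) M, S)"
  let ?g = "\<lambda>(M, S). (add_mset (Suc N) M, insert (Suc N) S)"
  have f: "inj_on ?f ?B" by (auto intro: inj_onI)
  have g: "inj_on ?g ?C"
  proof (rule inj_onI)
    fix x y assume xy: "x \<in> ?C" "y \<in> ?C" "?g x = ?g y"
    obtain M S M' S' where e: "x = (M, S)" "y = (M', S')" by force
    have "Suc N \<notin> S" "Suc N \<notin> S'"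
      using xy(1,2) unfolding e bounded_overpartitions_def by force+
    then show "x = y" using xy(3) unfolding e by (simp add: insert_ident)
  qed
  have A: "Suc N \<notin># fst p" if "p \<in> bounded_overpartitions k N n'" for p k n'
    using that by (fastforce simp: bounded_overpartitions_def)
  have 1: "?A \<inter> (?f ` ?B \<union> ?g ` ?C) = {}"
    using A by (auto, (metis fst_conv union_single_eq_member)+)
  have B: "snd p \<subseteq> set_mset (fst p)" if "p \<in> ?B" for p
    using that by (auto simp: bounded_overpartitions_def)
  \<comment> \<open>A removal undone by \<open>?f\<close> leaves every overlined size among the
    remaining parts; under \<open>?g\<close> the size \<open>Suc N\<close> is overlined but has no
    further copy.\<close>
  have 2: "?f ` ?B \<inter> ?g ` ?C = {}"
  proof (rule ccontr)
    assume "\<not> ?thesis"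
    then obtain x y where xy: "x \<in> ?B" "y \<in> ?C" "?f x = ?g y" by blast
    then have "fst x = fst y" "Suc N \<in> snd x" by (auto simp: split_beta)
    then show False using B[OF xy(1)] A[OF xy(2)] by auto
  qed
  show ?thesis
    unfolding bounded_overpartitions_Suc_Suc
    using 1 2 by (auto simp: card_Un_disjoint card_image f g)
qed

definition overpartition_gf :: "nat \<Rightarrow> nat \<Rightarrow> complex fps" where
  "overpartition_gf l N = Abs_fps (\<lambda>n. of_nat (card (bounded_overpartitions l N n)))"

lemma overpartition_gf_simps:
  "overpartition_gf 0 N = 1"
  "overpartition_gf (Suc l) 0 = 0"
  "overpartition_gf (Suc l) (Suc N) = overpartition_gf (Suc l) N +
     fps_X ^ Suc N * (overpartition_gf l (Suc N) + overpartition_gf l N)"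
proof -
  show "overpartition_gf 0 N = 1"
    by (rule fps_ext) (simp add: overpartition_gf_def bounded_overpartitions_0_left)
  show "overpartition_gf (Suc l) 0 = 0"
    by (rule fps_ext) (simp add: overpartition_gf_def bounded_overpartitions_Suc_0)
  show "overpartition_gf (Suc l) (Suc N) = overpartition_gf (Suc l) N +
     fps_X ^ Suc N * (overpartition_gf l (Suc N) + overpartition_gf l N)"
  proof (rule fps_ext)
    fix n
    show "fps_nth (overpartition_gf (Suc l) (Suc N)) n = fps_nth (overpartition_gf (Suc l) N +
       fps_X ^ Suc N * (overpartition_gf l (Suc N) + overpartition_gf l N)) n"
      unfolding fps_add_nth fps_X_power_mult_nth overpartition_gf_def fps_nth_Abs_fps
      by (simp add: card_bounded_overpartitions_Suc_Suc)
  qed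
qed

text \<open>Adding the recurrence at two consecutive bounds gives a recurrence for the pair sums
  alone; divided by \<open>2 * q ^ Suc l\<close> it is the one that defines
  \<open>delannoy\<close>.\<close>

lemma delannoy_recurrence:
  fixes q :: "'a::comm_ring_1"
  assumes rec: "\<And>N. f 0 N = 1" "\<And>l. f (Suc l) 0 = 0"
    "\<And>l N. f (Suc l) (Suc N) = f (Suc l) N + q ^ Suc N * (f l (Suc N) + f l N)"
  shows "f l (Suc p) + f l p = 2 * q ^ l * delannoy q l p"
proof (induction l arbitrary: p)
  case 0
  then show ?case by (simp add: rec)
next
  case (Suc l)
  note IH = Suc
  show ?case
  proof (induction p)
    case 0
    have "f (Suc l) (Suc 0) + f (Suc l) 0 = q * (f l (Suc 0) + f l 0)" by (simp add: rec)
    then show ?case unfolding IH by (simp add: algebra_simps)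
  next
    case (Suc p)
    have "f (Suc l) (Suc (Suc p)) + f (Suc l) (Suc p) = (f (Suc l) (Suc p) + f (Suc l) p) +
        q ^ Suc (Suc p) * (f l (Suc (Suc p)) + f l (Suc p)) + q ^ Suc p * (f l (Suc p) + f l p)"
      using rec(3)[of l "Suc p"] rec(3)[of l p] by (simp add: algebra_simps)
    also have "\<dots> = 2 * q ^ Suc l * delannoy q (Suc l) (Suc p)"
      unfolding Suc IH by (simp add: algebra_simps)
    finally show ?case .
  qed
qed

lemma overpartition_gf_add:
  "overpartition_gf l (Suc p) + overpartition_gf l p = 2 * fps_X ^ l * delannoy fps_X l p"
  by (rule delannoy_recurrence) (fact overpartition_gf_simps)+

text \<open>Raising the bound from \<open>p\<close> to \<open>Suc p\<close> admits exactly the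
  overpartitions with largest part \<open>Suc p\<close>, and the recurrence expresses them by a pair
  sum with one part fewer. The result is symmetric in \<open>l\<close> and \<open>p\<close>, so
  negating the rank preserves the counts.\<close>

lemma overpartition_gf_diff:
  "overpartition_gf (Suc l) (Suc p) - overpartition_gf (Suc l) p =
     2 * fps_X ^ (l + p + 1) * delannoy fps_X l p"
proof -
  have "overpartition_gf (Suc l) (Suc p) - overpartition_gf (Suc l) p =
     fps_X ^ Suc p * (2 * fps_X ^ l * delannoy fps_X l p)"
    unfolding overpartition_gf_add[symmetric] overpartition_gf_simps(3) by (rule
        add_diff_cancel_left')
  also have "\<dots> = 2 * (fps_X ^ Suc p * fps_X ^ l) * delannoy fps_X l p"
    by (simp only: mult_ac)
  also have "fps_X ^ Suc p * fps_X ^ l = fps_X ^ (l + p + 1)"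
    by (simp only: power_add[symmetric]) (rule arg_cong[where f = "power fps_X"], simp)
  finally show ?thesis .
qed

lemma card_overpartitions_size_Max:
  "of_nat (card {(M, S). (M, S) \<in> overpartitions n \<and> size M = Suc a \<and> Max (set_mset
      M) = Suc c}) =
     fps_nth (2 * fps_X ^ (a + c + 1) * delannoy fps_X a c :: complex fps) n"
proof -
  let ?E = "{(M, S). (M, S) \<in> overpartitions n \<and> size M = Suc a \<and> Max (set_mset M)
      = Suc c}"
  have E: "?E = bounded_overpartitions (Suc a) (Suc c) n - bounded_overpartitions (Suc a) c n"
  proof (intro equalityI subsetI)
    fix p assume p: "p \<in> ?E"
    obtain M S where MS: "p = (M, S)" by force
    have o: "\<forall>x\<in>#M. 0 < x" "sum_mset M = n" "S \<subseteq> set_mset M"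
      and size: "size M = Suc a" and mx: "Max (set_mset M) = Suc c"
      using p by (simp_all add: MS overpartitions_def)
    have "set_mset M \<noteq> {}" using size by auto
    then have "Suc c \<in># M" using Max_in[of "set_mset M"] mx by simp
    moreover have "x \<le> Suc c" if "x \<in># M" for x
      using Max_ge[of "set_mset M" x] that mx by simp
    ultimately show "p \<in> bounded_overpartitions (Suc a) (Suc c) n - bounded_overpartitions
        (Suc a) c n"
      using o size by (simp add: MS bounded_overpartitions_def) (meson Suc_n_not_le_n)
  next
    fix p assume p: "p \<in> bounded_overpartitions (Suc a) (Suc c) n - bounded_overpartitions
        (Suc a) c n"
    obtain M S where MS: "p = (M, S)" by force
    have o: "\<forall>x\<in>#M. 0 < x \<and> x \<le> Suc c" "sum_mset M = n" "S \<subseteq>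
        set_mset M" "size M = Suc a"
      using p by (simp_all add: MS bounded_overpartitions_def)
    moreover have "(M, S) \<notin> bounded_overpartitions (Suc a) c n" using p by (simp add: MS)
    ultimately obtain x where "x \<in># M" "\<not> x \<le> c"
      by (auto simp: bounded_overpartitions_def)
    moreover from this have "x = Suc c" using o(1) by fastforce
    ultimately have "Suc c \<in># M" by simp
    then have "Max (set_mset M) = Suc c" using o(1) by (intro Max_eqI) auto
    then show "p \<in> ?E"
      using o by (simp add: MS overpartitions_def)
  qed
  have sub: "bounded_overpartitions (Suc a) c n \<subseteq> bounded_overpartitions (Suc a) (Suc
      c) n"
    by (auto simp: bounded_overpartitions_def)
  have "of_nat (card ?E) = fps_nth (overpartition_gf (Suc a) (Suc c) - overpartition_gf (Suc a)
      c) n"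
    unfolding E by (simp add: card_Diff_subset[OF _ sub] of_nat_diff card_mono[OF _ sub]
        overpartition_gf_def)
  then show ?thesis unfolding overpartition_gf_diff .
qed

text \<open>Here \<open>Suc a\<close> is the number of parts and \<open>Suc c\<close> the largest
  part; both are at most \<open>n\<close>. For \<open>n = 0\<close> the box is empty, in agreement
  with the convention in \<open>Nbar\<close>.\<close>

lemma of_nat_Nbar:
  "(of_nat (Nbar s m n) :: complex) = (\<Sum>(a, c)\<in>{..<n} \<times> {..<n}.
     if [int c - int a = s] (mod m) then
       fps_nth (2 * fps_X ^ (a + c + 1) * delannoy fps_X a c) n else 0)"
proof (cases "n = 0")
  case False
  let ?P = "{(a, c) \<in> {..<n} \<times> {..<n}. [int c - int a = s] (mod m)}"
  let ?E = "\<lambda>(a, c). {(M, S). (M, S) \<in> overpartitions n \<and> size M = Suc a \<and>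
      Max (set_mset M) = Suc c}"
  have fin: "finite ?P" by (rule finite_subset[of _ "{..<n} \<times> {..<n}"]) auto
  have eq: "{p \<in> overpartitions n. [overpartition_rank p = s] (mod m)} = (\<Union>x\<in>?P.
      ?E x)"
  proof (intro equalityI subsetI)
    fix p assume p: "p \<in> {p \<in> overpartitions n. [overpartition_rank p = s] (mod m)}"
    obtain M S where MS: "p = (M, S)" by force
    have o: "\<forall>x\<in>#M. x > 0" "sum_mset M = n" using p unfolding MS overpartitions_def
        by auto
    have "M \<noteq> {#}" using o False by auto
    then obtain x M' where M': "M = add_mset x M'" by (meson multiset_cases)
    have size: "size M \<le> n"
      using o(1) unfolding o(2)[symmetric] by (induction M) fastforce+
    define y where "y = Max (set_mset M)"
    have "y \<in># M" unfolding y_def by (rule Max_in) (auto simp: M')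
    moreover from this obtain M'' where "M = add_mset y M''"
      by (meson mset_add)
    then have "sum_mset M = y + sum_mset M''" by simp
    ultimately have mx: "0 < Max (set_mset M)" "Max (set_mset M) \<le> n"
      using o unfolding y_def[symmetric] by auto
    let ?a = "size M - 1" and ?c = "Max (set_mset M) - 1"
    have "size M = Suc ?a" "Max (set_mset M) = Suc ?c" using mx by (auto simp: M')
    moreover from this have "(?a, ?c) \<in> ?P"
      using p size mx unfolding MS overpartition_rank_def by (simp add: Suc_le_eq)
    moreover have "(M, S) \<in> overpartitions n" using p by (simp add: MS)
    ultimately have "p \<in> ?E (?a, ?c)" by (simp add: MS)
    then show "p \<in> (\<Union>x\<in>?P. ?E x)"
      using \<open>(?a, ?c) \<in> ?P\<close> by (rule UN_I[rotated])
  next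
    fix p assume "p \<in> (\<Union>x\<in>?P. ?E x)"
    then show "p \<in> {p \<in> overpartitions n. [overpartition_rank p = s] (mod m)}"
      by (auto simp: overpartition_rank_def)
  qed
  have finE: "finite (?E x)" for x
  proof -
    have "?E x \<subseteq> bounded_overpartitions (Suc (fst x)) (Suc (snd x)) n"
    proof
      fix p assume p: "p \<in> ?E x"
      obtain M S where MS: "p = (M, S)" by force
      have "Max (set_mset M) = Suc (snd x)" using p by (simp add: MS split_beta)
      then have "y \<le> Suc (snd x)" if "y \<in># M" for y
        using Max_ge[of "set_mset M" y] that by simp
      then show "p \<in> bounded_overpartitions (Suc (fst x)) (Suc (snd x)) n"
        using p unfolding MS by (auto simp: bounded_overpartitions_def overpartitions_def
            split_beta)
    qed
    then show ?thesis by (rule finite_subset) simp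
  qed
  have "card (\<Union>x\<in>?P. ?E x) = (\<Sum>x\<in>?P. card (?E x))"
  proof (rule card_UN_disjoint[OF fin])
    show "\<forall>x\<in>?P. finite (?E x)" using finE by blast
    show "\<forall>x\<in>?P. \<forall>y\<in>?P. x \<noteq> y \<longrightarrow> ?E x \<inter> ?E y
        = {}" by auto
  qed
  then have "(of_nat (Nbar s m n) :: complex) = (\<Sum>x\<in>?P. of_nat (card (?E x)))"
    using False unfolding Nbar_def eq by simp
  also have "\<dots> = (\<Sum>(a, c)\<in>?P. fps_nth (2 * fps_X ^ (a + c + 1) * delannoy fps_X a
      c) n)"
    by (intro sum.cong refl) (clarify, rule card_overpartitions_size_Max)
  also have "\<dots> = (\<Sum>(a, c)\<in>{..<n} \<times> {..<n}.
     if [int c - int a = s] (mod m) then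
       fps_nth (2 * fps_X ^ (a + c + 1) * delannoy fps_X a c) n else 0)"
    by (rule sum.mono_neutral_cong_left) (auto split: if_splits)
  finally show ?thesis .
qed (simp add: Nbar_def)

section \<open>Generating functions for the rank\<close>

definition qpow :: "int \<Rightarrow> complex fls"
  where "qpow n = fls_X powi n"

lemma qpow_0 [simp]: "qpow 0 = 1"
  by (simp only: qpow_def power_int_0_right)

lemma qpow_nz [simp]: "qpow n \<noteq> 0"
  unfolding qpow_def by (rule power_int_not_zero) simp

lemma qpow_add: "qpow (a + b) = qpow a * qpow b"
  unfolding qpow_def by (rule power_int_add) simp

lemma qpow_mult: "qpow a * qpow b = qpow (a + b)"
  by (rule qpow_add[symmetric])

lemma qpow_mult_left: "qpow a * (qpow b * c) = qpow (a + b) * c"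
  by (simp only: qpow_add mult.assoc)

lemma qpow_mult_mid: "qpow a * (c * qpow b) = qpow (a + b) * c"
  by (simp only: qpow_add mult_ac)

lemmas qpow_simps = qpow_mult qpow_mult_left qpow_mult_mid

lemma qpow_minus: "qpow (- n) = inverse (qpow n)"
  unfolding qpow_def by (rule power_int_minus)

lemma qpow_diff: "qpow (a - b) = qpow a / qpow b"
  unfolding qpow_def by (rule power_int_diff) simp

lemma qpow_power: "qpow n ^ k = qpow (n * int k)"
  by (simp only: qpow_def power_int_mult power_int_of_nat)

lemma fls_X_power_qpow: "fls_X ^ n = qpow (int n)"
  unfolding qpow_def by (rule power_int_of_nat[symmetric])

lemma qpow_nth: "fls_nth (qpow n) k = (if k = n then 1 else 0)"
  unfolding qpow_def by (simp add: fls_X_power_int)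

lemma low_qpow [simp]: "vanishes_below N (qpow n) \<longleftrightarrow> N \<le> n"
  by (auto simp: vanishes_below_def qpow_nth)

lemma one_minus_qpow_nz: "n \<noteq> 0 \<Longrightarrow> 1 - qpow n \<noteq> 0"
proof
  assume n: "n \<noteq> 0" and "1 - qpow n = 0"
  then have "fls_nth (1 - qpow n) n = 0" by (metis fls_zero_nth)
  then show False using n by (simp add: qpow_nth)
qed

definition sign_pow :: "int \<Rightarrow> complex fls"
  where "sign_pow n = (- 1) powi n"

lemma sign_pow_0 [simp]: "sign_pow 0 = 1" and sg_1 [simp]: "sign_pow 1 = - 1"
  by (simp_all only: sign_pow_def power_int_0_right power_int_1_right)

lemma sign_pow_add: "sign_pow (a + b) = sign_pow a * sign_pow b"
  unfolding sign_pow_def by (rule power_int_add) simp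

lemma sign_pow_eq: "sign_pow n = (if even n then 1 else - 1)"
  unfolding sign_pow_def by (auto simp: power_int_minus_left)

lemma sign_pow_minus [simp]: "sign_pow (- n) = sign_pow n"
  by (simp add: sign_pow_eq)

lemma sign_pow_diff: "sign_pow (a - b) = sign_pow a * sign_pow b"
  by (simp add: sign_pow_eq)

lemma sign_pow_square [simp]: "sign_pow n * sign_pow n = 1"
  by (simp add: sign_pow_eq)

lemma sign_pow_mult_left [simp]: "sign_pow n * (sign_pow n * c) = c"
  by (simp add: sign_pow_eq)

lemma sign_pow_3 [simp]: "sign_pow (3 * n) = sign_pow n"
  by (simp add: sign_pow_eq)

lemma low_sign_pow_mult [simp]: "vanishes_below N (sign_pow n * f) \<longleftrightarrow>
    vanishes_below N f"
  by (simp add: sign_pow_eq)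

lemma low_qpow_mult: "vanishes_below N f \<Longrightarrow> vanishes_below (n + N) (qpow n * f)"
  by (rule low_mult) simp

lemma low_qpow_multI: "vanishes_below 0 f \<Longrightarrow> N \<le> n \<Longrightarrow>
    vanishes_below N (qpow n * f)"
  using low_qpow_mult[of 0 f n] low_mono by auto

text \<open>For negative \<open>n\<close> the quotient is
  \<open>- qpow (m - n) / (1 - qpow (- n))\<close> and starts at \<open>m - n\<close> instead of
  \<open>m\<close>. Bounding both exponents avoids splitting on the sign of \<open>n\<close>
  later.\<close>

lemma low_qpow_div:
  assumes "n \<noteq> 0" "N \<le> m" "N \<le> m - n"
  shows "vanishes_below N (qpow m / (1 - qpow n))"
proof (cases "n > 0")
  case True
  then have "vanishes_below 0 (1 / (1 - qpow n))" by (intro low_inverse_1) simp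
  from low_qpow_multI[OF this assms(2)] show ?thesis by simp
next
  case False
  then have "vanishes_below 0 (1 / (1 - qpow (- n)))" using assms(1) by (intro low_inverse_1) simp
  then have "vanishes_below N (qpow (m - n) * (1 / (1 - qpow (- n))))"
    by (rule low_qpow_multI) (use assms in simp)
  moreover have "qpow m / (1 - qpow n) = - (qpow (m - n) * (1 / (1 - qpow (- n))))"
    using one_minus_qpow_nz[of n] one_minus_qpow_nz[of "- n"] assms(1)
    by (simp add: qpow_minus qpow_diff field_simps)
  ultimately show ?thesis by simp
qed

lemma qpow_div_minus: "n \<noteq> 0 \<Longrightarrow> qpow m / (1 - qpow (- n)) = - (qpow (m + n)
    / (1 - qpow n))"
  using one_minus_qpow_nz[of n] one_minus_qpow_nz[of "- n"]
  by (simp add: qpow_minus qpow_add field_simps)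

lemma fsum_int_halves:
  fixes f :: "int \<Rightarrow> 'a::field fls"
  assumes "null_family f"
  shows "fsum f = fsum (\<lambda>n. f (int n)) + fsum (\<lambda>n. f (- int n - 1))"
proof -
  let ?g = "\<lambda>n. if n \<ge> 0 then f n else 0" and ?h = "\<lambda>n. if n \<ge> 0 then 0
      else f n"
  have g: "null_family ?g" by (rule null_family_subset[OF assms]) auto
  have h: "null_family ?h" by (rule null_family_subset[OF assms]) auto
  have "fsum f = fsum (\<lambda>n. ?g n + ?h n)" by (rule arg_cong[of _ _ fsum]) auto
  also have "\<dots> = fsum ?g + fsum ?h" by (rule fsum_add[OF g h])
  also have "fsum ?g = fsum (\<lambda>n. ?g (int n))"
  proof (rule fsum_reindex_inj[OF g, symmetric])
    fix n assume "n \<notin> range int"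
    then have "n < 0" by (metis nonneg_int_cases not_le rangeI)
    then show "?g n = 0" by simp
  qed simp
  also have "fsum ?h = fsum (\<lambda>n. ?h (- int n - 1))"
  proof (rule fsum_reindex_inj[OF h, symmetric])
    fix n assume n: "n \<notin> range (\<lambda>n. - int n - 1)"
    have "n \<ge> 0"
    proof (rule ccontr)
      assume "\<not> n \<ge> 0"
      then have "n = - int (nat (- n - 1)) - 1" by simp
      then show False using n by blast
    qed
    then show "?h n = 0" by simp
  qed (auto intro: injI)
  finally show ?thesis by simp
qed

lemma null_family_comp_int: "null_family f \<Longrightarrow> null_family (\<lambda>n. f (int n))"
  by (erule null_family_comp_inj) simp

lemma fsum_geometric:
  assumes "vanishes_below 1 y"
  shows "null_family (\<lambda>k. y ^ k)" "fsum (\<lambda>k. y ^ k) = 1 / (1 - y)"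
proof -
  have "vanishes_below (int k) (y ^ k)" for k
  proof (induction k)
    case (Suc k)
    show ?case using low_mult[OF assms Suc] by (simp add: add.commute)
  qed simp
  then show n: "null_family (\<lambda>k. y ^ k)"
    by (intro null_family_nat[where C = 0]) simp
  have "fsum (\<lambda>k. y ^ k) = 1 + y * fsum (\<lambda>k. y ^ k)"
    using fsum_nat_Suc[OF n] fsum_mult_left[OF n, of y] by simp
  moreover have "1 - y \<noteq> 0"
  proof
    assume "1 - y = 0"
    then have "y = 1" by simp
    then show False using assms by simp
  qed
  ultimately show "fsum (\<lambda>k. y ^ k) = 1 / (1 - y)"
    by (simp add: field_simps)
qed

section \<open>Rank counts as sums of q-Delannoy polynomials\<close>

definition delannoy_q :: "nat \<Rightarrow> nat \<Rightarrow> complex fls"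
  where "delannoy_q l p = delannoy fls_X l p"

lemma fps_to_fls_delannoy: "fps_to_fls (delannoy fps_X l p) = delannoy_q l p"
proof -
  have "q = fps_X \<Longrightarrow> fps_to_fls (delannoy q l p) = delannoy_q l p" for q ::
      "complex fps"
    unfolding delannoy_q_def
    by (induction q l p rule: delannoy.induct)
       (simp_all add: fls_times_fps_to_fls fps_to_fls_power del: power_Suc)
  then show ?thesis by simp
qed

lemma low_fps_to_fls: "vanishes_below 0 (fps_to_fls f)"
  by (simp add: vanishes_below_def)

lemma low_delannoy: "vanishes_below 0 (delannoy_q l p)"
  unfolding fps_to_fls_delannoy[symmetric] by (rule low_fps_to_fls)

lemma delannoy_q_Suc_Suc:
  "delannoy_q (Suc l) (Suc p) = qpow (int p + 1) * delannoy_q l (Suc p) + delannoy_q (Suc l) p +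
      qpow (int p) * delannoy_q l p"
  unfolding delannoy_q_def delannoy.simps fls_X_power_qpow by (simp add: add.commute)

lemma delannoy_q_Suc_Suc':
  "delannoy_q (Suc l) (Suc p) = qpow (int l + 1) * delannoy_q (Suc l) p + delannoy_q l (Suc p) +
      qpow (int l) * delannoy_q l p"
  unfolding delannoy_q_def delannoy_Suc_Suc' fls_X_power_qpow by (simp add: add.commute)

lemma delannoy_q_0 [simp]: "delannoy_q 0 p = 1" "delannoy_q l 0 = 1"
  by (simp_all add: delannoy_q_def)

lemma delannoy_q_commute: "delannoy_q l p = delannoy_q p l"
  unfolding delannoy_q_def by (rule delannoy_commute)

text \<open>
  Summed over \<open>p\<close>, these terms count the overpartitions of rank \<open>m\<close>,
      those of rank at least \<open>m\<close>
  together with those of rank at least \<open>m + 1\<close>, and those of rank at most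
      \<open>m\<close> together with
  those of rank at most \<open>m + 1\<close>. The last two counts are related by
      \<open>rank_ge_gf_rec\<close>, Dyson's
  adjoint, and \<open>total_gf\<close> is twice the generating function of all overpartitions.
\<close>

definition rank_term_eq :: "nat \<Rightarrow> nat \<Rightarrow> complex fls"
  where "rank_term_eq m p = 2 * (qpow (2 * int p + int m + 1) * delannoy_q p (p + m))"

definition rank_term_ge :: "nat \<Rightarrow> nat \<Rightarrow> complex fls"
  where "rank_term_ge m p = 2 * (qpow (int p + int m + 1) * delannoy_q p (p + m + 1))"

definition rank_term_le :: "nat \<Rightarrow> nat \<Rightarrow> complex fls"
  where "rank_term_le m p = 2 * (qpow (int p) * delannoy_q p (p + m))"

definition "rank_eq_gf m = fsum (rank_term_eq m)"
definition "rank_ge_gf m = fsum (rank_term_ge m)"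
definition "rank_le_gf m = fsum (rank_term_le m)"

lemma low_2_mult: "vanishes_below N f \<Longrightarrow> vanishes_below N (2 * f :: complex fls)"
  using low_0_mult[OF low_numeral] .

lemma low_rank_term_eq: "vanishes_below (int p + int m) (rank_term_eq m p)" and low_kt:
    "vanishes_below (int p + int m) (rank_term_ge m p)"
  and low_rank_term_le: "vanishes_below (int p) (rank_term_le m p)"
  unfolding rank_term_eq_def rank_term_ge_def rank_term_le_def by (intro low_2_mult
      low_qpow_multI low_delannoy; simp)+

lemma null_rank_term_eq: "null_family (rank_term_eq m)"
  by (rule null_family_nat[where C = 0], rule low_mono[OF low_rank_term_eq]) simp

lemma null_rank_term_ge: "null_family (rank_term_ge m)"
  by (rule null_family_nat[where C = 0], rule low_mono[OF low_kt]) simp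

lemma null_rank_term_le: "null_family (rank_term_le m)"
  by (rule null_family_nat[where C = 0], rule low_mono[OF low_rank_term_le]) simp

lemma low_rank_ge_gf: "vanishes_below (int m) (rank_ge_gf m)"
  unfolding rank_ge_gf_def by (rule low_fsum[OF null_rank_term_ge], rule low_mono[OF low_kt]) simp

lemma null_Suc: "null_family f \<Longrightarrow> null_family (\<lambda>n. f (Suc n))"
  by (erule null_family_comp_inj) simp

text \<open>The transposed recurrence, applied to the term at \<open>Suc p\<close>, produces the
  terms of the three other series; the terms at \<open>p = 0\<close> agree since both polynomials
  are \<open>1\<close>.\<close>

lemma rank_ge_gf_diff: "rank_ge_gf m - rank_ge_gf (Suc m) = rank_eq_gf m + rank_eq_gf (Suc m)"
proof -
  have 0: "rank_term_ge m 0 = rank_term_eq m 0" by (simp add: rank_term_ge_def rank_term_eq_def)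
  have S: "rank_term_ge m (Suc p) = rank_term_eq m (Suc p) + (rank_term_ge (Suc m) p +
      rank_term_eq (Suc m) p)" for p
  proof -
    have "delannoy_q (Suc p) (Suc p + m + 1) =
        qpow (int p + 1) * delannoy_q (Suc p) (Suc p + m) + delannoy_q p (p + Suc m + 1) + qpow
            (int p) * delannoy_q p (p + Suc m)"
      using delannoy_q_Suc_Suc'[of p "p + m + 1"] by simp
    then show ?thesis by (simp add: rank_term_ge_def rank_term_eq_def algebra_simps qpow_simps
        del: add_Suc add_Suc_right)
  qed
  have "rank_ge_gf m = rank_term_ge m 0 + fsum (\<lambda>p. rank_term_ge m (Suc p))"
    unfolding rank_ge_gf_def by (rule fsum_nat_Suc[OF null_rank_term_ge])
  also have "fsum (\<lambda>p. rank_term_ge m (Suc p)) = fsum (\<lambda>p. rank_term_eq m (Suc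
      p)) + (rank_ge_gf (Suc m) + rank_eq_gf (Suc m))"
    unfolding S rank_ge_gf_def rank_eq_gf_def
    by (simp add: fsum_add null_family_add null_Suc null_rank_term_eq null_rank_term_ge)
  also have "rank_term_ge m 0 + (fsum (\<lambda>p. rank_term_eq m (Suc p)) + (rank_ge_gf (Suc m)
      + rank_eq_gf (Suc m)))
      = rank_eq_gf m + (rank_ge_gf (Suc m) + rank_eq_gf (Suc m))"
    unfolding 0 rank_eq_gf_def[of m] fsum_nat_Suc[OF null_rank_term_eq[of m]] by simp
  finally show ?thesis by simp
qed

lemma rank_le_gf_Suc: "rank_le_gf (Suc m) = rank_le_gf m + (rank_eq_gf (Suc (Suc m)) + rank_eq_gf
    (Suc m))"
proof -
  have 0: "rank_term_le (Suc m) 0 = rank_term_le m 0" by (simp add: rank_term_le_def)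
  have S: "rank_term_le (Suc m) (Suc p) = rank_term_le m (Suc p) + (rank_term_eq (Suc (Suc m)) p
      + rank_term_eq (Suc m) p)" for p
  proof -
    have "delannoy_q (Suc p) (Suc p + Suc m) = qpow (int p + int m + 2) * delannoy_q p (p + Suc
        (Suc m)) +
        delannoy_q (Suc p) (Suc p + m) + qpow (int p + int m + 1) * delannoy_q p (p + Suc m)"
      using delannoy_q_Suc_Suc[of p "p + m + 1"] by (simp add: algebra_simps)
    then show ?thesis by (simp add: rank_term_le_def rank_term_eq_def algebra_simps qpow_simps
        del: add_Suc add_Suc_right)
  qed
  have "rank_le_gf (Suc m) = rank_term_le (Suc m) 0 + fsum (\<lambda>p. rank_term_le (Suc m) (Suc
      p))"
    unfolding rank_le_gf_def by (rule fsum_nat_Suc[OF null_rank_term_le])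
  also have "fsum (\<lambda>p. rank_term_le (Suc m) (Suc p)) = fsum (\<lambda>p. rank_term_le m
      (Suc p)) + (rank_eq_gf (Suc (Suc m)) + rank_eq_gf (Suc m))"
    unfolding S rank_eq_gf_def
    by (simp add: fsum_add null_family_add null_Suc null_rank_term_eq null_rank_term_le)
  finally show ?thesis
    unfolding 0 rank_le_gf_def[of m] fsum_nat_Suc[OF null_rank_term_le[of m]] by (simp add:
        add.assoc)
qed

text \<open>The \<open>2\<close> is the term at \<open>p = 0\<close>: the empty overpartition,
  counted once for each of the two thresholds. The other terms come from the transposed recurrence
  on the diagonal.\<close>

lemma rank_le_gf_0: "rank_le_gf 0 = 2 + (rank_eq_gf 1 + (rank_ge_gf 0 + rank_eq_gf 0))"
proof -
  have 0: "rank_term_le 0 0 = 2" by (simp add: rank_term_le_def)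
  have S: "rank_term_le 0 (Suc p) = rank_term_eq 1 p + (rank_term_ge 0 p + rank_term_eq 0 p)" for p
    using delannoy_q_commute[of "Suc p" p]
    by (simp add: rank_term_le_def rank_term_eq_def rank_term_ge_def delannoy_q_Suc_Suc'[of p p]
        algebra_simps qpow_simps)
  have "rank_le_gf 0 = rank_term_le 0 0 + fsum (\<lambda>p. rank_term_le 0 (Suc p))"
    unfolding rank_le_gf_def by (rule fsum_nat_Suc[OF null_rank_term_le])
  also have "fsum (\<lambda>p. rank_term_le 0 (Suc p)) = rank_eq_gf 1 + (rank_ge_gf 0 +
      rank_eq_gf 0)"
    unfolding S rank_eq_gf_def rank_ge_gf_def
    by (simp add: fsum_add null_family_add null_rank_term_ge null_rank_term_eq)
  finally show ?thesis by (simp add: 0)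
qed

definition "total_gf = 2 + 2 * rank_ge_gf 0"

text \<open>The thresholds are complementary: rank at most \<open>m\<close> against at least
  \<open>m + 1\<close>, and at most \<open>m + 1\<close> against at least \<open>m + 2\<close>. In
  the induction the two summands change by opposite amounts.\<close>

lemma rank_le_gf_rank_ge_gf: "rank_le_gf m + rank_ge_gf (Suc m) = total_gf"
proof (induction m)
  case 0
  show ?case using rank_le_gf_0 rank_ge_gf_diff[of 0] by (simp add: total_gf_def algebra_simps)
next
  case (Suc m)
  then show ?case using rank_le_gf_Suc[of m] rank_ge_gf_diff[of "Suc m"] by (simp add:
      algebra_simps)
qed

text \<open>The terms of \<open>rank_ge_gf m\<close> and \<open>rank_le_gf (Suc m)\<close> contain
  the same polynomial \<open>delannoy_q p (p + m + 1)\<close>, so they differ only by a power of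
  \<open>q\<close> that is independent of \<open>p\<close>; the complement then returns to
  \<open>rank_ge_gf\<close>.\<close>

lemma rank_ge_gf_rec: "rank_ge_gf m = qpow (int m + 1) * (total_gf - rank_ge_gf (m + 2))"
proof -
  have "rank_term_ge m p = qpow (int m + 1) * rank_term_le (Suc m) p" for p
    by (simp add: rank_term_ge_def rank_term_le_def algebra_simps qpow_simps)
  then have "rank_ge_gf m = qpow (int m + 1) * rank_le_gf (Suc m)"
    unfolding rank_ge_gf_def rank_le_gf_def fsum_mult_left[OF null_rank_term_le, symmetric] by
        (intro arg_cong[of _ _ fsum]) auto
  moreover have "rank_le_gf (Suc m) = total_gf - rank_ge_gf (m + 2)"
    using rank_le_gf_rank_ge_gf[of "Suc m"] by (simp add: algebra_simps)
  ultimately show ?thesis by simp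
qed

text \<open>Unfolding \<open>x m = qpow (m + 1) * (1 - x (m + 2))\<close> yields the alternating
  exponents (m+1) + (m+3) + ... + (m+2n+1), which is
  \<open>(n + 1)\<^sup>2 + m * (n + 1)\<close>.\<close>

definition partial_theta_term :: "nat \<Rightarrow> nat \<Rightarrow> complex fls"
  where "partial_theta_term m n = sign_pow (int n) * qpow ((int n + 1)\<^sup>2 + int m * (int n +
      1))"

definition "partial_theta m = fsum (partial_theta_term m)"

lemma low_partial_theta_term: "vanishes_below (int n + int m) (partial_theta_term m n)"
  unfolding partial_theta_term_def by (auto simp: power2_eq_square algebra_simps)

lemma null_partial_theta_term: "null_family (partial_theta_term m)"
  by (rule null_family_nat[where C = 0], rule low_mono[OF low_partial_theta_term]) simp

lemma low_partial_theta: "vanishes_below (int m) (partial_theta m)"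
  unfolding partial_theta_def by (rule low_fsum[OF null_partial_theta_term], rule low_mono[OF
      low_partial_theta_term]) simp

lemma partial_theta_rec: "partial_theta m = qpow (int m + 1) * (1 - partial_theta (m + 2))"
proof -
  have 0: "partial_theta_term m 0 = qpow (int m + 1)" by (simp add: partial_theta_term_def
      add.commute)
  have "partial_theta_term m (Suc n) = - qpow (int m + 1) * partial_theta_term (m + 2) n" for n
    by (simp add: partial_theta_term_def sign_pow_add algebra_simps power2_eq_square qpow_simps)
  then have "fsum (\<lambda>n. partial_theta_term m (Suc n)) = - qpow (int m + 1) * partial_theta
      (m + 2)"
    unfolding partial_theta_def by (simp add: fsum_mult_left[OF null_partial_theta_term, symmetric])
  moreover have "partial_theta m = partial_theta_term m 0 + fsum (\<lambda>n. partial_theta_term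
      m (Suc n))"
    unfolding partial_theta_def by (rule fsum_nat_Suc[OF null_partial_theta_term])
  ultimately show ?thesis by (simp add: 0 algebra_simps)
qed

text \<open>Both sides solve the same inhomogeneous recurrence. Their difference satisfies the
  homogeneous one, in which every unfolding raises the order by at least one, so it has infinite
  order.\<close>

lemma rank_ge_gf_partial_theta: "rank_ge_gf m = total_gf * partial_theta m"
proof -
  define d where "d m = rank_ge_gf m - total_gf * partial_theta m" for m
  have rec: "d m = - (qpow (int m + 1) * d (m + 2))" for m
    unfolding d_def by (subst rank_ge_gf_rec, subst partial_theta_rec) (simp add: algebra_simps)
  have total_gf: "vanishes_below 0 total_gf"
    unfolding total_gf_def using low_rank_ge_gf[of 0] by (auto intro!: low_add low_2_mult
        low_numeral)
  have lowd: "vanishes_below (int k) (d m)" for k m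
  proof (induction k arbitrary: m)
    case 0
    have "vanishes_below 0 (rank_ge_gf m)" "vanishes_below 0 (partial_theta m)"
      using low_mono[OF low_rank_ge_gf[of m]] low_mono[OF low_partial_theta[of m]] by simp_all
    then show ?case unfolding d_def of_nat_0 by (intro low_diff low_mult0 total_gf)
  next
    case (Suc k)
    have "vanishes_below (int m + 1 + int k) (qpow (int m + 1) * d (m + 2))"
      by (rule low_qpow_mult) (rule Suc)
    then have "vanishes_below (int (Suc k)) (qpow (int m + 1) * d (m + 2))" by (rule low_mono) simp
    then show ?case unfolding rec[of m] by simp
  qed
  have "vanishes_below N (d m)" for N
    by (rule low_mono[OF lowd[of "nat N"]]) simp
  then have "d m = 0" by (rule low_all_imp_0)
  then show ?thesis by (simp add: d_def)
qed

section \<open>Rank differences modulo 3\<close>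

definition chi3 :: "int \<Rightarrow> complex fls"
  where "chi3 r = (if r mod 3 = 0 then 1 else if r mod 3 = 1 then - 1 else 0)"

definition rank_term :: "nat \<times> nat \<Rightarrow> complex fls"
  where "rank_term = (\<lambda>(a, c). chi3 (int c - int a) * (2 * (qpow (int a + int c + 1) *
      delannoy_q a c)))"

definition rank_gf :: "complex fls"
  where "rank_gf = fps_to_fls (Abs_fps (\<lambda>n. of_nat (Nbar 0 3 n) - of_nat (Nbar 1 3 n)))"

lemma low_chi3_mult: "vanishes_below N f \<Longrightarrow> vanishes_below N (chi3 r * f)"
  by (auto simp: chi3_def)

lemma low_rank_term: "vanishes_below (int a + int c + 1) (rank_term (a, c))"
  unfolding rank_term_def prod.case
  by (intro low_chi3_mult low_2_mult low_qpow_multI low_delannoy) simp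

lemma null_rank_term: "null_family rank_term"
proof (rule null_familyI)
  show "vanishes_below (case p of (a, c) \<Rightarrow> int a + int c + 1) (rank_term p)" for p
    by (cases p) (simp add: low_rank_term)
  fix N :: int
  have "{p. (case p of (a, c) \<Rightarrow> int a + int c + 1) < N} \<subseteq> {..nat N}
      \<times> {..nat N}" by auto
  then show "finite {p. (case p of (a, c) \<Rightarrow> int a + int c + 1) < N}"
    by (rule finite_subset) simp
qed

lemma rank_term_nth:
  "fls_nth (rank_term (a, c)) (int n) =
     (if [int c - int a = 0] (mod 3) then fps_nth (2 * fps_X ^ (a + c + 1) * delannoy fps_X a c)
         n else 0) -
     (if [int c - int a = 1] (mod 3) then fps_nth (2 * fps_X ^ (a + c + 1) * delannoy fps_X a c)
         n else 0)"
proof -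
  have e: "2 * (qpow (int a + int c + 1) * delannoy_q a c) = fps_to_fls (2 * fps_X ^ (a + c + 1)
      * delannoy fps_X a c)"
    by (simp only: fls_times_fps_to_fls fps_to_fls_power fps_to_fls_delannoy fps_X_to_fls
        fps_to_fls_numeral fls_X_power_qpow mult.assoc of_nat_add of_nat_1)
  define T where "T = fps_nth (2 * fps_X ^ (a + c + 1) * delannoy fps_X a c :: complex fps) n"
  define r where "r = int c - int a"
  have "[r = 0] (mod 3) \<longleftrightarrow> r mod 3 = 0" "[r = 1] (mod 3) \<longleftrightarrow>
      r mod 3 = 1"
    by (simp_all add: Cong.cong_def)
  moreover have "fls_nth (rank_term (a, c)) (int n) = (if r mod 3 = 0 then T else if r mod 3 = 1
      then - T else 0)"
    unfolding rank_term_def prod.case e chi3_def T_def r_def by auto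
  ultimately show ?thesis
    unfolding T_def[symmetric] r_def[symmetric] by simp
qed

lemma rank_gf_fsum: "rank_gf = fsum rank_term"
proof (rule fls_eqI)
  fix k :: int
  show "fls_nth rank_gf k = fls_nth (fsum rank_term) k"
  proof (cases "k < 0")
    case True
    have "vanishes_below 0 (fsum rank_term)"
    proof (rule low_fsum[OF null_rank_term])
      show "vanishes_below 0 (rank_term p)" for p
        by (cases p) (metis low_rank_term low_mono of_nat_0_le_iff add_nonneg_nonneg zero_le_one)
    qed
    then show ?thesis using True by (simp add: vanishes_below_def rank_gf_def)
  next
    case False
    then obtain n where k: "k = int n" by (metis nonneg_int_cases not_less)
    let ?A = "{..<n} \<times> {..<n}"
    have "vanishes_below (k + 1) (fsum rank_term - sum rank_term ?A)"
    proof (rule fsum_approx[OF null_rank_term])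
      show "{i. \<not> vanishes_below (k + 1) (rank_term i)} \<subseteq> ?A"
      proof
        fix p assume p: "p \<in> {i. \<not> vanishes_below (k + 1) (rank_term i)}"
        obtain a c where ac: "p = (a, c)" by force
        have "\<not> k + 1 \<le> int a + int c + 1"
          using p low_mono[OF low_rank_term[of a c]] unfolding ac by blast
        then show "p \<in> ?A" unfolding ac k by simp
      qed
    qed simp
    then have "fls_nth (fsum rank_term) k = fls_nth (sum rank_term ?A) k"
      by (simp add: vanishes_below_def)
    also have "\<dots> = (\<Sum>p\<in>?A. fls_nth (rank_term p) k)" by (simp add: fls_nth_sum)
    also have "\<dots> = of_nat (Nbar 0 3 n) - of_nat (Nbar 1 3 n)"
      unfolding of_nat_Nbar sum_subtractf[symmetric] k
      by (intro sum.cong refl) (clarify, simp only: rank_term_nth)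
    also have "\<dots> = fls_nth rank_gf k" by (simp add: rank_gf_def k)
    finally show ?thesis by simp
  qed
qed

text \<open>Numbers of parts and largest parts, both decreased by one, indexed by the rank and
    their minimum.\<close>

definition pair_of :: "int \<times> nat \<Rightarrow> nat \<times> nat"
  where "pair_of = (\<lambda>(r, p). (p + nat (- r), p + nat r))"

lemma bij_pair_of: "bij pair_of"
proof (rule o_bij)
  let ?g = "\<lambda>(a, c). (int c - int a, min a c)"
  show "?g \<circ> pair_of = id" by (auto simp: pair_of_def fun_eq_iff)
  show "pair_of \<circ> ?g = id" by (auto simp: pair_of_def fun_eq_iff min_def)
qed

lemma rank_term_pair_of: "rank_term (pair_of (r, p)) = chi3 r * rank_term_eq (nat \<bar>r\<bar>) p"
  by (cases "r \<ge> 0") (simp_all add: rank_term_def pair_of_def rank_term_eq_def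
      delannoy_q_commute[of "p + nat (- r)"] algebra_simps)

lemma low_rank_eq_gf: "vanishes_below (int m) (rank_eq_gf m)"
  unfolding rank_eq_gf_def by (rule low_fsum[OF null_rank_term_eq], rule low_mono[OF
      low_rank_term_eq]) simp

definition "rank_eq_gf_abs r = rank_eq_gf (nat \<bar>r\<bar>)"

lemma null_rank_eq_gf_abs: "null_family (\<lambda>r. rank_eq_gf_abs r)"
  by (rule null_family_int[where C = 0]) (simp add: rank_eq_gf_abs_def low_mono[OF low_rank_eq_gf])

lemma null_chi3_rank_eq_gf_abs: "null_family (\<lambda>r. chi3 r * rank_eq_gf_abs r)"
  by (rule null_family_int[where C = 0]) (simp add: rank_eq_gf_abs_def low_mono[OF
      low_rank_eq_gf] low_chi3_mult)

lemma rank_gf_rank_eq_gf_abs: "rank_gf = fsum (\<lambda>r. chi3 r * rank_eq_gf_abs r)"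
proof -
  have n: "null_family (\<lambda>x. rank_term (pair_of x))"
    by (rule null_family_comp_inj[OF null_rank_term]) (rule bij_is_inj[OF bij_pair_of])
  have "rank_gf = fsum (\<lambda>x. rank_term (pair_of x))"
    unfolding rank_gf_fsum by (rule fsum_reindex[OF null_rank_term bij_pair_of, symmetric])
  also have "\<dots> = fsum (\<lambda>r. fsum (\<lambda>p. rank_term (pair_of (r, p))))"
    by (rule fsum_Fubini[OF n, symmetric])
  finally show ?thesis
    unfolding rank_term_pair_of rank_eq_gf_abs_def rank_eq_gf_def by (simp add: fsum_mult_left[OF
        null_rank_term_eq])
qed

lemma null_rank_ge_gf_diff: "null_family (\<lambda>n. rank_ge_gf (3 * n + 1) - rank_ge_gf (3 * n
    + 2))"
  by (rule null_family_nat[where C = 0], rule low_diff; rule low_mono[OF low_rank_ge_gf]) simp_all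

lemma null_KK3: "null_family (\<lambda>n. rank_ge_gf (3 * n))"
  by (rule null_family_nat[where C = 0], rule low_mono[OF low_rank_ge_gf]) simp_all

text \<open>Pairing the indices \<open>n\<close> and \<open>- n - 1\<close>, the absolute ranks 3n,
  3n+1, 3n+2, 3n+3 carry the signs +, -, -, +. Three consecutive differences of
  \<open>rank_ge_gf\<close> telescope to the multiplicities 1, 2, 2, 1, and subtracting three times
  the middle difference gives these signs. This \<open>3\<close> is the source of the
  \<open>6\<close> in \<open>rank_gf_theta\<close>.\<close>

lemma rank_gf_rank_ge_gf: "rank_gf = rank_ge_gf 0 - 3 * fsum (\<lambda>n. rank_ge_gf (3 * n + 1)
    - rank_ge_gf (3 * n + 2))"
proof -
  have n0: "null_family (\<lambda>m. rank_eq_gf_abs (3 * m))" and n1: "null_family (\<lambda>m.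
      rank_eq_gf_abs (3 * m + 1))"
    by (rule null_family_comp_inj[OF null_rank_eq_gf_abs], auto intro: injI)+
  have "chi3 (3 * m) = 1" "chi3 (3 * m + 1) = - 1" "chi3 (3 * m + 2) = 0" for m
    by (simp_all add: chi3_def)
  then have "rank_gf = fsum (\<lambda>m. rank_eq_gf_abs (3 * m)) - fsum (\<lambda>m.
      rank_eq_gf_abs (3 * m + 1))"
    unfolding rank_gf_rank_eq_gf_abs fsum_split3[OF null_chi3_rank_eq_gf_abs] by (simp add:
        fsum_uminus[OF n1])
  also have "\<dots> = fsum (\<lambda>m. rank_eq_gf_abs (3 * m) - rank_eq_gf_abs (3 * m + 1))"
    by (rule fsum_diff[OF n0 n1, symmetric])
  also have "\<dots> = fsum (\<lambda>n. rank_eq_gf_abs (3 * int n) - rank_eq_gf_abs (3 * int n +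
      1)) +
      fsum (\<lambda>n. rank_eq_gf_abs (3 * (- int n - 1)) - rank_eq_gf_abs (3 * (- int n - 1) +
          1))"
    by (rule fsum_int_halves[OF null_family_diff[OF n0 n1]])
  also have "\<dots> = fsum (\<lambda>n. (rank_eq_gf_abs (3 * int n) - rank_eq_gf_abs (3 * int n
      + 1)) +
      (rank_eq_gf_abs (3 * (- int n - 1)) - rank_eq_gf_abs (3 * (- int n - 1) + 1)))"
    by (rule fsum_add[symmetric]; rule null_family_comp_inj[OF null_family_diff[OF n0 n1]])
       (auto intro: injI)
  also have "(\<lambda>n. (rank_eq_gf_abs (3 * int n) - rank_eq_gf_abs (3 * int n + 1)) +
      (rank_eq_gf_abs (3 * (- int n - 1)) - rank_eq_gf_abs (3 * (- int n - 1) + 1)))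
     = (\<lambda>n. (rank_ge_gf (3 * n) - rank_ge_gf (3 * Suc n)) - 3 * (rank_ge_gf (3 * n + 1) -
         rank_ge_gf (3 * n + 2)))"
  proof
    fix n
    have "rank_eq_gf_abs (3 * int n) = rank_eq_gf (3 * n)" "rank_eq_gf_abs (3 * int n + 1) =
        rank_eq_gf (3 * n + 1)"
      "rank_eq_gf_abs (3 * (- int n - 1)) = rank_eq_gf (3 * n + 3)" "rank_eq_gf_abs (3 * (- int n
          - 1) + 1) = rank_eq_gf (3 * n + 2)"
      unfolding rank_eq_gf_abs_def by (rule arg_cong[of _ _ rank_eq_gf], simp)+
    moreover have "rank_ge_gf (3 * n) - rank_ge_gf (3 * n + 1) = rank_eq_gf (3 * n) + rank_eq_gf
        (3 * n + 1)"
      "rank_ge_gf (3 * n + 1) - rank_ge_gf (3 * n + 2) = rank_eq_gf (3 * n + 1) + rank_eq_gf (3 *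
          n + 2)"
      "rank_ge_gf (3 * n + 2) - rank_ge_gf (3 * n + 3) = rank_eq_gf (3 * n + 2) + rank_eq_gf (3 *
          n + 3)"
      using rank_ge_gf_diff[of "3 * n"] rank_ge_gf_diff[of "3 * n + 1"] rank_ge_gf_diff[of "3 * n
          + 2"]
      by (simp_all add: numeral_3_eq_3)
    moreover have "rank_ge_gf (3 * Suc n) = rank_ge_gf (3 * n + 3)" by (simp add: add.commute)
    ultimately show "(rank_eq_gf_abs (3 * int n) - rank_eq_gf_abs (3 * int n + 1)) +
        (rank_eq_gf_abs (3 * (- int n - 1)) - rank_eq_gf_abs (3 * (- int n - 1) + 1))
      = (rank_ge_gf (3 * n) - rank_ge_gf (3 * Suc n)) - 3 * (rank_ge_gf (3 * n + 1) - rank_ge_gf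
          (3 * n + 2))"
      by (simp only:) (simp add: algebra_simps)
  qed
  also have "fsum \<dots> = fsum (\<lambda>n. rank_ge_gf (3 * n) - rank_ge_gf (3 * Suc n)) - 3 *
      fsum (\<lambda>n. rank_ge_gf (3 * n + 1) - rank_ge_gf (3 * n + 2))"
    unfolding fsum_mult_left[OF null_rank_ge_gf_diff, symmetric]
    by (rule fsum_diff[OF null_family_diff[OF null_KK3 null_Suc[OF null_KK3]]
        null_family_mult_left[OF null_rank_ge_gf_diff]])
  also have "fsum (\<lambda>n. rank_ge_gf (3 * n) - rank_ge_gf (3 * Suc n)) = rank_ge_gf 0"
    using fsum_diff[OF null_KK3 null_Suc[OF null_KK3]] fsum_nat_Suc[OF null_KK3] by simp
  finally show ?thesis .
qed

section \<open>From partial theta series to a Lambert series\<close>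

definition theta :: "int \<Rightarrow> complex fls"
  where "theta k = fsum (\<lambda>n. sign_pow n * qpow (k * n\<^sup>2))"

lemma abs_le_square_int: "\<bar>n\<bar> \<le> (n::int)\<^sup>2"
proof -
  have "\<bar>n\<bar> * 1 \<le> \<bar>n\<bar> * \<bar>n\<bar>" if "n \<noteq> 0"
    by (rule mult_left_mono) (use that in auto)
  then show ?thesis by (cases "n = 0") (simp_all add: power2_eq_square)
qed

lemma null_theta:
  assumes "k \<ge> 1"
  shows "null_family (\<lambda>n. sign_pow n * qpow (k * n\<^sup>2))"
proof (rule null_family_int[where C = 0])
  fix n :: int
  have "1 * n\<^sup>2 \<le> k * n\<^sup>2" using assms by (intro mult_right_mono) auto
  then show "vanishes_below (\<bar>n\<bar> - 0) (sign_pow n * qpow (k * n\<^sup>2))" using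
      abs_le_square_int[of n] by simp
qed

lemma theta_1_partial_theta: "theta 1 = 1 - 2 * partial_theta 0"
proof -
  let ?f = "\<lambda>n. sign_pow n * qpow (1 * n\<^sup>2)"
  have n: "null_family ?f" by (rule null_theta) simp
  have f: "?f (int (Suc m)) = - partial_theta_term 0 m" "?f (- int m - 1) = - partial_theta_term
      0 m" for m
    by (simp_all add: partial_theta_term_def sign_pow_add sign_pow_diff power2_eq_square
        algebra_simps)
  have "theta 1 = fsum (\<lambda>m. ?f (int m)) + fsum (\<lambda>m. ?f (- int m - 1))"
    unfolding theta_def by (rule fsum_int_halves[OF n])
  also have "fsum (\<lambda>m. ?f (int m)) = ?f (int 0) + fsum (\<lambda>m. ?f (int (Suc m)))"
    by (rule fsum_nat_Suc) (rule null_family_comp_int[OF n])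
  finally show ?thesis unfolding f partial_theta_def by (simp add: fsum_uminus[OF
      null_partial_theta_term])
qed

text \<open>The case \<open>m = 0\<close> of \<open>rank_ge_gf_partial_theta\<close> feeds back into
  the definition of \<open>total_gf\<close>. So the overpartition generating function is the inverse
  of \<open>theta 1\<close>, without any product formula.\<close>

lemma theta_1_total_gf: "theta 1 * total_gf = 2"
proof -
  have "theta 1 * total_gf = total_gf - 2 * (total_gf * partial_theta 0)" by (simp add:
      theta_1_partial_theta algebra_simps)
  also have "\<dots> = 2" unfolding rank_ge_gf_partial_theta[symmetric] by (simp add: total_gf_def)
  finally show ?thesis .
qed

definition lambert_term :: "int \<Rightarrow> complex fls"
  where "lambert_term n = (if n = 0 then 0 else sign_pow n * (qpow (n\<^sup>2 + n) / (1 - qpow (3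
      * n))))"

lemma null_lambert_term: "null_family lambert_term"
proof (rule null_family_int[where C = 2])
  fix n :: int
  define z where "z = n * n"
  \<comment> \<open>No integer lies strictly between 1 and 2. This bounds the exponent n^2 - 2n,
    which occurs for positive denominators' reflection, below by |n| - 2.\<close>
  have "0 \<le> (n - 1) * (n - 2)"
    by (cases "n \<le> 1") (auto intro: mult_nonneg_nonneg mult_nonpos_nonpos)
  then have z: "0 \<le> z" "0 \<le> z - 3 * n + 2" "0 \<le> z + 2 * n + 1"
    using zero_le_square[of "n + 1"] by (simp_all add: z_def algebra_simps)
  have "\<bar>n\<bar> - 2 \<le> n\<^sup>2 + n - 3 * n" "\<bar>n\<bar> - 2 \<le> n\<^sup>2 + n"
    unfolding power2_eq_square z_def[symmetric] abs_if using z by auto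
  then show "vanishes_below (\<bar>n\<bar> - 2) (lambert_term n)"
    unfolding lambert_term_def using low_qpow_div[of "3 * n"]
    by (cases "n = 0") (simp_all del: times_divide_eq_right)
qed

text \<open>After interchanging the sums, the series in \<open>k\<close> is geometric with ratio
  q^(3N), N = n + 1. Its numerator q^(N^2+N) - q^(N^2+2N) splits into the Lambert terms at N and -N,
  since reflecting the denominator at -N raises the exponent N^2 - N by 3N.\<close>

lemma partial_theta_lambert_term: "fsum (\<lambda>k. partial_theta (3 * k + 1) - partial_theta (3
    * k + 2)) = - fsum lambert_term"
proof -
  let ?f = "\<lambda>(k, n). partial_theta_term (3 * k + 1) n - partial_theta_term (3 * k + 2) n"
  have nf: "null_family ?f"
  proof (rule null_familyI)
    show "vanishes_below (case p of (k, n) \<Rightarrow> int k + int n) (?f p)" for p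
      by (cases p, simp, rule low_diff; rule low_mono[OF low_partial_theta_term]) simp_all
    fix N :: int
    have "{p. (case p of (k, n) \<Rightarrow> int k + int n) < N} \<subseteq> {..nat N} \<times>
        {..nat N}" by auto
    then show "finite {p. (case p of (k, n) \<Rightarrow> int k + int n) < N}"
      by (rule finite_subset) simp
  qed
  have "fsum (\<lambda>k. partial_theta (3 * k + 1) - partial_theta (3 * k + 2)) = fsum
      (\<lambda>k. fsum (\<lambda>n. partial_theta_term (3 * k + 1) n - partial_theta_term (3 * k
      + 2) n))"
    unfolding partial_theta_def by (simp add: fsum_diff[OF null_partial_theta_term
        null_partial_theta_term])
  also have "\<dots> = fsum (\<lambda>n. fsum (\<lambda>k. partial_theta_term (3 * k + 1) n -
      partial_theta_term (3 * k + 2) n))"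
    by (rule fsum_swap[OF nf])
  also have "\<dots> = fsum (\<lambda>n. - lambert_term (int (Suc n)) - lambert_term (- int n - 1))"
  proof (rule arg_cong[of _ _ fsum], rule ext)
    fix n
    let ?N = "int n + 1"
    let ?c = "sign_pow (int n) * (qpow (?N\<^sup>2 + ?N) - qpow (?N\<^sup>2 + 2 * ?N))"
    have "vanishes_below 1 (qpow (3 * ?N))" by simp
    note g = fsum_geometric[OF this]
    have e: "partial_theta_term (3 * k + 1) n - partial_theta_term (3 * k + 2) n = ?c * qpow (3 *
        ?N) ^ k" for k
      by (simp add: partial_theta_term_def qpow_power algebra_simps qpow_simps)
    have "fsum (\<lambda>k. partial_theta_term (3 * k + 1) n - partial_theta_term (3 * k + 2) n)
        = ?c * (1 / (1 - qpow (3 * ?N)))"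
      unfolding e fsum_mult_left[OF g(1)] g(2) ..
    also have "\<dots> = - lambert_term ?N - lambert_term (- ?N)"
    proof -
      have "lambert_term (- ?N) = sign_pow ?N * (qpow (?N\<^sup>2 - ?N) / (1 - qpow (- (3 * ?N))))"
        by (simp add: lambert_term_def sign_pow_diff sign_pow_add algebra_simps power2_eq_square)
      also have "\<dots> = - (sign_pow ?N * (qpow (?N\<^sup>2 + 2 * ?N) / (1 - qpow (3 * ?N))))"
        by (subst qpow_div_minus) (simp_all add: algebra_simps)
      finally have 1: "lambert_term (- ?N) = - (sign_pow ?N * (qpow (?N\<^sup>2 + 2 * ?N) / (1 -
          qpow (3 * ?N))))" .
      have 2: "lambert_term ?N = sign_pow ?N * (qpow (?N\<^sup>2 + ?N) / (1 - qpow (3 * ?N)))" by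
          (simp add: lambert_term_def)
      show ?thesis unfolding 1 2 sign_pow_add sg_1 by (simp add: diff_divide_distrib
          right_diff_distrib)
    qed
    also have "?N = int (Suc n)" by simp
    also have "- int (Suc n) = - int n - 1" by simp
    finally show "fsum (\<lambda>k. partial_theta_term (3 * k + 1) n - partial_theta_term (3 * k
        + 2) n) = - lambert_term (int (Suc n)) - lambert_term (- int n - 1)" .
  qed
  also have "\<dots> = - fsum (\<lambda>n. lambert_term (int (Suc n))) - fsum (\<lambda>n.
      lambert_term (- int n - 1))"
  proof -
    have a: "null_family (\<lambda>n. lambert_term (int (Suc n)))" and b: "null_family
        (\<lambda>n. lambert_term (- int n - 1))"
      by (rule null_family_comp_inj[OF null_lambert_term], auto intro: injI)+
    show ?thesis unfolding fsum_diff[OF null_family_uminus[OF a] b] fsum_uminus[OF a] ..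
  qed
  also have "\<dots> = - fsum lambert_term"
    using fsum_int_halves[OF null_lambert_term] fsum_nat_Suc[OF null_family_comp_int[OF
        null_lambert_term]]
    by (simp add: lambert_term_def)
  finally show ?thesis .
qed

text \<open>By \<open>theta_1_total_gf\<close>, multiplying \<open>rank_gf\<close> by
  \<open>theta 1\<close> leaves \<open>2 * partial_theta 0\<close> besides the Lambert series; the
  added \<open>theta 1 = 1 - 2 * partial_theta 0\<close> cancels this last partial theta
  series.\<close>

lemma rank_gf_theta: "theta 1 * (1 + rank_gf) = 1 + 6 * fsum lambert_term"
proof -
  have n: "null_family (\<lambda>k. partial_theta (3 * k + 1) - partial_theta (3 * k + 2))"
    by (rule null_family_nat[where C = 0], rule low_diff; rule low_mono[OF low_partial_theta])
        simp_all
  have "fsum (\<lambda>k. rank_ge_gf (3 * k + 1) - rank_ge_gf (3 * k + 2)) = total_gf * fsum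
      (\<lambda>k. partial_theta (3 * k + 1) - partial_theta (3 * k + 2))"
    unfolding fsum_mult_left[OF n, symmetric] by (simp add: rank_ge_gf_partial_theta
        right_diff_distrib)
  then have "rank_gf = total_gf * (partial_theta 0 + 3 * fsum lambert_term)"
    unfolding rank_gf_rank_ge_gf partial_theta_lambert_term by (simp add:
        rank_ge_gf_partial_theta algebra_simps)
  then have "theta 1 * rank_gf = (theta 1 * total_gf) * (partial_theta 0 + 3 * fsum
      lambert_term)" by (simp only: mult.assoc)
  then show ?thesis
    unfolding theta_1_total_gf distrib_left by (simp add: theta_1_partial_theta algebra_simps)
qed

section \<open>Infinite products and the Jacobi triple product\<close>

text \<open>Convergence expressed by orders instead of distances;
  \<open>converges_to_imp_LIMSEQ\<close> carries it over to the topology in which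
  \<open>prodinf\<close> is taken.\<close>

definition converges_to :: "(nat \<Rightarrow> 'a::field fls) \<Rightarrow> 'a fls \<Rightarrow>
    bool"
  where "converges_to p P \<longleftrightarrow> (\<forall>M. \<forall>\<^sub>F n in sequentially.
      vanishes_below M (p n - P))"

lemma tendsD: "converges_to p P \<Longrightarrow> \<forall>\<^sub>F n in sequentially.
    vanishes_below M (p n - P)"
  by (simp add: converges_to_def)

lemma converges_to_const [simp]: "converges_to (\<lambda>_. c) c"
  by (simp add: converges_to_def)

lemma converges_to_unique:
  assumes "converges_to p P" "converges_to p R"
  shows "P = R"
proof (rule eq_lowI)
  fix N
  have "\<forall>\<^sub>F n in sequentially. vanishes_below N (p n - P) \<and> vanishes_below N
      (p n - R)"
    using tendsD[OF assms(1)] tendsD[OF assms(2)] by (rule eventually_conj)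
  then obtain n where "vanishes_below N (p n - P)" "vanishes_below N (p n - R)"
    using eventually_happens by fastforce
  then have "vanishes_below N ((p n - R) - (p n - P))" by (rule low_diff[rotated])
  then show "vanishes_below N (P - R)" by simp
qed

lemma converges_to_mult:
  assumes "converges_to p P" "converges_to r R"
  shows "converges_to (\<lambda>n. p n * r n) (P * R)"
  unfolding converges_to_def
proof
  fix M
  obtain a where a: "vanishes_below a P" using low_ex by blast
  obtain b where b: "vanishes_below b R" using low_ex by blast
  have "\<forall>\<^sub>F n in sequentially. vanishes_below (M - b) (p n - P) \<and>
      vanishes_below (max a 0) (p n - P) \<and> vanishes_below (M - a) (r n - R)"
    by (intro eventually_conj tendsD assms)
  then show "\<forall>\<^sub>F n in sequentially. vanishes_below M (p n * r n - P * R)"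
  proof eventually_elim
    case (elim n)
    have "vanishes_below a (p n)"
      using low_add[OF low_mono[of "max a 0" "p n - P" a] a] elim by simp
    then have 1: "vanishes_below (a + (M - a)) (p n * (r n - R))" using elim by (intro low_mult)
        auto
    have 2: "vanishes_below ((M - b) + b) ((p n - P) * R)" using elim b by (intro low_mult) auto
    have "vanishes_below M (p n * (r n - R) + (p n - P) * R)" using 1 2 by (intro low_add) simp_all
    then show ?case by (simp add: algebra_simps)
  qed
qed

lemma converges_to_power: "converges_to p P \<Longrightarrow> converges_to (\<lambda>n. p n ^ k)
    (P ^ k)"
  by (induction k) (auto intro: converges_to_mult)

lemma converges_to_subseq:
  assumes "converges_to p P" "strict_mono r"
  shows "converges_to (\<lambda>n. p (r n)) P"
  unfolding converges_to_def
proof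
  fix M
  show "\<forall>\<^sub>F n in sequentially. vanishes_below M (p (r n) - P)"
    using tendsD[OF assms(1), of M] filterlim_subseq[OF assms(2)] by (rule
        eventually_compose_filterlim)
qed

lemma converges_to_times: "converges_to p P \<Longrightarrow> c > 0 \<Longrightarrow>
    converges_to (\<lambda>n. p (c * n)) P"
  by (erule converges_to_subseq) (simp add: strict_mono_def)

lemma converges_to_cmult: "converges_to p P \<Longrightarrow> converges_to (\<lambda>n. c * p n)
    (c * P)"
  by (rule converges_to_mult[OF converges_to_const])

lemma dist_le_of_low:
  fixes f g :: "'a::field fls"
  assumes "vanishes_below (int N) (f - g)"
  shows "dist f g \<le> inverse (2 ^ N)"
proof (cases "f = g")
  case False
  then have s: "int N \<le> fls_subdegree (f - g)" using assms by (auto simp: low_iff)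
  then have "N \<le> nat (fls_subdegree (f - g))" by simp
  then have "inverse (2 ^ nat (fls_subdegree (f - g))) \<le> (inverse (2 ^ N) :: real)"
    by (intro le_imp_inverse_le power_increasing) auto
  then show ?thesis using False s by (simp add: dist_fls_def)
qed simp

lemma has_sum_fsum:
  assumes "null_family f"
  shows "(f has_sum fsum f) UNIV"
  unfolding has_sum_def tendsto_iff
proof (intro allI impI)
  fix r :: real assume r: "0 < r"
  obtain N :: nat where N: "inverse (2 ^ N) < r"
    using real_arch_pow_inv[OF r, of "1/2"] by (auto simp: power_one_over inverse_eq_divide)
  show "\<forall>\<^sub>F F in finite_subsets_at_top UNIV. dist (sum f F) (fsum f) < r"
    unfolding eventually_finite_subsets_at_top
  proof (intro exI[of _ "{i. \<not> vanishes_below (int N) (f i)}"] conjI allI impI)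
    show "finite {i. \<not> vanishes_below (int N) (f i)}" by (rule null_familyD[OF assms])
    fix F assume F: "finite F \<and> {i. \<not> vanishes_below (int N) (f i)} \<subseteq> F
        \<and> F \<subseteq> UNIV"
    then have "vanishes_below (int N) (fsum f - sum f F)" by (intro fsum_approx[OF assms]) auto
    then have "dist (fsum f) (sum f F) \<le> inverse (2 ^ N)" by (rule dist_le_of_low)
    then show "dist (sum f F) (fsum f) < r" using N by (simp add: dist_commute)
  qed simp
qed

lemma converges_to_imp_LIMSEQ:
  assumes "converges_to p P"
  shows "p \<longlonglongrightarrow> P"
proof (rule metric_LIMSEQ_I)
  fix r :: real assume r: "0 < r"
  obtain N :: nat where N: "inverse (2 ^ N) < r"
    using real_arch_pow_inv[OF r, of "1/2"] by (auto simp: power_one_over inverse_eq_divide)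
  obtain no where no: "\<And>n. n \<ge> no \<Longrightarrow> vanishes_below (int N) (p n - P)"
    using tendsD[OF assms] unfolding eventually_sequentially by blast
  have "dist (p n) P < r" if "n \<ge> no" for n
    using dist_le_of_low[OF no[OF that]] N by linarith
  then show "\<exists>no. \<forall>n\<ge>no. dist (p n) P < r" by blast
qed

text \<open>The increments of the partial products have growing order, so they form a summable
  family. The limit has constant coefficient \<open>1\<close>; that it is nonzero is part of what
  identifies it as the value of \<open>prodinf\<close>.\<close>

lemma partial_products:
  fixes u :: "nat \<Rightarrow> 'a::field fls"
  assumes u: "\<And>k. vanishes_below (int k + 1) (u k)"
  defines "f \<equiv> \<lambda>k. 1 - u k"
  shows "converges_to (\<lambda>n. \<Prod>k<n. f k) (prodinf f)" "prodinf f \<noteq> 0"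
proof -
  define p where "p n = (\<Prod>k<n. f k)" for n
  have u0: "vanishes_below 0 (u k)" for k by (rule low_mono[OF u]) simp
  have p0: "vanishes_below 0 (p n)" for n
    unfolding p_def f_def using u0 by (intro low_prod0 low_diff) auto
  define d where "d n = - (p n * u n)" for n
  have d: "vanishes_below (int n + 1) (d n)" for n
    unfolding d_def using low_0_mult[OF p0 u] by simp
  have nd: "null_family d"
    by (rule null_family_nat[where C = 0], rule low_mono[OF d]) simp
  have ps: "p n = 1 + (\<Sum>k<n. d k)" for n
  proof (induction n)
    case (Suc n)
    have "p (Suc n) = p n + d n" by (simp add: p_def d_def f_def algebra_simps)
    then show ?case using Suc by simp
  qed (simp add: p_def)
  define P where "P = 1 + fsum d"
  have t: "converges_to p P"
    unfolding converges_to_def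
  proof
    fix M
    have "vanishes_below M (p n - P)" if "n \<ge> nat M" for n
    proof -
      have "vanishes_below M (fsum d - sum d {..<n})"
      proof (rule fsum_approx[OF nd])
        show "{i. \<not> vanishes_below M (d i)} \<subseteq> {..<n}"
        proof
          fix i assume "i \<in> {i. \<not> vanishes_below M (d i)}"
          then have "\<not> M \<le> int i + 1" using low_mono[OF d] by blast
          then show "i \<in> {..<n}" using that by simp
        qed
      qed simp
      then have "vanishes_below M (- (fsum d - sum d {..<n}))" by (simp only: low_uminus)
      then show ?thesis by (simp add: ps P_def)
    qed
    then show "\<forall>\<^sub>F n in sequentially. vanishes_below M (p n - P)"
      unfolding eventually_sequentially by blast
  qed
  have "vanishes_below 1 (fsum d)"
    by (rule low_fsum[OF nd], rule low_mono[OF d]) simp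
  then have "fls_nth P 0 = 1" by (simp add: P_def vanishes_below_def)
  then have P: "P \<noteq> 0" by auto
  \<comment> \<open>The products in \<open>raw_has_prod\<close> include the index \<open>n\<close>
    itself, hence the shift.\<close>
  have "converges_to (\<lambda>n. p (Suc n)) P" by (rule converges_to_subseq[OF t]) (simp add:
      strict_mono_def)
  then have "(\<lambda>n. p (Suc n)) \<longlonglongrightarrow> P" by (rule converges_to_imp_LIMSEQ)
  then have "f has_prod P"
    unfolding has_prod_def raw_has_prod_def p_def lessThan_Suc_atMost using P by simp
  then have "prodinf f = P" by (rule has_prod_unique[symmetric])
  then show "converges_to (\<lambda>n. \<Prod>k<n. f k) (prodinf f)" "prodinf f \<noteq> 0"
    using t P by (simp_all add: p_def[symmetric])
qed

section \<open>Euler products and their finite truncations\<close>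

definition euler_partial :: "int \<Rightarrow> nat \<Rightarrow> complex fls"
  where "euler_partial s n = (\<Prod>k<n. 1 - qpow (s * (int k + 1)))"

definition euler_plus_partial :: "int \<Rightarrow> nat \<Rightarrow> complex fls"
  where "euler_plus_partial s n = (\<Prod>k<n. 1 + qpow (s * (int k + 1)))"

definition euler_prod :: "int \<Rightarrow> complex fls" where "euler_prod s = qpoch_inf (qpow s)
    (qpow s)"
definition euler_plus_prod :: "int \<Rightarrow> complex fls" where "euler_plus_prod s =
    qpoch_inf (- qpow s) (qpow s)"

lemma euler_partial_0 [simp]: "euler_partial s 0 = 1" and mc_0 [simp]: "euler_plus_partial s 0 = 1"
  by (simp_all add: euler_partial_def euler_plus_partial_def)

lemma euler_partial_Suc: "euler_partial s (Suc n) = euler_partial s n * (1 - qpow (s * (int n +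
    1)))"
  and euler_plus_partial_Suc: "euler_plus_partial s (Suc n) = euler_plus_partial s n * (1 + qpow
      (s * (int n + 1)))"
  by (simp_all add: euler_partial_def euler_plus_partial_def mult.commute)

lemma le_times_Suc: "s \<ge> 1 \<Longrightarrow> int k + 1 \<le> s * (int k + 1)"
  using mult_right_mono[of 1 s "int k + 1"] by simp

lemma converges_to_euler_partial: "s \<ge> 1 \<Longrightarrow> converges_to (euler_partial s)
    (euler_prod s)" and EE_nz: "s \<ge> 1 \<Longrightarrow> euler_prod s \<noteq> 0"
  and converges_to_euler_plus_partial: "s \<ge> 1 \<Longrightarrow> converges_to
      (euler_plus_partial s) (euler_plus_prod s)" and MM_nz: "s \<ge> 1 \<Longrightarrow>
      euler_plus_prod s \<noteq> 0"
proof -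
  assume s: "s \<ge> 1"
  have e: "qpow s * qpow s ^ k = qpow (s * (int k + 1))" for k
    by (simp add: qpow_power qpow_mult algebra_simps)
  have "vanishes_below (int k + 1) (qpow (s * (int k + 1)))" for k using le_times_Suc[OF s] by simp
  from partial_products[of "\<lambda>k. qpow (s * (int k + 1))", OF this]
  show "converges_to (euler_partial s) (euler_prod s)" "euler_prod s \<noteq> 0"
    unfolding euler_prod_def qpoch_inf_def e euler_partial_def by blast+
  have "vanishes_below (int k + 1) (- qpow (s * (int k + 1)))" for k using le_times_Suc[OF s] by
      simp
  from partial_products[of "\<lambda>k. - qpow (s * (int k + 1))", OF this]
  show "converges_to (euler_plus_partial s) (euler_plus_prod s)" "euler_plus_prod s \<noteq> 0"
    unfolding euler_plus_prod_def qpoch_inf_def mult_minus_left e euler_plus_partial_def by simp_all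
qed

lemma euler_partial_nz: "s \<ge> 1 \<Longrightarrow> euler_partial s n \<noteq> 0"
  unfolding euler_partial_def using one_minus_qpow_nz by (auto simp: prod_zero_iff)

lemma euler_plus_prod_mult_euler_prod: "s \<ge> 1 \<Longrightarrow> euler_plus_prod s *
    euler_prod s = euler_prod (2 * s)"
proof -
  assume s: "s \<ge> 1"
  have "euler_plus_partial s n * euler_partial s n = euler_partial (2 * s) n" for n
    unfolding euler_plus_partial_def euler_partial_def prod.distrib[symmetric]
    by (rule prod.cong) (simp_all add: algebra_simps qpow_simps)
  then have "converges_to (euler_partial (2 * s)) (euler_plus_prod s * euler_prod s)"
    using converges_to_mult[OF converges_to_euler_plus_partial[OF s]
        converges_to_euler_partial[OF s]] by simp
  then show ?thesis using converges_to_unique converges_to_euler_partial[of "2 * s"] s by auto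
qed

section \<open>Triangular exponents and the finite triple product\<close>

definition tri :: "int \<Rightarrow> int" where "tri k = k * (k - 1) div 2"

text \<open>Identities between exponents are checked after doubling, which turns them into
  polynomial identities without integer division.\<close>

lemma two_tri: "2 * tri k = k * (k - 1)"
proof -
  have "even (k * (k - 1))" by simp
  then show ?thesis unfolding tri_def by simp
qed

lemma tri_eqI: "2 * x = k * (k - 1) \<Longrightarrow> tri k = x"
  using two_tri[of k] by simp

lemma tri_add: "tri (k + m) = tri k + tri m + k * m"
  by (rule tri_eqI) (use two_tri[of k] two_tri[of m] in \<open>simp add: algebra_simps\<close>)

lemma tri_uminus: "tri (- k) = tri k + k"
  by (rule tri_eqI) (use two_tri[of k] in \<open>simp add: algebra_simps\<close>)

lemma tri_0 [simp]: "tri 0 = 0" and tri_1 [simp]: "tri 1 = 0" and tri_2 [simp]: "tri 2 = 1"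
  by (simp_all add: tri_def)

lemma tri_Suc: "tri (k + 1) = tri k + k"
  by (simp add: tri_add)

lemma square_tri: "k\<^sup>2 = 2 * tri k + k"
  using two_tri[of k] by (simp add: power2_eq_square algebra_simps)

lemma tri_ge: "4 * \<bar>k\<bar> - 6 \<le> 2 * tri k + \<bar>k\<bar>"
proof -
  have "0 \<le> (\<bar>k\<bar> - 2) * (\<bar>k\<bar> - 2) + 0" by simp
  then have "4 * \<bar>k\<bar> - 4 \<le> k\<^sup>2" by (simp add: power2_eq_square algebra_simps)
  then show ?thesis using square_tri[of k] by linarith
qed

text \<open>The value \<open>0\<close> at negative indices is the usual convention for reciprocals
  of q-factorials: it makes \<open>inv_poch_rec\<close> valid at \<open>i = 0\<close> too, so that
  recurrences hold for all integers.\<close>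

definition inv_poch :: "int \<Rightarrow> int \<Rightarrow> complex fls"
  where "inv_poch s i = (if i < 0 then 0 else inverse (euler_partial s (nat i)))"

lemma inv_poch_rec: "s \<ge> 1 \<Longrightarrow> inv_poch s (i - 1) = (1 - qpow (s * i)) *
    inv_poch s i"
proof -
  assume s: "s \<ge> 1"
  consider "i < 0" | "i = 0" | n where "i = int (Suc n)"
    by (metis int_cases neg_int_cases not0_implies_Suc of_nat_0 linorder_neqE_linordered_idom
        zero_less_imp_eq_int gr0_implies_Suc)
  then show ?thesis
  proof cases
    case (3 n)
    have "1 - qpow (s * i) \<noteq> 0" using s 3 by (intro one_minus_qpow_nz) auto
    then show ?thesis using 3 euler_partial_nz[OF s, of n]
      by (simp add: inv_poch_def nat_add_distrib euler_partial_Suc add.commute)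
  qed (simp_all add: inv_poch_def)
qed

text \<open>The Gaussian binomial coefficient of 2N over N + j in the base q^s.\<close>

definition jtp_coeff :: "int \<Rightarrow> nat \<Rightarrow> int \<Rightarrow> complex fls"
  where "jtp_coeff s N j = euler_partial s (2 * N) * (inv_poch s (int N + j) * inv_poch s (int N
      - j))"

lemma jtp_coeff_outside: "\<bar>j\<bar> > int N \<Longrightarrow> jtp_coeff s N j = 0"
  by (auto simp: jtp_coeff_def inv_poch_def)

lemma jtp_coeff_0: "jtp_coeff s 0 j = (if j = 0 then 1 else 0)"
  by (auto simp: jtp_coeff_def inv_poch_def)

text \<open>Two steps of the q-Pascal rule, from 2N to 2N + 2. All neighbours are expressed through
  the outermost factors \<open>u\<close> and \<open>v\<close>, leaving a polynomial identity in
  \<open>a\<close>, \<open>b\<close>, \<open>c\<close>.\<close>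

lemma jtp_coeff_rec:
  assumes s: "s \<ge> 1"
  shows "jtp_coeff s (Suc N) j = (1 + qpow (s * (2 * int N + 1))) * jtp_coeff s N j +
     qpow (s * (int N + 1 - j)) * jtp_coeff s N (j - 1) + qpow (s * (int N + 1 + j)) * jtp_coeff
         s N (j + 1)"
proof -
  define u v where "u = inv_poch s (int N + 1 + j)" and "v = inv_poch s (int N + 1 - j)"
  define a b c where "a = qpow (s * (int N + j))" and "b = qpow (s * (int N - j))" and "c = qpow s"
  have rec: "inv_poch s i = (1 - qpow (s * (i + 1))) * inv_poch s (i + 1)" for i
    using inv_poch_rec[OF s, of "i + 1"] by simp
  have u: "inv_poch s (int N + j) = (1 - a * c) * u"
    unfolding rec[of "int N + j"] by (simp add: u_def a_def c_def qpow_mult algebra_simps)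
  have u': "inv_poch s (int N + (j - 1)) = (1 - a) * ((1 - a * c) * u)"
    using inv_poch_rec[OF s, of "int N + j"] unfolding u a_def[symmetric] add_diff_eq .
  have v: "inv_poch s (int N - j) = (1 - b * c) * v"
    unfolding rec[of "int N - j"] by (simp add: v_def b_def c_def qpow_mult algebra_simps)
  have v': "inv_poch s (int N - (j + 1)) = (1 - b) * ((1 - b * c) * v)"
    using inv_poch_rec[OF s, of "int N - j"] unfolding v b_def[symmetric] diff_diff_eq .
  have w: "inv_poch s (int N + (j + 1)) = u" "inv_poch s (int N - (j - 1)) = v"
    by (simp_all add: u_def v_def algebra_simps)
  have w': "inv_poch s (int (Suc N) + j) = u" "inv_poch s (int (Suc N) - j) = v"
    by (simp_all add: u_def v_def algebra_simps)
  have ab: "a * b * c = qpow (s * (2 * int N + 1))" "b * c = qpow (s * (int N + 1 - j))"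
    "a * c = qpow (s * (int N + 1 + j))" "a * b * c * c = qpow (s * (2 * int N + 2))"
    by (simp_all add: a_def b_def c_def qpow_mult algebra_simps)
  have "euler_partial s (2 * Suc N) = euler_partial s (2 * N) * (1 - qpow (s * (2 * int N + 1)))
      * (1 - qpow (s * (2 * int N + 2)))"
    by (simp add: euler_partial_Suc algebra_simps)
  then have p: "euler_partial s (2 * Suc N) = euler_partial s (2 * N) * (1 - a * b * c) * (1 - a
      * b * c * c)"
    unfolding ab(4)[symmetric] ab(1)[symmetric] .
  show ?thesis
    unfolding jtp_coeff_def p u u' v v' w w' ab[symmetric] by (simp add: algebra_simps)
qed

lemma null_family_qpow:
  assumes "\<And>n. vanishes_below 0 (c n)" "\<And>n. \<bar>n\<bar> - C \<le> e n"
  shows "null_family (\<lambda>n::int. c n * qpow (e n))"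
proof (rule null_family_int)
  show "vanishes_below (\<bar>n\<bar> - C) (c n * qpow (e n))" for n
    using low_qpow_multI[OF assms, of n] by (simp add: mult.commute)
qed

text \<open>Multiplied by \<open>euler_partial s N\<close>, the Gaussian coefficient becomes a
  product of two tails of the Euler product, all of whose exponents exceed N - |j|.\<close>

lemma low_jtp_coeff:
  assumes s: "s \<ge> 1"
  shows "vanishes_below 0 (euler_partial s N * jtp_coeff s N j)" "vanishes_below (int N -
      \<bar>j\<bar>) (euler_partial s N * jtp_coeff s N j - 1)"
proof -
  have main: "vanishes_below 0 (euler_partial s N * jtp_coeff s N j) \<and> vanishes_below (int N
      - \<bar>j\<bar>) (euler_partial s N * jtp_coeff s N j - 1)"
  proof (cases "\<bar>j\<bar> \<le> int N")
    case False
    then show ?thesis by (auto simp: jtp_coeff_outside intro: low_mono)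
  next
    case True
    have prod1: "vanishes_below (int k) ((\<Prod>i\<in>{k..<n}. 1 - qpow (s * (int i + 1))) - 1)"
        if "k \<le> n" for k n
      using that
    proof (induction n rule: dec_induct)
      case (step n)
      let ?P = "\<Prod>i\<in>{k..<n}. 1 - qpow (s * (int i + 1))"
      have "int k \<le> s * (int n + 1)"
        using le_times_Suc[OF s, of n] step(1) by linarith
      then have "vanishes_below (int k) (qpow (s * (int n + 1)))" by (simp only: low_qpow)
      moreover have "vanishes_below 0 ?P"
        by (intro low_prod0 low_diff) (use s in \<open>auto intro: mult_nonneg_nonneg\<close>)
      ultimately have "vanishes_below (int k) (?P * qpow (s * (int n + 1)))" by (intro low_0_mult)
      with step.IH have "vanishes_below (int k) ((?P - 1) - ?P * qpow (s * (int n + 1)))" by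
          (rule low_diff)
      then show ?case using step(1) by (simp add: prod.atLeastLessThan_Suc algebra_simps)
    qed simp
    have quot: "euler_partial s n * inverse (euler_partial s k) = (\<Prod>i\<in>{k..<n}. 1 - qpow
        (s * (int i + 1)))" if "k \<le> n" for k n
    proof -
      have "euler_partial s n = euler_partial s k * (\<Prod>i\<in>{k..<n}. 1 - qpow (s * (int i +
          1)))"
        unfolding euler_partial_def lessThan_atLeast0 using that by (simp add:
            prod.atLeastLessThan_concat)
      then show ?thesis using euler_partial_nz[OF s, of k] by simp
    qed
    define a b where "a = nat (int N + \<bar>j\<bar>)" and "b = nat (int N - \<bar>j\<bar>)"
    have ab: "a \<le> 2 * N" "b \<le> N" "int b = int N - \<bar>j\<bar>" "b \<le> a" using True
        by (auto simp: a_def b_def)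
    define A B where "A = (\<Prod>i\<in>{a..<2 * N}. 1 - qpow (s * (int i + 1)))"
      and "B = (\<Prod>i\<in>{b..<N}. 1 - qpow (s * (int i + 1)))"
    have "jtp_coeff s N j = euler_partial s (2 * N) * inverse (euler_partial s a) * inverse
        (euler_partial s b)"
      using True by (cases "j \<ge> 0") (simp_all add: jtp_coeff_def inv_poch_def a_def b_def)
    then have "euler_partial s N * jtp_coeff s N j = (euler_partial s (2 * N) * inverse
        (euler_partial s a)) * (euler_partial s N * inverse (euler_partial s b))"
      by (simp only: mult_ac)
    then have e: "euler_partial s N * jtp_coeff s N j = A * B"
      unfolding quot[OF ab(1)] quot[OF ab(2)] A_def B_def .
    have A: "vanishes_below (int b) (A - 1)"
      unfolding A_def using low_mono[OF prod1[OF ab(1)], of "int b"] ab(4) by simp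
    have B: "vanishes_below (int b) (B - 1)"
      unfolding B_def by (rule prod1[OF ab(2)])
    have B0: "vanishes_below 0 B" using low_add[OF low_mono[OF B, of 0], of 1] by simp
    have A0: "vanishes_below 0 A" using low_add[OF low_mono[OF A, of 0], of 1] by simp
    have "vanishes_below (int b) ((A - 1) * B + (B - 1))"
      by (intro low_add low_mult0 A B B0)
    then have "vanishes_below (int b) (A * B - 1)" by (simp add: algebra_simps)
    then show ?thesis unfolding e ab(3) using low_mult0[OF A0 B0] by simp
  qed
  show "vanishes_below 0 (euler_partial s N * jtp_coeff s N j)" "vanishes_below (int N -
      \<bar>j\<bar>) (euler_partial s N * jtp_coeff s N j - 1)"
    using main by auto
qed

lemma null_jtp_sum: "null_family (\<lambda>j. g j * jtp_coeff s N j)"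
proof (rule null_family_finite, rule finite_subset)
  show "{j. g j * jtp_coeff s N j \<noteq> 0} \<subseteq> {- int N..int N}"
  proof
    fix j assume "j \<in> {j. g j * jtp_coeff s N j \<noteq> 0}"
    then have "\<not> \<bar>j\<bar> > int N" using jtp_coeff_outside[of N j s] by auto
    then show "j \<in> {- int N..int N}" by auto
  qed
qed simp

text \<open>Dominated convergence in the sense of Tannery: the finitely many terms of low order
  satisfy |j| <= \<open>m\<close> and are controlled by \<open>low_jtp_coeff\<close>; all other
  terms are already small.\<close>

lemma converges_to_jtp_coeff:
  assumes s: "s \<ge> 1" and f: "null_family f"
  shows "converges_to (\<lambda>N. euler_partial s N * fsum (\<lambda>j. f j * jtp_coeff s N j))
      (fsum f)"
  unfolding converges_to_def
proof
  fix M
  let ?J = "{j. \<not> vanishes_below M (f j)}"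
  have fin: "finite ?J" by (rule null_familyD[OF f])
  obtain B where B: "vanishes_below B (f j)" for j using null_family_lower[OF f] by blast
  define m where "m = Max (insert 0 (abs ` ?J))"
  have m: "\<bar>j\<bar> \<le> m" if "j \<in> ?J" for j
    unfolding m_def using fin that by (intro Max_ge) auto
  have "vanishes_below M (euler_partial s N * fsum (\<lambda>j. f j * jtp_coeff s N j) - fsum f)"
      if N: "int N \<ge> M - B + m" for N
  proof -
    let ?c = "\<lambda>j. euler_partial s N * jtp_coeff s N j"
    have fc: "null_family (\<lambda>j. f j * jtp_coeff s N j)" by (rule null_jtp_sum)
    have n1: "null_family (\<lambda>j. euler_partial s N * (f j * jtp_coeff s N j))" by (rule
        null_family_mult_left[OF fc])
    have "euler_partial s N * fsum (\<lambda>j. f j * jtp_coeff s N j) - fsum f = fsum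
        (\<lambda>j. euler_partial s N * (f j * jtp_coeff s N j) - f j)"
      by (simp only: fsum_mult_left[OF fc] fsum_diff[OF n1 f])
    also have "vanishes_below M \<dots>"
    proof (rule low_fsum[OF null_family_diff[OF n1 f]])
      fix j
      have "vanishes_below M (f j * (?c j - 1))"
      proof (cases "vanishes_below M (f j)")
        case True
        have "vanishes_below 0 (?c j - 1)" using low_jtp_coeff(1)[OF s, of N j] by (intro
            low_diff) auto
        then show ?thesis by (rule low_mult0[OF True])
      next
        case False
        have "vanishes_below (B + (int N - \<bar>j\<bar>)) (f j * (?c j - 1))"
          by (rule low_mult[OF B low_jtp_coeff(2)[OF s]])
        then show ?thesis using N m[of j] False by (auto elim: low_mono)
      qed
      then show "vanishes_below M (euler_partial s N * (f j * jtp_coeff s N j) - f j)" by (simp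
          add: algebra_simps)
    qed
    finally show ?thesis .
  qed
  then show "\<forall>\<^sub>F N in sequentially. vanishes_below M (euler_partial s N * fsum
      (\<lambda>j. f j * jtp_coeff s N j) - fsum f)"
    unfolding eventually_sequentially by (metis nat_le_iff)
qed

definition jtp_term :: "int \<Rightarrow> int \<Rightarrow> complex fls" where "jtp_term s j =
    sign_pow j * qpow (s * tri j)"

lemma jtp_term_Suc: "jtp_term s (j + 1) = - qpow (s * j) * jtp_term s j"
  unfolding jtp_term_def tri_Suc sign_pow_add by (simp add: algebra_simps qpow_simps)

text \<open>The weight stays arbitrary so that one recurrence serves both the powers of z and the
  weight j, their derivative at z = 1.\<close>

definition jtp_sum :: "int \<Rightarrow> (int \<Rightarrow> complex fls) \<Rightarrow> nat
    \<Rightarrow> complex fls"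
  where "jtp_sum s w N = fsum (\<lambda>j. jtp_term s j * w j * jtp_coeff s N j)"

text \<open>Shifting the summation index moves the shift from the coefficient to the weight; the
  ratio of consecutive \<open>jtp_term\<close> cancels the dependence of the powers of
  \<open>q\<close> on \<open>j\<close>.\<close>

lemma jtp_sum_Suc:
  assumes s: "s \<ge> 1"
  shows "jtp_sum s w (Suc N) = (1 + qpow (s * (2 * int N + 1))) * jtp_sum s w N
     - qpow (s * int N) * jtp_sum s (\<lambda>j. w (j + 1)) N - qpow (s * (int N + 1)) * jtp_sum
         s (\<lambda>j. w (j - 1)) N"
proof -
  let ?g1 = "\<lambda>j. (1 + qpow (s * (2 * int N + 1))) * (jtp_term s j * w j * jtp_coeff s N j)"
  let ?g2 = "\<lambda>j. - qpow (s * int N) * (jtp_term s j * w (j + 1) * jtp_coeff s N j)"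
  let ?g3 = "\<lambda>j. - qpow (s * (int N + 1)) * (jtp_term s j * w (j - 1) * jtp_coeff s N j)"
  have n: "null_family ?g1" "null_family ?g2" "null_family ?g3"
    by (intro null_family_mult_left null_jtp_sum)+
  have n2: "null_family (\<lambda>j. ?g2 (j + (-1)))" and n3: "null_family (\<lambda>j. ?g3 (j +
      1))"
    using null_family_comp_inj[OF n(2), of "\<lambda>j. j + (-1)"] null_family_comp_inj[OF n(3),
        of "\<lambda>j. j + 1"]
    by (simp_all add: inj_def)
  have "jtp_term s j * w j * jtp_coeff s (Suc N) j = ?g1 j + (?g2 (j + (-1)) + ?g3 (j + 1))" for j
  proof -
    have 2: "qpow (s * (int N + 1 - j)) * jtp_term s j = - qpow (s * int N) * jtp_term s (j - 1)"
      using jtp_term_Suc[of s "j - 1"] by (simp add: algebra_simps qpow_simps)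
    have 3: "qpow (s * (int N + 1 + j)) * jtp_term s j = - qpow (s * (int N + 1)) * jtp_term s (j
        + 1)"
      unfolding jtp_term_Suc by (simp add: algebra_simps qpow_simps)
    have "jtp_term s j * w j * jtp_coeff s (Suc N) j = ?g1 j + (qpow (s * (int N + 1 - j)) *
        jtp_term s j) * w j * jtp_coeff s N (j - 1)
        + (qpow (s * (int N + 1 + j)) * jtp_term s j) * w j * jtp_coeff s N (j + 1)"
      unfolding jtp_coeff_rec[OF s] by (simp add: algebra_simps)
    then show ?thesis unfolding 2 3 by (simp add: algebra_simps)
  qed
  then have "jtp_sum s w (Suc N) = fsum (\<lambda>j. ?g1 j + (?g2 (j + (-1)) + ?g3 (j + 1)))"
    unfolding jtp_sum_def by presburger
  also have "\<dots> = fsum ?g1 + (fsum (\<lambda>j. ?g2 (j + (-1))) + fsum (\<lambda>j. ?g3 (j +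
      1)))"
    unfolding fsum_add[OF n2 n3, symmetric] by (rule fsum_add[OF n(1) null_family_add[OF n2 n3]])
  also have "\<dots> = fsum ?g1 + (fsum ?g2 + fsum ?g3)"
    unfolding fsum_int_shift[OF n(2)] fsum_int_shift[OF n(3)] ..
  also have "\<dots> = (1 + qpow (s * (2 * int N + 1))) * jtp_sum s w N
     - qpow (s * int N) * jtp_sum s (\<lambda>j. w (j + 1)) N - qpow (s * (int N + 1)) * jtp_sum
         s (\<lambda>j. w (j - 1)) N"
    unfolding jtp_sum_def fsum_mult_left[OF null_jtp_sum] by simp
  finally show ?thesis .
qed

lemma jtp_sum_cmult: "jtp_sum s (\<lambda>j. c * w j) N = c * jtp_sum s w N"
  unfolding jtp_sum_def fsum_mult_left[OF null_jtp_sum, symmetric] by (simp add: mult_ac)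

lemma jtp_sum_0: "jtp_sum s w 0 = w 0"
  unfolding jtp_sum_def by (subst fsum_finite[of "{0}"]) (auto simp: jtp_coeff_0 jtp_term_def)

text \<open>For a geometric weight the shifts in \<open>jtp_sum_Suc\<close> are multiplications by z
  and its inverse, and the resulting coefficient factors. This is the finite triple product.\<close>

lemma jtp_sum_product:
  assumes s: "s \<ge> 1" and z: "z \<noteq> 0" and w: "\<And>j. w (j + 1) = z * w j" "w 0 = 1"
  shows "jtp_sum s w N = (\<Prod>k<N. (1 - z * qpow (s * int k)) * (1 - qpow (s * (int k + 1)) /
      z))"
proof (induction N)
  case 0
  show ?case by (simp add: jtp_sum_0 w)
next
  case (Suc N)
  have w': "w (j - 1) = inverse z * w j" for j using w(1)[of "j - 1"] z by (simp add: field_simps)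
  have e: "qpow (s * (2 * int N + 1)) = qpow (s * int N) * qpow (s * (int N + 1))"
    by (simp add: qpow_mult algebra_simps)
  have "jtp_sum s w (Suc N) = (1 + qpow (s * (2 * int N + 1)) - qpow (s * int N) * z - qpow (s *
      (int N + 1)) * inverse z) * jtp_sum s w N"
    unfolding jtp_sum_Suc[OF s] w(1) w' jtp_sum_cmult by (simp add: algebra_simps)
  also have "1 + qpow (s * (2 * int N + 1)) - qpow (s * int N) * z - qpow (s * (int N + 1)) *
      inverse z
      = (1 - z * qpow (s * int N)) * (1 - qpow (s * (int N + 1)) / z)"
    unfolding e using z by (simp add: field_simps)
  finally show ?case using Suc by (simp add: mult.commute)
qed

lemma Jacobi_triple_product:
  assumes s: "s \<ge> 1" and z: "z \<noteq> 0" and w: "\<And>j. w (j + 1) = z * w j" "w 0 = 1"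
    and n: "null_family (\<lambda>j. jtp_term s j * w j)"
  shows "converges_to (\<lambda>N. euler_partial s N * (\<Prod>k<N. (1 - z * qpow (s * int k)) *
      (1 - qpow (s * (int k + 1)) / z)))
     (fsum (\<lambda>j. jtp_term s j * w j))"
  using converges_to_jtp_coeff[OF s n] unfolding jtp_sum_product[OF s z w, symmetric] jtp_sum_def .

lemma jtp_sum_1:
  assumes "s \<ge> 1"
  shows "jtp_sum s (\<lambda>_. 1) (Suc N) = 0"
proof -
  have "jtp_sum s (\<lambda>_. 1) (Suc N) = (\<Prod>k<Suc N. (1 - 1 * qpow (s * int k)) * (1 -
      qpow (s * (int k + 1)) / 1))"
    by (rule jtp_sum_product[OF assms]) simp_all
  also have "\<dots> = 0" by (rule prod_zero) (auto intro: bexI[of _ 0])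
  finally show ?thesis .
qed

text \<open>For the weight j a shift only adds a multiple of the sum with weight 1, which is zero
  from \<open>N = 1\<close> on. The nonzero value at \<open>N = 0\<close> starts the induction. This
  gives the derivative of the finite triple product at z = 1 without differentiation.\<close>

lemma jtp_sum_of_int:
  assumes s: "s \<ge> 1"
  shows "jtp_sum s of_int (Suc N) = - (euler_partial s N * euler_partial s (Suc N))"
proof (induction N)
  have sh: "jtp_sum s (\<lambda>j. of_int (j + c)) N = jtp_sum s of_int N + of_int c * jtp_sum s
      (\<lambda>_. 1) N" for N c
    unfolding jtp_sum_def fsum_mult_left[OF null_jtp_sum, symmetric] fsum_add[OF null_jtp_sum
        null_family_mult_left[OF null_jtp_sum], symmetric]
    by (simp add: algebra_simps)
  note sh' = sh[of 1] sh[of "-1"]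
  {
    case 0
    show ?case unfolding jtp_sum_Suc[OF s] using sh'[of 0] by (simp add: jtp_sum_0
        euler_partial_Suc)
  next
    case (Suc N)
    have e: "qpow (s * (2 * int (Suc N) + 1)) = qpow (s * int (Suc N)) * qpow (s * (int (Suc N) +
        1))"
      by (simp add: qpow_mult algebra_simps)
    have "jtp_sum s of_int (Suc (Suc N)) = (1 - qpow (s * int (Suc N))) * (1 - qpow (s * (int
        (Suc N) + 1))) * jtp_sum s of_int (Suc N)"
      unfolding jtp_sum_Suc[OF s, of _ "Suc N"] e using sh'[of "Suc N"] jtp_sum_1[OF s, of N]
      by (simp add: algebra_simps)
    also have "\<dots> = - (euler_partial s (Suc N) * euler_partial s (Suc (Suc N)))"
      unfolding Suc euler_partial_Suc by (simp add: algebra_simps)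
    finally show ?case .
  }
qed

text \<open>Jacobi's identity for the cube of the Euler product in bilateral form; pairing j with 1
  - j gives the usual coefficients 2j - 1.\<close>

lemma Jacobi_subst_cube:
  assumes s: "s \<ge> 1" and n: "null_family (\<lambda>j. jtp_term s j * of_int j)"
  shows "fsum (\<lambda>j. jtp_term s j * of_int j) = - (euler_prod s ^ 3)"
proof -
  have "converges_to (\<lambda>N. euler_partial s (Suc N) * jtp_sum s of_int (Suc N)) (fsum
      (\<lambda>j. jtp_term s j * of_int j))"
    using converges_to_subseq[OF converges_to_jtp_coeff[OF s n], of Suc] unfolding jtp_sum_def by
        (simp add: strict_mono_def)
  moreover have "converges_to (\<lambda>N. euler_partial s (Suc N) * jtp_sum s of_int (Suc N)) (-
      1 * (euler_prod s * (euler_prod s * euler_prod s)))"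
  proof -
    have p: "converges_to (\<lambda>N. euler_partial s (Suc N)) (euler_prod s)"
      using converges_to_subseq[OF converges_to_euler_partial[OF s], of Suc] by (simp add:
          strict_mono_def)
    have "converges_to (\<lambda>N. - 1 * (euler_partial s (Suc N) * (euler_partial s N *
        euler_partial s (Suc N)))) (- 1 * (euler_prod s * (euler_prod s * euler_prod s)))"
      by (intro converges_to_cmult converges_to_mult p converges_to_euler_partial[OF s])
    then show ?thesis unfolding jtp_sum_of_int[OF s] by simp
  qed
  ultimately show ?thesis using converges_to_unique by (fastforce simp: power3_eq_cube)
qed

section \<open>Theta series as products\<close>

lemma tri_nonneg: "0 \<le> tri j"
proof -
  have "0 \<le> j * (j - 1)"
    by (cases "j \<le> 0") (auto intro: mult_nonneg_nonneg mult_nonpos_nonpos)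
  then show ?thesis using two_tri[of j] by linarith
qed

lemma triple_exponent_ge:
  assumes "s \<ge> 1" "0 \<le> b" "b \<le> s"
  shows "\<bar>j\<bar> - 3 \<le> s * tri j + b * j"
proof (cases "j \<ge> 0")
  case True
  have "1 * tri j \<le> s * tri j" using assms tri_nonneg by (intro mult_right_mono)
  moreover have "0 \<le> b * j" using assms True by simp
  ultimately show ?thesis using tri_ge[of j] by linarith
next
  case False
  have "1 * tri (- j) \<le> s * tri (- j)" using assms tri_nonneg by (intro mult_right_mono)
  moreover have "s * j \<le> b * j" using assms False by (intro mult_right_mono_neg) auto
  ultimately show ?thesis using tri_ge[of "- j"] by (simp add: tri_uminus algebra_simps)
qed

lemma triple_product_minus:
  assumes s: "s \<ge> 1" and b: "0 \<le> b" "b \<le> s"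
  shows "null_family (\<lambda>j. sign_pow j * qpow (s * tri j + b * j))"
    "converges_to (\<lambda>N. euler_partial s N * ((\<Prod>k<N. 1 - qpow (s * int k + b)) *
        (\<Prod>k<N. 1 - qpow (s * int k + (s - b)))))
       (fsum (\<lambda>j. sign_pow j * qpow (s * tri j + b * j)))"
proof -
  show n: "null_family (\<lambda>j. sign_pow j * qpow (s * tri j + b * j))"
    by (rule null_family_qpow[OF _ triple_exponent_ge[OF s b]]) (simp add: sign_pow_eq)
  have e: "jtp_term s j * qpow (b * j) = sign_pow j * qpow (s * tri j + b * j)" for j
    by (simp add: jtp_term_def qpow_mult mult.assoc)
  have q: "qpow (s * (int k + 1)) / qpow b = qpow (s * int k + (s - b))" "qpow b * qpow (s * int
      k) = qpow (s * int k + b)" for k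
    by (simp_all add: qpow_diff[symmetric] qpow_mult algebra_simps)
  have "converges_to (\<lambda>N. euler_partial s N * (\<Prod>k<N. (1 - qpow b * qpow (s * int
      k)) * (1 - qpow (s * (int k + 1)) / qpow b)))
      (fsum (\<lambda>j. jtp_term s j * qpow (b * j)))"
    using n by (intro Jacobi_triple_product[OF s qpow_nz]) (simp_all only: e qpow_mult, simp_all
        add: algebra_simps)
  then show "converges_to (\<lambda>N. euler_partial s N * ((\<Prod>k<N. 1 - qpow (s * int k +
      b)) * (\<Prod>k<N. 1 - qpow (s * int k + (s - b)))))
       (fsum (\<lambda>j. sign_pow j * qpow (s * tri j + b * j)))"
    unfolding q e prod.distrib .
qed

text \<open>The triple product at z = -q^b: the sign in the weight cancels the sign in
  \<open>jtp_term\<close>.\<close>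

lemma triple_product_plus:
  assumes s: "s \<ge> 1" and b: "0 \<le> b" "b \<le> s"
  shows "null_family (\<lambda>j. qpow (s * tri j + b * j))"
    "converges_to (\<lambda>N. euler_partial s N * ((\<Prod>k<N. 1 + qpow (s * int k + b)) *
        (\<Prod>k<N. 1 + qpow (s * int k + (s - b)))))
       (fsum (\<lambda>j. qpow (s * tri j + b * j)))"
proof -
  show n: "null_family (\<lambda>j. qpow (s * tri j + b * j))"
    using null_family_qpow[OF _ triple_exponent_ge[OF s b], of "\<lambda>_. 1"] by simp
  have e: "jtp_term s j * (sign_pow j * qpow (b * j)) = qpow (s * tri j + b * j)" for j
    by (simp add: jtp_term_def qpow_mult algebra_simps)
  have q: "1 - qpow (s * (int k + 1)) / (- qpow b) = 1 + qpow (s * int k + (s - b))"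
    "1 - (- qpow b) * qpow (s * int k) = 1 + qpow (s * int k + b)" for k
    by (simp_all add: qpow_diff[symmetric] qpow_mult algebra_simps)
  have "converges_to (\<lambda>N. euler_partial s N * (\<Prod>k<N. (1 - (- qpow b) * qpow (s *
      int k)) * (1 - qpow (s * (int k + 1)) / (- qpow b))))
      (fsum (\<lambda>j. jtp_term s j * (sign_pow j * qpow (b * j))))"
    using n by (intro Jacobi_triple_product[OF s]) (simp_all only: e, simp_all add: sign_pow_add
        qpow_simps algebra_simps)
  then show "converges_to (\<lambda>N. euler_partial s N * ((\<Prod>k<N. 1 + qpow (s * int k +
      b)) * (\<Prod>k<N. 1 + qpow (s * int k + (s - b)))))
       (fsum (\<lambda>j. qpow (s * tri j + b * j)))"
    unfolding q e prod.distrib .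
qed

lemma prod_lessThan_add: "(\<Prod>k<m + c. f k) = (\<Prod>k<m. f k) * (\<Prod>i<c. f (m + i ::
    nat) :: 'a::comm_monoid_mult)"
  by (induction c) (simp_all add: mult.assoc)

lemma prod_lessThan_mult:
  "(\<Prod>k<c * N. f k) = (\<Prod>i<c. \<Prod>n<N. f (c * n + i :: nat) :: 'a::comm_monoid_mult)"
proof (induction N)
  case (Suc N)
  have "c * Suc N = c * N + c" by simp
  then show ?case by (simp only: prod_lessThan_add Suc prod.lessThan_Suc prod.distrib)
qed simp

text \<open>Sorting the factors by residue. The product formulas below are compared for truncations
  at multiples of \<open>N\<close>, where the factors regroup exactly, and then passed to the
  limit.\<close>

lemma euler_partial_mult: "euler_partial s (c * N) = (\<Prod>i<c. \<Prod>n<N. 1 - qpow (s * int c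
    * int n + s * (int i + 1)))"
  unfolding euler_partial_def prod_lessThan_mult by (simp add: algebra_simps)

lemma euler_plus_partial_mult: "euler_plus_partial s (c * N) = (\<Prod>i<c. \<Prod>n<N. 1 + qpow
    (s * int c * int n + s * (int i + 1)))"
  unfolding euler_plus_partial_def prod_lessThan_mult by (simp add: algebra_simps)

text \<open>Gauss's product formula: in the triple product with base q^(2k) the two linear products
  coincide and run over the odd multiples of \<open>k\<close>.\<close>

lemma theta_euler_prod:
  assumes k: "k \<ge> 1"
  shows "theta k * euler_prod (2 * k) = euler_prod k ^ 2"
proof -
  have s: "2 * k \<ge> 1" "0 \<le> k" "k \<le> 2 * k" using k by auto
  have "theta k = fsum (\<lambda>j. sign_pow j * qpow (2 * k * tri j + k * j))"
    unfolding theta_def square_tri by (simp add: algebra_simps)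
  then have 1: "converges_to (\<lambda>N. euler_partial (2 * k) N * ((\<Prod>n<N. 1 - qpow (2 * k
      * int n + k)) * (\<Prod>n<N. 1 - qpow (2 * k * int n + (2 * k - k)))) * euler_partial (2 *
      k) N)
      (theta k * euler_prod (2 * k))"
    using triple_product_minus(2)[OF s] converges_to_euler_partial[OF s(1)] by (intro
        converges_to_mult) auto
  have 2: "euler_partial (2 * k) N * ((\<Prod>n<N. 1 - qpow (2 * k * int n + k)) * (\<Prod>n<N. 1
      - qpow (2 * k * int n + (2 * k - k)))) * euler_partial (2 * k) N
      = euler_partial k (2 * N) ^ 2" for N
    unfolding euler_partial_mult by (simp add: euler_partial_def eval_nat_numeral lessThan_Suc
        power2_eq_square algebra_simps)
  have "converges_to (\<lambda>N. euler_partial k (2 * N) ^ 2) (euler_prod k ^ 2)"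
    by (intro converges_to_power converges_to_times converges_to_euler_partial k) simp
  with 1[unfolded 2] show ?thesis by (rule converges_to_unique)
qed

text \<open>The exponents here and in the next definitions are 3m^2 + 2m, the pentagonal k(3k-1)/2,
  and 3k(k-1)/2; \<open>theta_J_deriv\<close> is the derivative of \<open>theta_J\<close> with
  respect to a variable z marking \<open>k\<close>, at z = 1.\<close>

definition theta_W :: "complex fls" where "theta_W = fsum (\<lambda>m. sign_pow m * qpow (6 * tri
    m + 5 * m))"
definition theta_J :: "complex fls" where "theta_J = fsum (\<lambda>k. qpow (3 * tri k + k))"
definition theta_J_deriv :: "complex fls" where "theta_J_deriv = fsum (\<lambda>k. of_int k *
    qpow (3 * tri k + k))"
definition theta_K :: "complex fls" where "theta_K = fsum (\<lambda>k. qpow (3 * tri k))"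

text \<open>The linear products run over the exponents prime to 6; multiples of 2 and of 3 supply
  the rest, with multiples of 6 occurring twice.\<close>

lemma theta_W_euler_prod: "theta_W * (euler_prod 2 * euler_prod 3) = euler_prod 1 * euler_prod 6
    ^ 2"
proof -
  let ?f = "\<lambda>N. euler_partial 6 N * ((\<Prod>k<N. 1 - qpow (6 * int k + 5)) *
      (\<Prod>k<N. 1 - qpow (6 * int k + (6 - 5))))"
  have 1: "converges_to (\<lambda>N. ?f N * (euler_partial 2 (3 * N) * euler_partial 3 (2 * N)))
      (theta_W * (euler_prod 2 * euler_prod 3))"
    unfolding theta_W_def by (intro converges_to_mult triple_product_minus(2) converges_to_times
        converges_to_euler_partial) simp_all
  have 2: "?f N * (euler_partial 2 (3 * N) * euler_partial 3 (2 * N)) = euler_partial 1 (6 * N) *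
      euler_partial 6 N ^ 2" for N
    unfolding euler_partial_mult by (simp add: euler_partial_def eval_nat_numeral lessThan_Suc
        power2_eq_square algebra_simps)
  have "converges_to (\<lambda>N. euler_partial 1 (6 * N) * euler_partial 6 N ^ 2) (euler_prod 1
      * euler_prod 6 ^ 2)"
    by (intro converges_to_mult converges_to_power converges_to_times converges_to_euler_partial)
        simp_all
  with 1[unfolded 2] show ?thesis by (rule converges_to_unique)
qed

lemma theta_J_euler_plus_prod: "theta_J * euler_plus_prod 3 = euler_plus_prod 1 * euler_prod 3"
proof -
  let ?f = "\<lambda>N. euler_partial 3 N * ((\<Prod>k<N. 1 + qpow (3 * int k + 1)) *
      (\<Prod>k<N. 1 + qpow (3 * int k + (3 - 1))))"
  have "converges_to ?f theta_J"
    unfolding theta_J_def using triple_product_plus(2)[of 3 1] by simp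
  then have 1: "converges_to (\<lambda>N. ?f N * euler_plus_partial 3 N) (theta_J *
      euler_plus_prod 3)"
    by (intro converges_to_mult converges_to_euler_plus_partial) simp_all
  have 2: "?f N * euler_plus_partial 3 N = euler_plus_partial 1 (3 * N) * euler_partial 3 N" for N
    unfolding euler_plus_partial_mult by (simp add: euler_plus_partial_def eval_nat_numeral
        lessThan_Suc algebra_simps)
  have "converges_to (\<lambda>N. euler_plus_partial 1 (3 * N) * euler_partial 3 N)
      (euler_plus_prod 1 * euler_prod 3)"
    by (intro converges_to_mult converges_to_times converges_to_euler_partial
        converges_to_euler_plus_partial) simp_all
  with 1[unfolded 2] show ?thesis by (rule converges_to_unique)
qed

lemma theta_K_euler_plus_prod: "theta_K = 2 * euler_plus_prod 3 ^ 2 * euler_prod 3"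
proof -
  let ?f = "\<lambda>N. euler_partial 3 N * ((\<Prod>k<N. 1 + qpow (3 * int k)) *
      euler_plus_partial 3 N)"
  have "converges_to ?f theta_K"
    unfolding theta_K_def using triple_product_plus(2)[of 3 0] by (simp add:
        euler_plus_partial_def algebra_simps)
  \<comment> \<open>The two plus products run over k < N and 1 <= k <= N. The extra factor, which
    tends to 1, makes them equal up to the factor 1 + q^0 = 2.\<close>
  moreover have "converges_to (\<lambda>N. 1 + qpow (3 * int N)) 1"
    unfolding converges_to_def eventually_sequentially
  proof
    fix M
    show "\<exists>N. \<forall>n\<ge>N. vanishes_below M (1 + qpow (3 * int n) - 1)"
      by (rule exI[of _ "nat M"]) auto
  qed
  ultimately have 1: "converges_to (\<lambda>N. ?f N * (1 + qpow (3 * int N))) theta_K"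
    using converges_to_mult by fastforce
  have "(\<Prod>k<N. 1 + qpow (3 * int k)) * (1 + qpow (3 * int N)) = 2 * euler_plus_partial 3 N"
      for N
    by (induction N) (simp_all add: euler_plus_partial_Suc algebra_simps)
  then have 2: "?f N * (1 + qpow (3 * int N)) = 2 * euler_plus_partial 3 N ^ 2 * euler_partial 3
      N" for N
    by (simp add: power2_eq_square algebra_simps)
  have "converges_to (\<lambda>N. 2 * euler_plus_partial 3 N ^ 2 * euler_partial 3 N) (2 *
      euler_plus_prod 3 ^ 2 * euler_prod 3)"
    by (intro converges_to_mult converges_to_cmult converges_to_power converges_to_euler_partial
        converges_to_euler_plus_partial) simp_all
  with 1[unfolded 2] show ?thesis by (rule converges_to_unique)
qed

text \<open>Euler's pentagonal number theorem in q^2; it evaluates the inner sums in the quintuple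
  product argument.\<close>

lemma pentagonal:
  "null_family (\<lambda>j. sign_pow j * qpow (6 * tri j + 4 * j))"
  "fsum (\<lambda>j. sign_pow j * qpow (6 * tri j + 4 * j)) = euler_prod 2"
proof -
  show "null_family (\<lambda>j. sign_pow j * qpow (6 * tri j + 4 * j))"
    by (rule triple_product_minus(1)) simp_all
  let ?f = "\<lambda>N. euler_partial 6 N * ((\<Prod>k<N. 1 - qpow (6 * int k + 4)) *
      (\<Prod>k<N. 1 - qpow (6 * int k + (6 - 4))))"
  have 1: "converges_to ?f (fsum (\<lambda>j. sign_pow j * qpow (6 * tri j + 4 * j)))"
    by (rule triple_product_minus(2)) simp_all
  have 2: "?f N = euler_partial 2 (3 * N)" for N
    unfolding euler_partial_mult by (simp add: euler_partial_def eval_nat_numeral lessThan_Suc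
        algebra_simps)
  have "converges_to (\<lambda>N. euler_partial 2 (3 * N)) (euler_prod 2)"
    by (intro converges_to_times converges_to_euler_partial) simp_all
  with 1[unfolded 2] show "fsum (\<lambda>j. sign_pow j * qpow (6 * tri j + 4 * j)) = euler_prod 2"
    by (rule converges_to_unique)
qed

lemma null_theta_J: "null_family (\<lambda>k. qpow (3 * tri k + k))"
  using triple_product_plus(1)[of 3 1] by simp

lemma null_theta_J_deriv: "null_family (\<lambda>k. of_int k * qpow (3 * tri k + k))"
  using null_family_qpow[OF _ triple_exponent_ge[of 3 1], of of_int] by simp

lemma null_theta_K: "null_family (\<lambda>k. qpow (3 * tri k))"
  using triple_product_plus(1)[of 3 0] by simp

lemma fsum_antisym:
  fixes f :: "int \<Rightarrow> complex fls"
  assumes n: "null_family f" and "\<And>n. f (c - n) = - f n"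
  shows "fsum f = 0"
proof -
  have "bij (\<lambda>n. c - n)" by (rule o_bij[of "\<lambda>n. c - n"]) auto
  then have "fsum f = fsum (\<lambda>n. f (c - n))" by (rule fsum_reindex[OF n, symmetric])
  also have "\<dots> = - fsum f" unfolding assms(2) by (rule fsum_uminus[OF n])
  finally show ?thesis by simp
qed

text \<open>
  The derivative at \<open>z = 1\<close> of the quintuple product identity: the product of
  \<open>\<Sum> (-1)\<^sup>n q^(n(n-1)/2) z\<^sup>n\<close> and \<open>\<Sum> (-1)\<^sup>m
      q^(m\<^sup>2) z^(2m)\<close> is rearranged by
  \<open>N = n + 2m\<close> and split according to \<open>N\<close> modulo \<open>3\<close>.
\<close>

lemma quintuple:
  "theta_J - 6 * theta_J_deriv = euler_prod 1 * theta 1 ^ 2"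
proof -
  \<comment> \<open>\<open>\<alpha>1\<close> and \<open>\<beta>1\<close> carry the derivatives with
    respect to z; the factor 2 coming from z^(2m) is supplied in \<open>F\<close>.\<close>
  define \<alpha> \<alpha>1 \<beta> \<beta>1 :: "int \<Rightarrow> complex fls" where "\<alpha> n
      = sign_pow n * qpow (tri n)" and "\<alpha>1 n = sign_pow n * of_int n * qpow (tri n)"
    and "\<beta> n = sign_pow n * qpow (1 * n\<^sup>2)" and "\<beta>1 n = sign_pow n * of_int n *
        qpow (1 * n\<^sup>2)" for n
  have tg: "\<bar>n\<bar> - 3 \<le> tri n" for n using triple_exponent_ge[of 1 0 n] by simp
  have low_sg: "vanishes_below 0 (sign_pow n)" "vanishes_below 0 (sign_pow n * of_int n)" for n
      by (simp_all add: sign_pow_eq)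
  have na: "null_family \<alpha>" "null_family \<alpha>1"
    unfolding \<alpha>_def \<alpha>1_def by (rule null_family_qpow[OF low_sg(1) tg], rule
        null_family_qpow[OF low_sg(2) tg])
  have sq: "\<bar>n\<bar> - 0 \<le> 1 * n\<^sup>2" for n :: int using abs_le_square_int[of n] by
      simp
  have nb: "null_family \<beta>" "null_family \<beta>1"
    unfolding \<beta>_def \<beta>1_def by (rule null_family_qpow[OF low_sg(1) sq], rule
        null_family_qpow[OF low_sg(2) sq])
  \<comment> \<open>The first factor vanishes at z = 1, so only the term with its derivative
    survives the product rule.\<close>
  have "fsum \<alpha> = 0"
  proof (rule fsum_antisym[OF na(1), of 1])
    fix n
    have "tri (1 - n) = tri n" by (rule tri_eqI) (use two_tri[of n] in \<open>simp add:
        algebra_simps\<close>)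
    then show "\<alpha> (1 - n) = - \<alpha> n" by (simp add: \<alpha>_def sign_pow_diff)
  qed
  moreover have "fsum \<alpha>1 = - (euler_prod 1 ^ 3)"
  proof -
    have e: "\<alpha>1 = (\<lambda>j. jtp_term 1 j * of_int j)" by (simp add: \<alpha>1_def
        jtp_term_def fun_eq_iff mult_ac)
    show ?thesis using Jacobi_subst_cube[of 1] na(2) unfolding e by simp
  qed
  moreover have "fsum \<beta> = theta 1" unfolding \<beta>_def theta_def ..
  ultimately have sums: "fsum (\<lambda>(n, m). \<alpha>1 n * \<beta> m) = - (euler_prod 1 ^ 3) *
      theta 1" "fsum (\<lambda>(n, m). \<alpha> n * \<beta>1 m) = 0"
    unfolding fsum_prod[OF na(2) nb(1)] fsum_prod[OF na(1) nb(2)] by simp_all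
  define F where "F = (\<lambda>(n, m). of_int (n + 2 * m) * (sign_pow (n + m) * qpow (tri n +
      m\<^sup>2)))"
  have F: "F p = (case p of (n, m) \<Rightarrow> \<alpha>1 n * \<beta> m) + 2 * (case p of (n, m)
      \<Rightarrow> \<alpha> n * \<beta>1 m)" for p
    by (cases p) (simp add: F_def \<alpha>_def \<alpha>1_def \<beta>_def \<beta>1_def
        sign_pow_add algebra_simps qpow_simps)
  have n1: "null_family (\<lambda>(n, m). \<alpha>1 n * \<beta> m)" and n2: "null_family
      (\<lambda>p. 2 * (case p of (n, m) \<Rightarrow> \<alpha> n * \<beta>1 m))"
    by (intro null_family_mult_left null_family_prod na nb)+
  have nF: "null_family F" unfolding F by (rule null_family_add[OF n1 n2])
  have "fsum F = - (euler_prod 1 ^ 3) * theta 1"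
    unfolding F fsum_add[OF n1 n2] fsum_mult_left[OF null_family_prod[OF na(1) nb(2)]] sums by simp
  define h :: "int \<times> int \<Rightarrow> int \<times> int" where "h = (\<lambda>(N, m). (N -
      2 * m, m))"
  have bij: "bij h"
    by (rule o_bij[of "\<lambda>(n, m). (n + 2 * m, m)"]) (auto simp: h_def)
  have nFh: "null_family (\<lambda>p. F (h p))" by (rule null_family_comp_inj[OF nF bij_is_inj[OF
      bij]])
  define H where "H N = fsum (\<lambda>m. F (h (N, m)))" for N
  have nH: "null_family H" unfolding H_def by (rule null_family_section_fsum[OF nFh])
  have "fsum F = fsum H"
    unfolding H_def fsum_Fubini[OF nFh] by (rule fsum_reindex[OF nF bij, symmetric])
  also have "\<dots> = fsum (\<lambda>k. H (3 * k)) + fsum (\<lambda>k. H (3 * k + 1)) + fsum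
      (\<lambda>k. H (3 * k + 2))"
    by (rule fsum_split3[OF nH])
  also have "fsum (\<lambda>k. H (3 * k)) = euler_prod 2 * (3 * theta_J_deriv)"
  proof -
    have "H (3 * k) = euler_prod 2 * (3 * (of_int k * qpow (3 * tri k + k)))" for k
    proof -
      \<comment> \<open>The shift of \<open>m\<close> by \<open>k\<close> completes the square, so
        the exponent splits into a part in \<open>k\<close> and a pentagonal part in
        \<open>m\<close>.\<close>
      have "F (h (3 * k, m + k)) = 3 * (of_int k * qpow (3 * tri k + k)) * (sign_pow m * qpow (6
          * tri m + 4 * m))" for m
      proof -
        have "tri (3 * k - 2 * (m + k)) + (m + k)\<^sup>2 = (3 * tri k + k) + (6 * tri m + 4 * m)"
          using two_tri[of "3 * k - 2 * (m + k)"] two_tri[of k] two_tri[of m]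
          by (simp add: algebra_simps power2_eq_square)
        moreover have "sign_pow (3 * k - 2 * (m + k) + (m + k)) = sign_pow m" by (simp add:
            sign_pow_eq)
        ultimately show ?thesis by (simp add: F_def h_def qpow_mult qpow_mult_left algebra_simps)
      qed
      then have "fsum (\<lambda>m. F (h (3 * k, m + k))) = 3 * (of_int k * qpow (3 * tri k + k))
          * euler_prod 2"
        by (simp only: fsum_mult_left[OF pentagonal(1)] pentagonal(2))
      then show ?thesis
        unfolding H_def fsum_int_shift[OF null_family_section[OF nFh]] by (simp only: mult_ac)
    qed
    then show ?thesis
      unfolding theta_J_deriv_def by (simp only: fsum_mult_left[OF null_family_mult_left[OF
          null_theta_J_deriv]] fsum_mult_left[OF null_theta_J_deriv])
  qed
  also have "fsum (\<lambda>k. H (3 * k + 1)) = euler_prod 2 * (3 * theta_J_deriv - theta_J)"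
  proof -
    define g where "g k = (3 * of_int k - 1) * qpow (3 * tri k + k)" for k
    have g: "g k = 3 * (of_int k * qpow (3 * tri k + k)) - qpow (3 * tri k + k)" for k
      by (simp add: g_def algebra_simps)
    have ng: "null_family g" unfolding g by (intro null_family_diff null_family_mult_left
        null_theta_J null_theta_J_deriv)
    have fg: "fsum g = 3 * theta_J_deriv - theta_J"
      unfolding g theta_J_deriv_def theta_J_def fsum_diff[OF null_family_mult_left[OF
          null_theta_J_deriv] null_theta_J] fsum_mult_left[OF null_theta_J_deriv] ..
    have "H (3 * k + 1) = euler_prod 2 * g (- k)" for k
    proof -
      \<comment> \<open>A reflected shift is needed here, and the outer series appears at
        \<open>- k\<close>: the weight 3k + 1 is minus the factor in \<open>g (- k)\<close>, and the
        sign is absorbed by \<open>sign_pow\<close>.\<close>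
      have "F (h (3 * k + 1, - m + k)) = g (- k) * (sign_pow m * qpow (6 * tri m + 4 * m))" for m
      proof -
        have e: "tri (3 * k + 1 - 2 * (- m + k)) + (- m + k)\<^sup>2 = (3 * tri (- k) - k) + (6 *
            tri m + 4 * m)"
          using two_tri[of "3 * k + 1 - 2 * (- m + k)"] two_tri[of "- k"] two_tri[of m]
          by (simp add: algebra_simps power2_eq_square)
        have s: "sign_pow (3 * k + 1 - 2 * (- m + k) + (- m + k)) = - sign_pow m" by (simp add:
            sign_pow_eq)
        have c: "3 * k + 1 - 2 * (- m + k) + 2 * (- m + k) = 3 * k + 1" by simp
        show ?thesis unfolding F_def h_def prod.case e s c g_def unfolding qpow_add[of "3 * tri
            (- k) - k"] by (simp add: algebra_simps)
      qed
      then have "fsum (\<lambda>m. F (h (3 * k + 1, - m + k))) = g (- k) * euler_prod 2"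
        by (simp only: fsum_mult_left[OF pentagonal(1)] pentagonal(2))
      moreover have "bij (\<lambda>m. - m + k)" by (rule o_bij[of "\<lambda>m. - m + k"]) auto
      ultimately show ?thesis
        unfolding H_def using fsum_reindex[OF null_family_section[OF nFh], of "\<lambda>m. - m +
            k"] by (simp only: mult_ac)
    qed
    then show ?thesis
      unfolding fg[symmetric] fsum_int_uminus[OF ng, symmetric]
      by (simp only: fsum_mult_left[OF null_family_comp_inj[OF ng inj_uminus]])
  qed
  also have "fsum (\<lambda>k. H (3 * k + 2)) = 0"
  proof -
    \<comment> \<open>The reflection of \<open>m\<close> preserves the exponent and the weight but
      changes the parity of n + m.\<close>
    have "H (3 * k + 2) = 0" for k
      unfolding H_def
    proof (rule fsum_antisym[OF null_family_section[OF nFh], of _ "2 * k + 1"])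
      fix m
      have "tri (3 * k + 2 - 2 * (2 * k + 1 - m)) + (2 * k + 1 - m)\<^sup>2 = tri (3 * k + 2 - 2
          * m) + m\<^sup>2"
        using two_tri[of "3 * k + 2 - 2 * (2 * k + 1 - m)"] two_tri[of "3 * k + 2 - 2 * m"]
        by (simp add: algebra_simps power2_eq_square)
      moreover have "sign_pow (3 * k + 2 - 2 * (2 * k + 1 - m) + (2 * k + 1 - m)) = - sign_pow (3
          * k + 2 - 2 * m + m)"
        by (simp add: sign_pow_eq)
      ultimately show "F (h (3 * k + 2, 2 * k + 1 - m)) = - F (h (3 * k + 2, m))"
        by (simp add: F_def h_def)
    qed
    then show ?thesis by simp
  qed
  finally have "euler_prod 2 * (theta_J - 6 * theta_J_deriv) = euler_prod 1 ^ 3 * theta 1"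
    unfolding \<open>fsum F = - (euler_prod 1 ^ 3) * theta 1\<close> by (simp add: algebra_simps)
  also have "\<dots> = euler_prod 1 * theta 1 * (theta 1 * euler_prod 2)"
    using theta_euler_prod[of 1] by (simp add: power3_eq_cube power2_eq_square mult_ac)
  finally show ?thesis using EE_nz[of 2] by (simp add: power2_eq_square mult_ac)
qed

section \<open>Dissection modulo 3\<close>

text \<open>With q^3 in place of q, the next three families are the terms of
  \<open>lambert_term\<close> at 3m+1, 3m and 3m+2, the first up to the factor -q^2. The first is
  also the summand of the bilateral sum in the theorem.\<close>

definition appell_term :: "int \<Rightarrow> complex fls"
  where "appell_term m = sign_pow m * (qpow (3 * m\<^sup>2 + 3 * m) / (1 - qpow (3 * m + 1)))"

definition lambert_term0 :: "int \<Rightarrow> complex fls"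
  where "lambert_term0 m = (if m = 0 then 0 else sign_pow m * (qpow (3 * m\<^sup>2 + m) / (1 -
      qpow (3 * m))))"

definition lambert_term2 :: "int \<Rightarrow> complex fls"
  where "lambert_term2 m = sign_pow m * (qpow (3 * m\<^sup>2 + 5 * m + 2) / (1 - qpow (3 * m + 2)))"

lemma square_ge: "4 * \<bar>k\<bar> - 4 \<le> (k::int)\<^sup>2"
proof -
  have "0 \<le> (\<bar>k\<bar> - 2) * (\<bar>k\<bar> - 2)" by simp
  then show ?thesis by (simp add: power2_eq_square algebra_simps)
qed

lemma sign_pow_3' [simp]: "sign_pow (n * 3) = sign_pow n"
  by (simp add: sign_pow_eq)

text \<open>Meant for y = |n - k|, z = |k|, u = (n - k)^2 and v = k^2. Squares enter only through
  their tangent bounds, so that linear arithmetic suffices; the constant 20 is generous.\<close>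

lemma quadratic_bounds:
  fixes n k e u v y z :: int
  assumes "4 * y - 4 \<le> u" "4 * z - 4 \<le> v" "0 \<le> v" "\<bar>n\<bar> \<le> y + z"
    "n - k \<le> y" "- y \<le> n - k" "k \<le> z" "- z \<le> k"
  shows "2 * e = u + (n - k) + 2 * v \<Longrightarrow> \<bar>n\<bar> + z - 20 \<le> e"
    "2 * e = u + (n - k) + 2 * v \<Longrightarrow> \<bar>n\<bar> + z - 20 \<le> e - n"
    "2 * e = u - n - v \<Longrightarrow> \<bar>n\<bar> - (20 + 4 * z + v) \<le> e"
proof -
  have nn: "0 \<le> y" "0 \<le> z" using assms(5-8) by simp_all
  {
    assume e: "2 * e = u + (n - k) + 2 * v"
    have "3 * y + 8 * z - 12 \<le> 2 * e" using e assms(1,2,6) by simp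
    then show "\<bar>n\<bar> + z - 20 \<le> e" using assms(4) nn by simp
    have "3 * y + 6 * z - 12 \<le> 2 * (e - n)" using e assms(1,2,5,7) by simp
    then show "\<bar>n\<bar> + z - 20 \<le> e - n" using assms(4) nn by simp
  next
    assume e: "2 * e = u - n - v"
    have "3 * y - z - 4 - v \<le> 2 * e" using e assms(1,5,7) by simp
    then show "\<bar>n\<bar> - (20 + 4 * z + v) \<le> e" using assms(3,4) nn by simp
  }
qed

lemma null_appell_term: "null_family appell_term" and null_Y0t: "null_family lambert_term0" and
    null_Y2t: "null_family lambert_term2"
proof -
  have sq: "4 * \<bar>m\<bar> - 4 \<le> m\<^sup>2" for m :: int by (rule square_ge)
  have "vanishes_below (\<bar>m\<bar> - 20) (appell_term m)" for m
    unfolding appell_term_def low_sign_pow_mult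
  proof (rule low_qpow_div)
    show "3 * m + 1 \<noteq> 0" by presburger
  qed (use sq[of m] in linarith)+
  then show "null_family appell_term" by (rule null_family_int)
  have "vanishes_below (\<bar>m\<bar> - 20) (lambert_term2 m)" for m
    unfolding lambert_term2_def low_sign_pow_mult
  proof (rule low_qpow_div)
    show "3 * m + 2 \<noteq> 0" by presburger
  qed (use sq[of m] in linarith)+
  then show "null_family lambert_term2" by (rule null_family_int)
  have "vanishes_below (\<bar>m\<bar> - 20) (lambert_term0 m)" for m
  proof (cases "m = 0")
    case False
    then have "vanishes_below (\<bar>m\<bar> - 20) (qpow (3 * m\<^sup>2 + m) / (1 - qpow (3 * m)))"
      by (intro low_qpow_div) (use sq[of m] in \<open>simp, linarith+\<close>)
    then show ?thesis using False by (simp only: lambert_term0_def low_sign_pow_mult if_False)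
  qed (simp add: lambert_term0_def)
  then show "null_family lambert_term0" by (rule null_family_int)
qed

section \<open>A double series and its two orders of summation\<close>

definition single_term :: "int \<Rightarrow> int \<Rightarrow> complex fls"
  where "single_term k n = (if n = 0 then 0 else sign_pow n * (qpow (tri n + n - k * n) / (1 -
      qpow n)))"

definition double_term :: "int \<times> int \<Rightarrow> complex fls"
  where "double_term = (\<lambda>(n, k). qpow (3 * tri k + k) * single_term k n)"

lemma double_term_eq: "double_term (n, k) = (if n = 0 then 0 else sign_pow n * (qpow (tri n + n -
    k * n + (3 * tri k + k)) / (1 - qpow n)))"
  unfolding double_term_def single_term_def prod.case qpow_add[of "tri n + n - k * n"] by (simp
      add: mult_ac)

lemma null_double_term: "null_family double_term"
proof (rule null_family_int_pair)
  fix n k :: int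
  let ?e = "tri n + n - k * n + (3 * tri k + k)"
  \<comment> \<open>A sum of squares up to a linear term: the exponent grows in both indices, which
    is what permits the interchange of summation.\<close>
  have e: "2 * ?e = (n - k)\<^sup>2 + (n - k) + 2 * k\<^sup>2"
    using two_tri[of n] two_tri[of k] by (simp add: algebra_simps power2_eq_square)
  define y z where "y = \<bar>n - k\<bar>" and "z = \<bar>k\<bar>"
  have sq: "4 * y - 4 \<le> (n - k)\<^sup>2" "4 * z - 4 \<le> k\<^sup>2" unfolding y_def z_def by
      (rule square_ge)+
  have ab: "0 \<le> k\<^sup>2" "\<bar>n\<bar> \<le> y + z" "n - k \<le> y" "- y \<le> n - k" "k
      \<le> z" "- z \<le> k"
    unfolding y_def z_def by (simp, linarith+)
  from quadratic_bounds(1,2)[OF sq ab e] have "n \<noteq> 0 \<Longrightarrow> vanishes_below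
      (\<bar>n\<bar> + \<bar>k\<bar> - 20) (qpow ?e / (1 - qpow n))"
    unfolding z_def by (intro low_qpow_div)
  then show "vanishes_below (\<bar>n\<bar> + \<bar>k\<bar> - 20) (double_term (n, k))"
    unfolding double_term_eq by (cases "n = 0") (simp_all only: low_sign_pow_mult if_True
        if_False low_0 simp_thms)
qed

lemma null_single_term: "null_family (single_term k)"
proof -
  have "null_family (\<lambda>n. qpow (- (3 * tri k + k)) * double_term (n, k))"
    by (rule null_family_mult_left, rule null_family_comp_inj[OF null_double_term]) (auto intro:
        injI)
  moreover have "qpow (- (3 * tri k + k)) * double_term (n, k) = single_term k n" for n
    by (simp add: double_term_def qpow_mult_left)
  ultimately show ?thesis by simp
qed

text \<open>In the difference the denominator cancels, leaving minus the terms of a theta series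
  with index 0 omitted. The full theta series vanishes by reflection, so the omitted term
  \<open>1\<close> remains.\<close>

lemma fsum_single_term_Suc: "fsum (single_term k) - fsum (single_term (k + 1)) = 1"
proof -
  let ?z = "\<lambda>n. sign_pow n * qpow (1 * tri n - k * n)"
  have nz: "null_family ?z"
  proof (rule null_family_qpow)
    fix n
    show "vanishes_below 0 (sign_pow n)" by (simp add: sign_pow_eq)
    define y z where "y = \<bar>n - k\<bar>" and "z = \<bar>k\<bar>"
    have sq: "4 * y - 4 \<le> (n - k)\<^sup>2" "4 * z - 4 \<le> k\<^sup>2" "0 \<le> k\<^sup>2"
      unfolding y_def z_def by (rule square_ge, rule square_ge, simp)
    have ab: "\<bar>n\<bar> \<le> y + z" "n - k \<le> y" "- y \<le> n - k" "k \<le> z" "- z \<le>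
        k" unfolding y_def z_def by linarith+
    have e: "2 * (tri n - k * n) = (n - k)\<^sup>2 - n - k\<^sup>2"
      using two_tri[of n] by (simp add: algebra_simps power2_eq_square)
    show "\<bar>n\<bar> - (20 + 4 * \<bar>k\<bar> + k\<^sup>2) \<le> 1 * tri n - k * n"
      using quadratic_bounds(3)[OF sq ab e] unfolding z_def by simp
  qed
  have "fsum ?z = 0"
  proof (rule fsum_antisym[OF nz, of "2 * k + 1"])
    fix n
    have "tri (2 * k + 1 - n) - k * (2 * k + 1 - n) = tri n - k * n"
      using two_tri[of "2 * k + 1 - n"] two_tri[of n] by (simp add: algebra_simps)
    moreover have "sign_pow (2 * k + 1 - n) = - sign_pow n" by (simp add: sign_pow_eq)
    ultimately show "?z (2 * k + 1 - n) = - ?z n" by simp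
  qed
  define d where "d n = (if n = 0 then 1 else 0 :: complex fls)" for n :: int
  have nd: "null_family d" by (rule null_family_finite) (simp add: d_def)
  have fd: "fsum d = 1" by (subst fsum_finite[of "{0}"]) (auto simp: d_def)
  have "single_term k n - single_term (k + 1) n = d n - ?z n" for n
  proof (cases "n = 0")
    case False
    have "qpow (tri n + n - k * n) - qpow (tri n + n - (k + 1) * n) = - qpow (tri n - k * n) * (1
        - qpow n)"
      by (simp add: algebra_simps qpow_simps)
    then have "(qpow (tri n + n - k * n) - qpow (tri n + n - (k + 1) * n)) / (1 - qpow n) = -
        qpow (tri n - k * n)"
      using one_minus_qpow_nz[OF False] by (simp del: minus_mult_left)
    moreover have "single_term k n - single_term (k + 1) n = sign_pow n * ((qpow (tri n + n - k *
        n) - qpow (tri n + n - (k + 1) * n)) / (1 - qpow n))"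
      using False by (simp add: single_term_def diff_divide_distrib right_diff_distrib)
    ultimately show ?thesis using False by (simp add: d_def)
  qed (simp add: single_term_def d_def)
  then have "fsum (\<lambda>n. single_term k n - single_term (k + 1) n) = fsum (\<lambda>n. d n -
      ?z n)" by simp
  then show ?thesis
    unfolding fsum_diff[OF null_single_term null_single_term] fsum_diff[OF nd nz] fd \<open>fsum
        ?z = 0\<close> by simp
qed

lemma fsum_single_term: "fsum (single_term k) = - of_int k"
proof (induction k rule: int_induct[where k = 0])
  case base
  \<comment> \<open>At \<open>k = 0\<close> the substitution of -n for n negates every term.\<close>
  have "fsum (single_term 0) = 0"
  proof (rule fsum_antisym[OF null_single_term, of _ 0])
    fix n
    show "single_term 0 (0 - n) = - single_term 0 n"
    proof (cases "n = 0")
      case False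
      then have "single_term 0 (0 - n) = sign_pow n * (qpow (tri n) / (1 - qpow (- n)))"
        by (simp add: single_term_def tri_uminus)
      also have "\<dots> = - single_term 0 n"
        unfolding qpow_div_minus[OF False] using False by (simp add: single_term_def)
      finally show ?thesis .
    qed (simp add: single_term_def)
  qed
  then show ?case by simp
next
  case (step1 i)
  then show ?case using fsum_single_term_Suc[of i] by (simp add: algebra_simps)
next
  case (step2 i)
  then show ?case using fsum_single_term_Suc[of "i - 1"] by (simp add: algebra_simps)
qed

text \<open>
  Summing \<open>double_term\<close> first over \<open>k\<close> gives theta series, whose type
      depends on \<open>n\<close>
  modulo \<open>3\<close>; summing first over \<open>n\<close> gives \<open>- k\<close> by
      telescoping.
\<close>

lemma Appell_identity: "theta_J * (fsum lambert_term0 + fsum lambert_term2) - qpow 1 * theta_K *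
    fsum appell_term = - theta_J_deriv"
proof -
  define H where "H n = fsum (\<lambda>k. double_term (n, k))" for n
  have nH: "null_family H" unfolding H_def by (rule null_family_section_fsum[OF null_double_term])
  have swap: "null_family (\<lambda>(n, k). double_term (n, k))" using null_double_term by simp
  have "fsum H = fsum (\<lambda>k. fsum (\<lambda>n. double_term (n, k)))"
    unfolding H_def by (rule fsum_swap[OF swap])
  also have "\<dots> = fsum (\<lambda>k. - (of_int k * qpow (3 * tri k + k)))"
    unfolding double_term_def prod.case fsum_mult_left[OF null_single_term] fsum_single_term by
        (simp add: mult.commute)
  also have "\<dots> = - theta_J_deriv" unfolding theta_J_deriv_def by (rule fsum_uminus[OF
      null_theta_J_deriv])
  finally have "- theta_J_deriv = fsum (\<lambda>m. H (3 * m)) + fsum (\<lambda>m. H (3 * m + 1))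
      + fsum (\<lambda>m. H (3 * m + 2))"
    unfolding fsum_split3[OF nH] by simp
  moreover have "H (3 * m) = theta_J * lambert_term0 m" for m
  proof (cases "m = 0")
    case True
    then show ?thesis by (simp add: H_def double_term_eq lambert_term0_def)
  next
    case False
    \<comment> \<open>The shift of \<open>k\<close> by \<open>m\<close> removes the mixed product of
      \<open>k\<close> and \<open>m\<close> from the exponent.\<close>
    have "double_term (3 * m, k + m) = lambert_term0 m * qpow (3 * tri k + k)" for k
    proof -
      have e: "tri (3 * m) + 3 * m - (k + m) * (3 * m) + (3 * tri (k + m) + (k + m)) = (3 *
          m\<^sup>2 + m) + (3 * tri k + k)"
        using two_tri[of "3 * m"] two_tri[of "k + m"] two_tri[of k]
        by (simp add: algebra_simps power2_eq_square)
      have nz: "(3 * m = 0) = False" "(m = 0) = False" using False by simp_all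
      show ?thesis
        unfolding double_term_eq lambert_term0_def e nz if_False unfolding qpow_add[of "3 *
            m\<^sup>2 + m"] by simp
    qed
    then have "fsum (\<lambda>k. double_term (3 * m, k + m)) = lambert_term0 m * theta_J"
      by (simp only: fsum_mult_left[OF null_theta_J] theta_J_def)
    then show ?thesis
      unfolding H_def fsum_int_shift[OF null_family_section[OF null_double_term]] by (simp only:
          mult.commute)
  qed
  moreover have "H (3 * m + 1) = - (qpow 1 * theta_K) * appell_term m" for m
  proof -
    have nz: "(3 * m + 1 = 0) = False" by presburger
    have "double_term (3 * m + 1, k + m) = - qpow 1 * appell_term m * qpow (3 * tri k)" for k
    proof -
      have e: "tri (3 * m + 1) + (3 * m + 1) - (k + m) * (3 * m + 1) + (3 * tri (k + m) + (k + m))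
          = 1 + (3 * m\<^sup>2 + 3 * m) + 3 * tri k"
        using two_tri[of "3 * m + 1"] two_tri[of "k + m"] two_tri[of k]
        by (simp add: algebra_simps power2_eq_square)
      show ?thesis
        unfolding double_term_eq appell_term_def e nz if_False
        unfolding qpow_add[of _ "3 * tri k"] qpow_add[of 1 "3 * m\<^sup>2 + 3 * m"] sign_pow_add
            by simp
    qed
    then have "fsum (\<lambda>k. double_term (3 * m + 1, k + m)) = - qpow 1 * appell_term m *
        theta_K"
      by (simp only: fsum_mult_left[OF null_theta_K] theta_K_def)
    then show ?thesis
      unfolding H_def fsum_int_shift[OF null_family_section[OF null_double_term]] by (simp add:
          mult_ac)
  qed
  moreover have "H (3 * m + 2) = theta_J * lambert_term2 m" for m
  proof -
    have nz: "(3 * m + 2 = 0) = False" by presburger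
    \<comment> \<open>Besides decoupling the indices, the reflection brings the linear term into the
      form of \<open>theta_J\<close>.\<close>
    have "double_term (3 * m + 2, m + 1 - k) = lambert_term2 m * qpow (3 * tri k + k)" for k
    proof -
      have e: "tri (3 * m + 2) + (3 * m + 2) - (m + 1 - k) * (3 * m + 2) + (3 * tri (m + 1 - k) +
          (m + 1 - k))
          = (3 * m\<^sup>2 + 5 * m + 2) + (3 * tri k + k)"
        using two_tri[of "3 * m + 2"] two_tri[of "m + 1 - k"] two_tri[of k]
        by (simp add: algebra_simps power2_eq_square)
      have s: "sign_pow (3 * m + 2) = sign_pow m" by (simp add: sign_pow_eq)
      show ?thesis
        unfolding double_term_eq lambert_term2_def e s nz if_False unfolding qpow_add[of _ "3 *
            tri k + k"] by simp
    qed
    then have "fsum (\<lambda>k. double_term (3 * m + 2, m + 1 - k)) = lambert_term2 m * theta_J"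
      by (simp only: fsum_mult_left[OF null_theta_J] theta_J_def)
    moreover have "bij (\<lambda>k. m + 1 - k)" by (rule o_bij[of "\<lambda>k. m + 1 - k"]) auto
    ultimately show ?thesis
      unfolding H_def using fsum_reindex[OF null_family_section[OF null_double_term], of
          "\<lambda>k. m + 1 - k"]
      by (simp only: mult.commute)
  qed
  ultimately have "- theta_J_deriv = theta_J * fsum lambert_term0 + - (qpow 1 * theta_K) * fsum
      appell_term + theta_J * fsum lambert_term2"
    by (simp only: fsum_mult_left[OF null_Y0t] fsum_mult_left[OF null_appell_term]
        fsum_mult_left[OF null_Y2t])
  then show ?thesis by (simp add: algebra_simps)
qed

text \<open>Series in x = q^3 are kept as series in q, and \<open>subst_cube\<close> puts them back
  into q^3; after a dissection, \<open>qpow 1\<close> thus plays the role of x.\<close>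

definition subst_cube :: "complex fls \<Rightarrow> complex fls"
  where "subst_cube f = fls_compose_power f 3"

lemma subst_cube_nth: "fls_nth (subst_cube f) n = (if 3 dvd n then fls_nth f (n div 3) else 0)"
  unfolding subst_cube_def by (simp add: fls_nth_compose_power)

lemma subst_cube_simps [simp]:
  "subst_cube (f + g) = subst_cube f + subst_cube g" "subst_cube (f - g) = subst_cube f -
      subst_cube g" "subst_cube (- f) = - subst_cube f"
  "subst_cube (f * g) = subst_cube f * subst_cube g" "subst_cube (f ^ n) = subst_cube f ^ n"
      "subst_cube 1 = 1" "subst_cube 0 = 0"
  unfolding subst_cube_def by simp_all

lemma subst_cube_numeral [simp]: "subst_cube (numeral n) = numeral n"
proof -
  have "subst_cube (of_nat k) = of_nat k" for k by (induction k) simp_all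
  then show ?thesis by (metis of_nat_numeral)
qed

lemma subst_cube_qpow [simp]: "subst_cube (qpow n) = qpow (3 * n)"
  by (rule fls_eqI) (auto simp: subst_cube_nth qpow_nth)

lemma subst_cube_sign_pow [simp]: "subst_cube (sign_pow n) = sign_pow n"
  by (simp add: sign_pow_eq)

lemma subst_cube_eq_iff: "subst_cube f = subst_cube g \<longleftrightarrow> f = g"
proof
  assume e: "subst_cube f = subst_cube g"
  have "fls_nth f n = fls_nth g n" for n
    using arg_cong[OF e, of "\<lambda>h. fls_nth h (3 * n)"] by (simp add: subst_cube_nth)
  then show "f = g" by (rule fls_eqI)
qed simp

lemma subst_cube_divide [simp]: "subst_cube (f / g) = subst_cube f / subst_cube g"
proof (cases "g = 0")
  case False
  then have "subst_cube g \<noteq> 0" using subst_cube_eq_iff[of g 0] by simp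
  moreover have "subst_cube (f / g) * subst_cube g = subst_cube f"
    unfolding subst_cube_simps(4)[symmetric] using False by simp
  ultimately show ?thesis by (simp add: field_simps)
qed simp

lemma null_subst_cube: "null_family f \<Longrightarrow> null_family (\<lambda>i. subst_cube (f i))"
  unfolding null_family_def
proof
  fix N assume f: "\<forall>N. finite {i. \<not> vanishes_below N (f i)}"
  have "vanishes_below N (subst_cube (f i))" if "vanishes_below (max N 1) (f i)" for i
    unfolding vanishes_below_def
  proof (intro allI impI)
    fix n assume "n < N"
    then have "3 dvd n \<Longrightarrow> n div 3 < max N 1" by auto
    then show "fls_nth (subst_cube (f i)) n = 0" using that by (auto simp: subst_cube_nth
        vanishes_below_def)
  qed
  then have "{i. \<not> vanishes_below N (subst_cube (f i))} \<subseteq> {i. \<not>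
      vanishes_below (max N 1) (f i)}" by blast
  then show "finite {i. \<not> vanishes_below N (subst_cube (f i))}" using f finite_subset by blast
qed

lemma fsum_subst_cube: "null_family f \<Longrightarrow> fsum (\<lambda>i. subst_cube (f i)) =
    subst_cube (fsum f)"
  by (rule fls_eqI) (simp add: fsum_nth null_subst_cube subst_cube_nth)

lemma qpow_mult_nth: "fls_nth (qpow m * f) n = fls_nth f (n - m)"
  unfolding qpow_def by (simp add: fls_X_power_int fls_shifted_times_simps)

lemma dissection_unique:
  assumes "subst_cube a + qpow 1 * subst_cube b + qpow 2 * subst_cube c = subst_cube a' + qpow 1
      * subst_cube b' + qpow 2 * subst_cube c'"
  shows "a = a'" "b = b'" "c = c'"
proof -
  have e: "fls_nth (subst_cube a) n + fls_nth (subst_cube b) (n - 1) + fls_nth (subst_cube c) (n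
      - 2) =
      fls_nth (subst_cube a') n + fls_nth (subst_cube b') (n - 1) + fls_nth (subst_cube c') (n -
          2)" for n
    using arg_cong[OF assms, of "\<lambda>h. fls_nth h n"] by (simp add: qpow_mult_nth)
  have m: "\<not> 3 dvd 3 * n - 1" "\<not> 3 dvd 3 * n - 2" "\<not> 3 dvd 3 * n + 1" "\<not> 3
      dvd 3 * n + 2" for n :: int
    by presburger+
  show "a = a'"
  proof (rule fls_eqI)
    show "fls_nth a n = fls_nth a' n" for n using e[of "3 * n"] m[of n] by (simp add:
        subst_cube_nth)
  qed
  show "b = b'"
  proof (rule fls_eqI)
    show "fls_nth b n = fls_nth b' n" for n using e[of "3 * n + 1"] m[of n] by (simp add:
        subst_cube_nth)
  qed
  show "c = c'"
  proof (rule fls_eqI)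
    show "fls_nth c n = fls_nth c' n" for n using e[of "3 * n + 2"] m[of n] m(3)[of n, unfolded
        add.commute[of _ 1]] by (simp add: subst_cube_nth)
  qed
qed

lemma theta_subst_cube: "k \<ge> 1 \<Longrightarrow> subst_cube (theta k) = theta (3 * k)"
  unfolding theta_def fsum_subst_cube[OF null_theta, symmetric] by (simp add: mult.assoc)

lemma null_theta_W: "null_family (\<lambda>m. sign_pow m * qpow (6 * tri m + 5 * m))"
  by (rule triple_product_minus(1)) simp_all

text \<open>The classes 3m+1 and 3m+2 contribute equally, since 3(-m-1) + 2 = -(3m+1) and the terms
  are even; hence the factor 2.\<close>

lemma theta_dissection: "theta 1 = subst_cube (theta 3) - 2 * (qpow 1 * subst_cube theta_W)"
proof -
  let ?f = "\<lambda>n. sign_pow n * qpow (1 * n\<^sup>2)"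
  let ?w = "\<lambda>m. subst_cube (sign_pow m * qpow (6 * tri m + 5 * m))"
  have n: "null_family ?f" by (rule null_theta) simp
  have nw: "null_family ?w" by (rule null_subst_cube[OF null_theta_W])
  have "?f (3 * m) = subst_cube (sign_pow m * qpow (3 * m\<^sup>2))" for m
    by (simp add: power2_eq_square algebra_simps)
  then have 0: "fsum (\<lambda>m. ?f (3 * m)) = subst_cube (theta 3)"
    unfolding theta_def by (simp only: fsum_subst_cube[OF null_theta[of 3]])
  have w: "?f (3 * m + 1) = - qpow 1 * ?w m" for m
  proof -
    have "1 * (3 * m + 1)\<^sup>2 = 1 + 3 * (6 * tri m + 5 * m)"
      using two_tri[of m] by (simp add: power2_eq_square algebra_simps)
    then show ?thesis by (simp only: sign_pow_add sign_pow_3 sg_1 qpow_add[of 1] subst_cube_simps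
        subst_cube_sign_pow subst_cube_qpow) simp
  qed
  then have 1: "fsum (\<lambda>m. ?f (3 * m + 1)) = - qpow 1 * subst_cube theta_W"
    unfolding theta_W_def by (simp only: fsum_mult_left[OF nw] fsum_subst_cube[OF null_theta_W])
  have "?f (3 * (- m - 1) + 2) = - qpow 1 * ?w m" for m
  proof -
    have "?f (3 * (- m - 1) + 2) = ?f (3 * m + 1)"
      by (simp add: sign_pow_eq power2_eq_square algebra_simps)
    then show ?thesis using w by simp
  qed
  then have "fsum (\<lambda>m. ?f (3 * (- m - 1) + 2)) = - qpow 1 * subst_cube theta_W"
    unfolding theta_W_def by (simp only: fsum_mult_left[OF nw] fsum_subst_cube[OF null_theta_W])
  moreover have "bij (\<lambda>m::int. - m - 1)" by (rule o_bij[of "\<lambda>m. - m - 1"]) auto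
  moreover have "null_family (\<lambda>m. ?f (3 * m + 2))"
    by (rule null_family_comp_inj[OF n]) (auto intro: injI)
  ultimately have 2: "fsum (\<lambda>m. ?f (3 * m + 2)) = - qpow 1 * subst_cube theta_W"
    using fsum_reindex[of "\<lambda>m. ?f (3 * m + 2)" "\<lambda>m. - m - 1"] by simp
  show ?thesis
    unfolding theta_def[of 1] fsum_split3[OF n] 0 1 2 by simp
qed

text \<open>For n congruent to 0, 1, 2 modulo 3, n^2 + n is congruent to 0, 2, 0, and the
  denominators already contain q^3 only. So nothing falls into the class of q^1.\<close>

lemma lambert_term_dissection: "fsum lambert_term = subst_cube (fsum lambert_term0 + fsum
    lambert_term2) - qpow 2 * subst_cube (fsum appell_term)"
proof -
  have "lambert_term (3 * m) = subst_cube (lambert_term0 m)" for m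
    by (simp add: lambert_term_def lambert_term0_def power2_eq_square algebra_simps)
  then have 0: "fsum (\<lambda>m. lambert_term (3 * m)) = subst_cube (fsum lambert_term0)"
    by (simp only: fsum_subst_cube[OF null_Y0t])
  have "lambert_term (3 * m + 1) = - qpow 2 * subst_cube (appell_term m)" for m
  proof -
    have "3 * m + 1 \<noteq> 0" by presburger
    moreover have "(3 * m + 1)\<^sup>2 + (3 * m + 1) = 2 + 3 * (3 * m\<^sup>2 + 3 * m)"
      by (simp add: power2_eq_square algebra_simps)
    ultimately have "lambert_term (3 * m + 1) = sign_pow (3 * m + 1) * (qpow (2 + 3 * (3 *
        m\<^sup>2 + 3 * m)) / (1 - qpow (3 * (3 * m + 1))))"
      by (simp only: lambert_term_def if_False)
    also have "\<dots> = - qpow 2 * subst_cube (appell_term m)"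
      unfolding appell_term_def subst_cube_simps subst_cube_divide subst_cube_sign_pow
          subst_cube_qpow qpow_add[of 2] sign_pow_add sign_pow_3 sg_1 by simp
    finally show ?thesis .
  qed
  then have 1: "fsum (\<lambda>m. lambert_term (3 * m + 1)) = - qpow 2 * subst_cube (fsum
      appell_term)"
    by (simp only: fsum_mult_left[OF null_subst_cube[OF null_appell_term]] fsum_subst_cube[OF
        null_appell_term])
  have "lambert_term (3 * m + 2) = subst_cube (lambert_term2 m)" for m
  proof -
    have "3 * m + 2 \<noteq> 0" by presburger
    moreover have "(3 * m + 2)\<^sup>2 + (3 * m + 2) = 3 * (3 * m\<^sup>2 + 5 * m + 2)"
      by (simp add: power2_eq_square algebra_simps)
    moreover have "sign_pow (3 * m + 2) = sign_pow m" by (simp add: sign_pow_eq)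
    ultimately show ?thesis
      by (simp only: lambert_term_def lambert_term2_def if_False subst_cube_simps
          subst_cube_divide subst_cube_sign_pow subst_cube_qpow)
  qed
  then have 2: "fsum (\<lambda>m. lambert_term (3 * m + 2)) = subst_cube (fsum lambert_term2)"
    by (simp only: fsum_subst_cube[OF null_Y2t])
  show ?thesis unfolding fsum_split3[OF null_lambert_term] 0 1 2 by simp
qed

section \<open>The cubic theta identity and the main theorem\<close>

lemma theta_euler_plus_prod:
  assumes "k \<ge> 1"
  shows "theta k * euler_plus_prod k = euler_prod k"
proof -
  have "(theta k * euler_plus_prod k) * euler_prod k = euler_prod k * euler_prod k"
    using theta_euler_prod[OF assms] euler_plus_prod_mult_euler_prod[OF assms] by (simp add:
        power2_eq_square mult.assoc)
  then show ?thesis using EE_nz[OF assms] by simp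
qed

section \<open>Twisting by cube roots of unity\<close>

definition twist :: "complex \<Rightarrow> complex fls \<Rightarrow> complex fls"
  where "twist c f = fls_compose_fps f (fps_const c * fps_X)"

lemma twist_nth: "c \<noteq> 0 \<Longrightarrow> fls_nth (twist c f) n = fls_nth f n * c powi n"
  unfolding twist_def by (rule fls_nth_fls_compose_fps_linear)

lemma twist_simps:
  assumes "c \<noteq> 0"
  shows "twist c (f * g) = twist c f * twist c g" "twist c (f - g) = twist c f - twist c g"
    "twist c 1 = 1" "twist c (qpow n) = fls_const (c powi n) * qpow n"
proof -
  have c: "fps_const c * fps_X \<noteq> 0" "fps_nth (fps_const c * fps_X) 0 = 0" using assms by
      simp_all
  show "twist c (f * g) = twist c f * twist c g" unfolding twist_def by (rule
      fls_compose_fps_mult[OF c])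
  show "twist c (f - g) = twist c f - twist c g" unfolding twist_def by (rule
      fls_compose_fps_diff[OF c])
  show "twist c 1 = 1" unfolding twist_def by simp
  show "twist c (qpow n) = fls_const (c powi n) * qpow n"
    by (rule fls_eqI) (simp add: twist_nth[OF assms] qpow_nth)
qed

lemma converges_to_twist:
  assumes "c \<noteq> 0" "converges_to p P"
  shows "converges_to (\<lambda>n. twist c (p n)) (twist c P)"
proof -
  have "vanishes_below M (twist c (p n) - twist c P)" if "vanishes_below M (p n - P)" for M n
    unfolding twist_simps(2)[OF assms(1), symmetric] using that
    by (simp add: vanishes_below_def twist_nth[OF assms(1)])
  then show ?thesis
    using assms(2) unfolding converges_to_def by (metis (mono_tags, lifting) eventually_mono)
qed

definition \<omega> :: complex where "\<omega> = Complex (- 1 / 2) (sqrt 3 / 2)"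

lemma omega: "1 + \<omega> + \<omega>\<^sup>2 = 0" "\<omega> ^ 3 = 1" "\<omega> \<noteq> 0"
proof -
  show 1: "1 + \<omega> + \<omega>\<^sup>2 = 0"
    by (simp add: complex_eq_iff \<omega>_def power2_eq_square)
  have "\<omega> ^ 3 - 1 = (\<omega> - 1) * (1 + \<omega> + \<omega>\<^sup>2)"
    by (simp add: power2_eq_square power3_eq_cube algebra_simps)
  then show "\<omega> ^ 3 = 1" using 1 by simp
  show "\<omega> \<noteq> 0" using 1 by auto
qed

text \<open>The norm from Laurent series in q to Laurent series in q^3.\<close>

definition norm3 :: "complex fls \<Rightarrow> complex fls"
  where "norm3 f = f * twist \<omega> f * twist (\<omega>\<^sup>2) f"

lemma omega2_nz: "\<omega>\<^sup>2 \<noteq> 0"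
  using omega(3) by simp

lemma norm3_mult: "norm3 (f * g) = norm3 f * norm3 g"
  unfolding norm3_def twist_simps(1)[OF omega(3)] twist_simps(1)[OF omega2_nz] by (simp add:
      mult_ac)

lemma norm3_1 [simp]: "norm3 1 = 1"
  unfolding norm3_def twist_simps(3)[OF omega(3)] twist_simps(3)[OF omega2_nz] by simp

lemma converges_to_norm3: "converges_to p P \<Longrightarrow> converges_to (\<lambda>n. norm3 (p
    n)) (norm3 P)"
  unfolding norm3_def by (intro converges_to_mult converges_to_twist omega(3) omega2_nz)

lemma norm3_binomial:
  assumes "\<And>c. c \<noteq> 0 \<Longrightarrow> twist c a = a"
  shows "norm3 (a - b * qpow n) = (a - b * qpow n) * (a - twist \<omega> b * (fls_const (\<omega>
      powi n) * qpow n)) *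
     (a - twist (\<omega>\<^sup>2) b * (fls_const ((\<omega>\<^sup>2) powi n) * qpow n))"
  unfolding norm3_def using assms omega(3) omega2_nz by (simp add: twist_simps)

lemma omega_cubic:
  fixes a b :: "complex fls"
  shows "(a - b) * (a - fls_const \<omega> * b) * (a - fls_const (\<omega>\<^sup>2) * b) = a ^ 3
      - b ^ 3"
proof -
  define u where "u = fls_const \<omega>"
  have u: "1 + u + u\<^sup>2 = 0" "u ^ 3 = 1" "fls_const (\<omega>\<^sup>2) = u\<^sup>2"
    unfolding u_def by (simp_all add: fls_const_power[symmetric] omega(2) fls_plus_const omega(1)
        flip: fls_const_1)
  have "(a - b) * (a - u * b) * (a - u\<^sup>2 * b) =
      a ^ 3 - u ^ 3 * b ^ 3 + (1 + u + u\<^sup>2) * (a * b\<^sup>2 * u - a\<^sup>2 * b)"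
    by (simp add: power2_eq_square power3_eq_cube algebra_simps)
  then show ?thesis unfolding u(3) u_def[symmetric] by (simp add: u)
qed

lemma omega_powi:
  "\<omega> powi (3 * n) = 1" "\<omega> powi (3 * n + 1) = \<omega>" "\<omega> powi (3 * n + 2) =
      \<omega>\<^sup>2"
  "(\<omega>\<^sup>2) powi (3 * n) = 1" "(\<omega>\<^sup>2) powi (3 * n + 1) = \<omega>\<^sup>2"
      "(\<omega>\<^sup>2) powi (3 * n + 2) = \<omega>"
proof -
  have 3: "\<omega> powi (3 * m) = 1" for m
    using omega(2) by (simp add: power_int_mult)
  have sq: "(\<omega>\<^sup>2) powi m = \<omega> powi (2 * m)" for m
    by (simp add: power_int_mult)
  have e: "2 * (3 * n) = 3 * (2 * n)" "2 * (3 * n + 1) = 3 * (2 * n) + 2" "2 * (3 * n + 2) = 3 *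
      (2 * n + 1) + 1"
    by simp_all
  show "\<omega> powi (3 * n) = 1" "\<omega> powi (3 * n + 1) = \<omega>" "\<omega> powi (3 * n +
      2) = \<omega>\<^sup>2"
    "(\<omega>\<^sup>2) powi (3 * n) = 1" "(\<omega>\<^sup>2) powi (3 * n + 1) =
        \<omega>\<^sup>2" "(\<omega>\<^sup>2) powi (3 * n + 2) = \<omega>"
    unfolding sq e power_int_add[OF disjI1[OF omega(3)]] 3 by simp_all
qed

text \<open>The twists fix q^(3n), giving a cube, and permute the linear factors of 1 - e q^(3k)
  otherwise. The sign \<open>e\<close> covers both kinds of Euler products, as e^3 = e.\<close>

lemma norm3_factor:
  assumes e: "e = 1 \<or> e = - 1"
  shows "norm3 (1 - e * qpow (3 * n)) = (1 - e * qpow (3 * n)) ^ 3"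
    "norm3 (1 - e * qpow (3 * n + 1)) = 1 - e * qpow (3 * (3 * n + 1))"
    "norm3 (1 - e * qpow (3 * n + 2)) = 1 - e * qpow (3 * (3 * n + 2))"
proof -
  have tw: "twist c e = e" if "c \<noteq> 0" for c
    using e twist_simps(2)[OF that, of 0 1] twist_simps(2)[OF that, of 1 1] twist_simps(3)[OF
        that] by auto
  have e3: "e ^ 3 = e" using e by auto
  have nb: "norm3 (1 - e * qpow n) = (1 - e * qpow n) * (1 - e * (fls_const (\<omega> powi n) *
      qpow n)) *
     (1 - e * (fls_const ((\<omega>\<^sup>2) powi n) * qpow n))" for n
    using norm3_binomial[of 1 e n] tw[OF omega(3)] tw[OF omega2_nz] twist_simps(3) by simp
  show "norm3 (1 - e * qpow (3 * n)) = (1 - e * qpow (3 * n)) ^ 3"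
    unfolding nb omega_powi by (simp add: power3_eq_cube)
  have c: "(e * qpow m) ^ 3 = e * qpow (3 * m)" for m
    by (simp add: power_mult_distrib e3 qpow_power mult.commute)
  show "norm3 (1 - e * qpow (3 * n + 1)) = 1 - e * qpow (3 * (3 * n + 1))"
    using omega_cubic[of 1 "e * qpow (3 * n + 1)"] unfolding nb omega_powi c by (simp add: mult_ac)
  show "norm3 (1 - e * qpow (3 * n + 2)) = 1 - e * qpow (3 * (3 * n + 2))"
    using omega_cubic[of 1 "e * qpow (3 * n + 2)"] unfolding nb omega_powi c by (simp add: mult_ac)
qed

text \<open>Exponents prime to 3 contribute factors with exponents 3i, i prime to 3. The product
  over multiples of 9 completes these to all multiples of 3; the exponents divisible by 3 give the
  cube.\<close>

lemma norm3_prod: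
  assumes e: "e = 1 \<or> e = - 1"
  shows "norm3 (\<Prod>k<3 * N. 1 - e * qpow (1 * (int k + 1))) * (\<Prod>k<N. 1 - e * qpow (9 *
      (int k + 1))) =
     (\<Prod>k<3 * N. 1 - e * qpow (3 * (int k + 1))) * (\<Prod>k<N. 1 - e * qpow (3 * (int k +
         1))) ^ 3"
proof (induction N)
  case (Suc N)
  have s: "3 * Suc N = Suc (Suc (Suc (3 * N)))" by simp
  have i: "1 * (int (3 * N) + 1) = 3 * int N + 1" "1 * (int (Suc (3 * N)) + 1) = 3 * int N + 2"
    "1 * (int (Suc (Suc (3 * N))) + 1) = 3 * (int N + 1)"
    "3 * (int (3 * N) + 1) = 3 * (3 * int N + 1)" "3 * (int (Suc (3 * N)) + 1) = 3 * (3 * int N +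
        2)"
    "3 * (int (Suc (Suc (3 * N))) + 1) = 9 * (int N + 1)"
    by simp_all
  define a b c d x y z w where "a = norm3 (\<Prod>k<3 * N. 1 - e * qpow (1 * (int k + 1)))"
    and "b = (\<Prod>k<N. 1 - e * qpow (9 * (int k + 1)))" and "c = (\<Prod>k<3 * N. 1 - e * qpow
        (3 * (int k + 1)))"
    and "d = (\<Prod>k<N. 1 - e * qpow (3 * (int k + 1)))"
    and "x = 1 - e * qpow (3 * (3 * int N + 1))" and "y = 1 - e * qpow (3 * (3 * int N + 2))"
    and "z = 1 - e * qpow (3 * (int N + 1))" and "w = 1 - e * qpow (9 * (int N + 1))"
  have IH: "a * b = c * d ^ 3" using Suc by (simp add: a_def b_def c_def d_def)
  have "(a * x * y * z ^ 3) * (b * w) = (a * b) * (x * y * z ^ 3 * w)" by (simp add: mult_ac)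
  also have "\<dots> = (c * x * y * w) * (d * z) ^ 3" unfolding IH by (simp add:
      power_mult_distrib mult_ac)
  finally show ?case
    unfolding s prod.lessThan_Suc i norm3_mult norm3_factor[OF e]
    unfolding a_def[symmetric] b_def[symmetric] c_def[symmetric] d_def[symmetric]
      x_def[symmetric] y_def[symmetric] z_def[symmetric] w_def[symmetric] .
qed simp

lemma norm3_euler_prod: "norm3 (euler_prod 1) * euler_prod 9 = euler_prod 3 * euler_prod 3 ^ 3"
proof -
  have 1: "converges_to (\<lambda>N. norm3 (euler_partial 1 (3 * N)) * euler_partial 9 N) (norm3
      (euler_prod 1) * euler_prod 9)"
    by (intro converges_to_mult converges_to_norm3 converges_to_times converges_to_euler_partial)
        simp_all
  have 2: "norm3 (euler_partial 1 (3 * N)) * euler_partial 9 N = euler_partial 3 (3 * N) *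
      euler_partial 3 N ^ 3" for N
    using norm3_prod[of 1 N] by (simp add: euler_partial_def)
  have "converges_to (\<lambda>N. euler_partial 3 (3 * N) * euler_partial 3 N ^ 3) (euler_prod 3
      * euler_prod 3 ^ 3)"
    by (intro converges_to_mult converges_to_power converges_to_times converges_to_euler_partial)
        simp_all
  with 1[unfolded 2] show ?thesis by (rule converges_to_unique)
qed

lemma norm3_euler_plus_prod: "norm3 (euler_plus_prod 1) * euler_plus_prod 9 = euler_plus_prod 3 *
    euler_plus_prod 3 ^ 3"
proof -
  have 1: "converges_to (\<lambda>N. norm3 (euler_plus_partial 1 (3 * N)) * euler_plus_partial 9
      N) (norm3 (euler_plus_prod 1) * euler_plus_prod 9)"
    by (intro converges_to_mult converges_to_norm3 converges_to_times
        converges_to_euler_plus_partial) simp_all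
  have 2: "norm3 (euler_plus_partial 1 (3 * N)) * euler_plus_partial 9 N = euler_plus_partial 3
      (3 * N) * euler_plus_partial 3 N ^ 3" for N
    using norm3_prod[of "- 1" N] by (simp add: euler_plus_partial_def)
  have "converges_to (\<lambda>N. euler_plus_partial 3 (3 * N) * euler_plus_partial 3 N ^ 3)
      (euler_plus_prod 3 * euler_plus_prod 3 ^ 3)"
    by (intro converges_to_mult converges_to_power converges_to_times
        converges_to_euler_plus_partial) simp_all
  with 1[unfolded 2] show ?thesis by (rule converges_to_unique)
qed

lemma norm3_theta: "norm3 (theta 1) * theta 9 = theta 3 ^ 4"
proof -
  have "(norm3 (theta 1) * theta 9) * (euler_plus_prod 3 * euler_plus_prod 3 ^ 3) = norm3 (theta
      1 * euler_plus_prod 1) * (theta 9 * euler_plus_prod 9)"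
    unfolding norm3_euler_plus_prod[symmetric] norm3_mult by (simp add: mult_ac)
  also have "\<dots> = euler_prod 3 * euler_prod 3 ^ 3" by (simp add: theta_euler_plus_prod
      norm3_euler_prod)
  also have "\<dots> = theta 3 ^ 4 * (euler_plus_prod 3 * euler_plus_prod 3 ^ 3)"
    unfolding theta_euler_plus_prod[of 3, symmetric, simplified] by (simp add: power_mult_distrib
        eval_nat_numeral mult_ac)
  finally show ?thesis using MM_nz[of 3] by simp
qed

lemma twist_subst_cube:
  assumes "c \<noteq> 0" "c ^ 3 = 1"
  shows "twist c (subst_cube f) = subst_cube f"
proof (rule fls_eqI)
  fix n :: int
  have "c powi n = 1" if "3 dvd n"
    using that assms by (auto simp: power_int_mult)
  then show "fls_nth (twist c (subst_cube f)) n = fls_nth (subst_cube f) n"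
    by (simp add: twist_nth[OF assms(1)] subst_cube_nth)
qed

text \<open>Two evaluations of \<open>norm3 (theta 1)\<close>: the dissection gives the determinant
  in q^3, the products give \<open>norm3_theta\<close>. Everything is then a series in q^3, and
  \<open>subst_cube\<close> is removed.\<close>

lemma theta_cubic: "(theta 3 ^ 3 - 8 * qpow 1 * theta_W ^ 3) * theta 3 = theta 1 ^ 4"
proof -
  have w2: "(\<omega>\<^sup>2) ^ 3 = 1" 
  proof -
    have "(\<omega>\<^sup>2) ^ 3 = (\<omega> ^ 3)\<^sup>2" by (simp only: power_mult[symmetric]
        mult.commute)
    then show ?thesis using omega(2) by simp
  qed
  have t: "theta 1 = subst_cube (theta 3) - subst_cube (2 * theta_W) * qpow 1"
    unfolding theta_dissection by (simp add: mult_ac)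
  have tw: "twist \<omega> (subst_cube f) = subst_cube f" "twist (\<omega>\<^sup>2) (subst_cube
      f) = subst_cube f" for f
    by (rule twist_subst_cube[OF omega(3,2)], rule twist_subst_cube[OF omega2_nz w2])
  have "norm3 (theta 1) = (subst_cube (theta 3) - subst_cube (2 * theta_W) * qpow 1) *
      (subst_cube (theta 3) - fls_const \<omega> * (subst_cube (2 * theta_W) * qpow 1)) *
          (subst_cube (theta 3) - fls_const (\<omega>\<^sup>2) * (subst_cube (2 * theta_W) * qpow
          1))"
    unfolding t norm3_def twist_simps[OF omega(3)] twist_simps[OF omega2_nz] tw by (simp add:
        mult_ac)
  also have "\<dots> = subst_cube (theta 3) ^ 3 - (subst_cube (2 * theta_W) * qpow 1) ^ 3" by
      (rule omega_cubic)
  also have "\<dots> = subst_cube (theta 3 ^ 3 - 8 * qpow 1 * theta_W ^ 3)"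
    by (simp add: power_mult_distrib qpow_power mult_ac)
  finally have "subst_cube ((theta 3 ^ 3 - 8 * qpow 1 * theta_W ^ 3) * theta 3) = subst_cube
      (theta 1 ^ 4)"
    using norm3_theta theta_subst_cube[of 3] theta_subst_cube[of 1] by simp
  then show ?thesis by (simp only: subst_cube_eq_iff)
qed

lemma rank_diff_dissection:
  "1 + rank_gf = subst_cube (1 + rank_diff 3 0 1 0) + qpow 1 * subst_cube (rank_diff 3 0 1 1) +
      qpow 2 * subst_cube (rank_diff 3 0 1 2)"
proof -
  have R: "fls_nth (rank_diff 3 0 1 d) k =
      (if k < 0 then 0 else of_nat (Nbar 0 3 (3 * nat k + d)) - of_nat (Nbar 1 3 (3 * nat k +
          d)))" for d k
    by (simp add: rank_diff_def)
  have "fls_nth rank_gf n = fls_nth (subst_cube (rank_diff 3 0 1 0) + qpow 1 * subst_cube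
      (rank_diff 3 0 1 1) + qpow 2 * subst_cube (rank_diff 3 0 1 2)) n" for n
  proof -
    define k where "k = n div 3"
    have g: "fls_nth rank_gf n = (if n < 0 then 0 else of_nat (Nbar 0 3 (nat n)) - of_nat (Nbar 1
        3 (nat n)))"
      by (simp add: rank_gf_def)
    have nd: "\<not> 3 dvd 3 * k - 1" "\<not> 3 dvd 3 * k - 2" "\<not> 3 dvd 3 * k + 1" "\<not> 3
        dvd 3 * k + 2" "\<not> 3 dvd 1 + 3 * k" by presburger+
    have "n = 3 * k \<or> n = 3 * k + 1 \<or> n = 3 * k + 2" unfolding k_def by presburger
    then consider "n = 3 * k" | "n = 3 * k + 1" | "n = 3 * k + 2" by blast
    then show ?thesis
    proof cases
      case 1
      then show ?thesis unfolding g using nd by (auto simp: R subst_cube_nth qpow_mult_nth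
          nat_mult_distrib)
    next
      case 2
      then have "nat n = 3 * nat k + 1" if "k \<ge> 0" using that by simp
      then show ?thesis unfolding g using nd 2 by (auto simp: R subst_cube_nth qpow_mult_nth)
    next
      case 3
      then have "nat n = 3 * nat k + 2" if "k \<ge> 0" using that by simp
      then show ?thesis unfolding g using nd 3 by (auto simp: R subst_cube_nth qpow_mult_nth)
    qed
  qed
  then have "rank_gf = subst_cube (rank_diff 3 0 1 0) + qpow 1 * subst_cube (rank_diff 3 0 1 1) +
      qpow 2 * subst_cube (rank_diff 3 0 1 2)"
    by (rule fls_eqI)
  then show ?thesis by (simp add: add.assoc)
qed

theorem theorem1p1:
  fixes q :: "complex fls"
  assumes "q = fls_X"
  shows "rank_diff 3 0 1 0 =
           - 1 + (qpoch_inf (q ^ 3) (q ^ 3)) ^ 2 * qpoch_inf (- q) q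
                 / (qpoch_inf q q * (qpoch_inf (- (q ^ 3)) (q ^ 3)) ^ 2) \<and>
         rank_diff 3 0 1 1 =
           2 * qpoch_inf (q ^ 3) (q ^ 3) * qpoch_inf (q ^ 6) (q ^ 6) / qpoch_inf q q \<and>
         (\<lambda>n :: int. (- 1) powi n * q powi (3 * n ^ 2 + 3 * n) / (1 - q powi (3 * n + 1)))
           summable_on UNIV \<and>
         rank_diff 3 0 1 2 =
           4 * (qpoch_inf (- (q ^ 3)) (q ^ 3)) ^ 2 * (qpoch_inf (q ^ 6) (q ^ 6)) ^ 2
             / qpoch_inf (q ^ 2) (q ^ 2)
           - 6 * qpoch_inf (- (q ^ 3)) (q ^ 3) / qpoch_inf (q ^ 3) (q ^ 3)
             * (\<Sum>\<^sub>\<infinity>n \<in> (UNIV :: int set).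
                  (- 1) powi n * q powi (3 * n ^ 2 + 3 * n) / (1 - q powi (3 * n + 1)))"
proof -
  let ?A = "1 + rank_diff 3 0 1 0" and ?B = "rank_diff 3 0 1 1" and ?C = "rank_diff 3 0 1 2"
  let ?P = "theta 3" and ?T = "theta 1" and ?S = "fsum appell_term" and ?Y = "fsum lambert_term0
      + fsum lambert_term2"
  let ?x = "qpow 1"
  have x2: "qpow 1 * qpow 1 = qpow 2" and x3: "qpow 1 * qpow 2 = subst_cube ?x" "qpow 2 * qpow 1
      = subst_cube ?x" by (simp_all add: qpow_mult)
  \<comment> \<open>The product of the two dissections, sorted by class; the overflow q * q^2
    becomes a factor \<open>?x\<close> in class 0.\<close>
  have "subst_cube (?P * ?A - 2 * ?x * theta_W * ?C) + qpow 1 * subst_cube (?P * ?B - 2 * theta_W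
      * ?A) + qpow 2 * subst_cube (?P * ?C - 2 * theta_W * ?B)
      = ?T * (1 + rank_gf)"
    unfolding rank_diff_dissection theta_dissection subst_cube_simps subst_cube_numeral
        x2[symmetric] x3(1)[symmetric]
    by (simp only: algebra_simps)
  also have "\<dots> = subst_cube (1 + 6 * ?Y) + qpow 1 * subst_cube 0 + qpow 2 * subst_cube (- 6
      * ?S)"
    unfolding rank_gf_theta lambert_term_dissection by (simp add: algebra_simps)
  finally have eqs: "?P * ?A - 2 * ?x * theta_W * ?C = 1 + 6 * ?Y" "?P * ?B - 2 * theta_W * ?A =
      0" "?P * ?C - 2 * theta_W * ?B = - 6 * ?S"
    by (rule dissection_unique)+
  note nz = EE_nz[of 1] EE_nz[of 2] EE_nz[of 3] EE_nz[of 6] MM_nz[of 1] MM_nz[of 3]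
  have P: "?P * euler_plus_prod 3 = euler_prod 3" and T: "?T * euler_plus_prod 1 = euler_prod 1"
      by (simp_all add: theta_euler_plus_prod)
  have E2: "euler_prod 2 = euler_plus_prod 1 * euler_prod 1" and E6: "euler_prod 6 =
      euler_plus_prod 3 * euler_prod 3" using euler_plus_prod_mult_euler_prod[of 1]
      euler_plus_prod_mult_euler_prod[of 3] by simp_all
  have Pnz: "?P \<noteq> 0" and Tnz: "?T \<noteq> 0" using P T nz by auto
  have Wp: "theta_W * euler_plus_prod 1 = euler_prod 6 * euler_plus_prod 3"
  proof -
    have "(theta_W * euler_plus_prod 1) * (euler_prod 1 * euler_prod 3) = (euler_prod 6 *
        euler_plus_prod 3) * (euler_prod 1 * euler_prod 3)"
      using theta_W_euler_prod unfolding E2 by (simp add: E6 power2_eq_square mult_ac)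
    then show ?thesis using nz by simp
  qed
  \<comment> \<open>This relation matches the coefficient of the bilateral sum in
    \<open>main\<close> with the one in \<open>Appell_identity\<close>.\<close>
  have WJ: "2 * theta_W * theta_J = ?P * theta_K"
  proof -
    have "(2 * theta_W * theta_J) * (euler_plus_prod 1 * euler_plus_prod 3) = 2 * (theta_W *
        euler_plus_prod 1) * (theta_J * euler_plus_prod 3)" by (simp add: mult_ac)
    also have "\<dots> = (?P * theta_K) * (euler_plus_prod 1 * euler_plus_prod 3)"
      unfolding Wp theta_J_euler_plus_prod theta_K_euler_plus_prod E6 P[symmetric] by (simp add:
          power2_eq_square mult_ac)
    finally show ?thesis using nz by simp
  qed
  have JT: "theta_J * ?T = ?P * euler_prod 1"
  proof -
    have "(theta_J * ?T) * (euler_plus_prod 1 * euler_plus_prod 3) = (theta_J * euler_plus_prod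
        3) * (?T * euler_plus_prod 1)" by (simp add: mult_ac)
    also have "\<dots> = (?P * euler_prod 1) * (euler_plus_prod 1 * euler_plus_prod 3)"
      unfolding theta_J_euler_plus_prod T P[symmetric] by (simp add: mult_ac)
    finally show ?thesis using nz by simp
  qed
  have Jnz: "theta_J \<noteq> 0" using JT Pnz nz by auto
  \<comment> \<open>Elimination of \<open>?C\<close> and then \<open>?B\<close> from the cyclic
    system.\<close>
  have main: "?P ^ 3 * ?A - 8 * ?x * theta_W ^ 3 * ?A = ?P\<^sup>2 * (1 + 6 * ?Y) - 12 * ?x *
      theta_W * ?P * ?S"
  proof -
    have B: "?P * ?B = 2 * theta_W * ?A" and C: "?P * ?C = 2 * theta_W * ?B - 6 * ?S" using
        eqs(2,3) by (simp_all add: algebra_simps)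
    have "?P\<^sup>2 * (1 + 6 * ?Y) = ?P ^ 3 * ?A - 2 * ?x * theta_W * ?P * (?P * ?C)"
      unfolding eqs(1)[symmetric] by (simp add: power2_eq_square power3_eq_cube algebra_simps)
    also have "\<dots> = ?P ^ 3 * ?A - 4 * ?x * theta_W * theta_W * (?P * ?B) + 12 * ?x * theta_W
        * ?P * ?S"
      unfolding C by (simp add: algebra_simps)
    also have "\<dots> = ?P ^ 3 * ?A - 8 * ?x * theta_W ^ 3 * ?A + 12 * ?x * theta_W * ?P * ?S"
      unfolding B by (simp add: power3_eq_cube algebra_simps)
    finally show ?thesis by simp
  qed
  have "theta_J * (?P\<^sup>2 * (1 + 6 * ?Y) - 12 * ?x * theta_W * ?P * ?S) =
      ?P\<^sup>2 * theta_J + 6 * ?P\<^sup>2 * (theta_J * ?Y) - 6 * ?P * ?x * (2 * theta_W *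
          theta_J) * ?S"
    by (simp add: algebra_simps)
  also have "\<dots> = ?P\<^sup>2 * (theta_J + 6 * (theta_J * ?Y - ?x * theta_K * ?S))"
    unfolding WJ by (simp add: power2_eq_square algebra_simps)
  also have "\<dots> = ?P\<^sup>2 * (euler_prod 1 * ?T\<^sup>2)"
    unfolding Appell_identity using quintuple by simp
  also have "\<dots> = theta_J * (?P * ?T ^ 3)"
  proof -
    have "?P\<^sup>2 * (euler_prod 1 * ?T\<^sup>2) = ?P * ?T\<^sup>2 * (?P * euler_prod 1)" by
        (simp add: power2_eq_square mult_ac)
    then show ?thesis unfolding JT[symmetric] by (simp add: power2_eq_square power3_eq_cube mult_ac)
  qed
  finally have "(?P ^ 3 - 8 * ?x * theta_W ^ 3) * ?A = ?P * ?T ^ 3"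
    using Jnz main by (simp add: left_diff_distrib)
  \<comment> \<open>One more factor \<open>?P\<close> completes the determinant to the left-hand
    side of \<open>theta_cubic\<close>, whose value \<open>?T ^ 4\<close> then cancels against
    \<open>?T ^ 3\<close>.\<close>
  then have "((?P ^ 3 - 8 * ?x * theta_W ^ 3) * ?P) * ?A = ?P\<^sup>2 * ?T ^ 3"
    by (simp add: power2_eq_square mult_ac)
  then have "?T ^ 3 * (?T * ?A) = ?T ^ 3 * ?P\<^sup>2"
    unfolding theta_cubic by (simp add: eval_nat_numeral mult_ac)
  then have TA: "?T * ?A = ?P\<^sup>2" using Tnz by simp
  have A: "?A = euler_prod 3 ^ 2 * euler_plus_prod 1 / (euler_prod 1 * euler_plus_prod 3 ^ 2)"
    unfolding T[symmetric] P[symmetric] using TA nz Tnz by (simp add: field_simps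
        power_mult_distrib)
  \<comment> \<open>The second equation has right-hand side \<open>0\<close>, so \<open>?B\<close>
    follows from \<open>?A\<close>.\<close>
  have TB: "?T * ?B = 2 * theta_W * ?P"
  proof -
    have "?P * (?T * ?B) = ?T * (?P * ?B)" by (simp only: mult_ac)
    also have "?P * ?B = 2 * theta_W * ?A" using eqs(2) by (simp only: right_minus_eq)
    also have "?T * (2 * theta_W * ?A) = 2 * theta_W * (?T * ?A)" by (simp only: mult_ac)
    also have "\<dots> = ?P * (2 * theta_W * ?P)" unfolding TA by (simp only: mult_ac
        power2_eq_square)
    finally have "?P * (?T * ?B) = ?P * (2 * theta_W * ?P)" .
    then show ?thesis using Pnz by simp
  qed
  have B: "?B = 2 * euler_prod 3 * euler_prod 6 / euler_prod 1"
  proof -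
    have "euler_prod 1 * ?B = (?T * ?B) * euler_plus_prod 1" unfolding T[symmetric] by (simp add:
        mult_ac)
    also have "\<dots> = 2 * (theta_W * euler_plus_prod 1) * ?P" unfolding TB by (simp add: mult_ac)
    also have "\<dots> = 2 * euler_prod 6 * (?P * euler_plus_prod 3)" unfolding Wp by (simp add:
        mult_ac)
    finally show ?thesis using nz unfolding P by (simp add: field_simps)
  qed
  have C: "?C = 4 * euler_plus_prod 3 ^ 2 * euler_prod 6 ^ 2 / euler_prod 2 - 6 * euler_plus_prod
      3 / euler_prod 3 * ?S"
  proof -
    \<comment> \<open>From the third equation; here the bilateral sum stays.\<close>
    have "?P * (?T * ?C) = ?P * (4 * theta_W\<^sup>2) - 6 * ?T * ?S"
    proof -
      have "?P * (?T * ?C) = ?T * (?P * ?C)" by (simp only: mult_ac)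
      also have "?P * ?C = 2 * theta_W * ?B - 6 * ?S" using eqs(3) by (simp add: algebra_simps)
      also have "?T * (2 * theta_W * ?B - 6 * ?S) = 2 * theta_W * (?T * ?B) - 6 * ?T * ?S"
        by (simp only: right_diff_distrib mult_ac)
      finally have "?P * (?T * ?C) = 2 * theta_W * (?T * ?B) - 6 * ?T * ?S" .
      then show ?thesis unfolding TB by (simp add: power2_eq_square algebra_simps)
    qed
    then have "?C = 4 * theta_W\<^sup>2 / ?T - 6 / ?P * ?S"
      using Pnz Tnz by (simp add: field_simps)
    moreover have "4 * theta_W\<^sup>2 / ?T = 4 * euler_plus_prod 3 ^ 2 * euler_prod 6 ^ 2 /
        euler_prod 2"
    proof -
      have "4 * theta_W\<^sup>2 * euler_prod 2 = 4 * (theta_W * euler_plus_prod 1)\<^sup>2 * ?T"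
        unfolding E2 T[symmetric] by (simp add: power2_eq_square mult_ac)
      also have "\<dots> = 4 * euler_plus_prod 3 ^ 2 * euler_prod 6 ^ 2 * ?T" unfolding Wp by
          (simp add: power2_eq_square mult_ac)
      finally show ?thesis using Tnz nz(2) by (simp add: frac_eq_eq)
    qed
    moreover have "6 / ?P = 6 * euler_plus_prod 3 / euler_prod 3"
      unfolding P[symmetric] using nz by (simp add: field_simps)
    ultimately show ?thesis by simp
  qed
  have q: "q = qpow 1" "q ^ 2 = qpow 2" "q ^ 3 = qpow 3" "q ^ 6 = qpow 6"
    unfolding assms fls_X_power_qpow by (simp_all add: qpow_def)
  have s: "(\<lambda>n. (- 1) powi n * q powi (3 * n ^ 2 + 3 * n) / (1 - q powi (3 * n + 1))) =
      appell_term"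
    unfolding appell_term_def sign_pow_def qpow_def assms times_divide_eq_right ..
  have hs: "appell_term summable_on UNIV" "infsum appell_term UNIV = ?S"
    using has_sum_fsum[OF null_appell_term] by (simp_all add: has_sum_iff)
  have "rank_diff 3 0 1 0 = - 1 + euler_prod 3 ^ 2 * euler_plus_prod 1 / (euler_prod 1 *
      euler_plus_prod 3 ^ 2)"
    using A by (simp add: algebra_simps)
  then show ?thesis
    using B C hs unfolding s q(2-4) unfolding q(1) euler_prod_def euler_plus_prod_def by simp
qed

end
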